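(* There is a randomized polynomial-time Turing (oracle) reduction from Non-Divisibility-$\mathbb{Z}$ to Non-Divisibility-$\mathbb{F}_q$. That is, the problem of deciding, for sparse $f,g\in\mathbb{Z}[x]$, whether $g$ does not divide $f$ in $\mathbb{Z}[x]$ reduces in randomized polynomial time (in the sparse binary input length, with bounded error) to the problem of deciding, for a finite field $\mathbb{F}_q$ and sparse $f,g\in\mathbb{F}_q[x]$, whether $g$ does not divide $f$ in $\mathbb{F}_q[x]$.
   Context: For a ring $R$, Non-Divisibility-$R$ is the problem of deciding whether a sparse polynomial $g\in R[x]$ does not divide another sparse polynomial $f\in R[x]$; here $g\mid f$ means $f=gh$ for some $h\in R[x]$ (so $0\mid f$ if and only if $f=0$). In Non-Divisibility-$\mathbb{F}_q$ the finite field is part of the instance (a prime field is given by its prime $p$ in binary). Sparse polynomials are given as lists of nonzero coefficients with associated exponents, with coefficients and exponents written in binary; the sparse input length is the bit length of this encoding. The reduction is a randomized polynomial-time Turing reduction to the finite-field non-divisibility oracle: a randomized polynomial-time procedure that may query the oracle and whose answer is correct with probability at least $2/3$ on every input. In branches where the integer-side answer has already been determined, the reduction may return directly; equivalently, those branches may be encoded by fixed oracle instances over $\mathbb{F}_2$, for instance the pair $(g,f)=(0,1)$ for a YES instance and $(g,f)=(1,0)$ for a NO instance. *)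

theory Defs
  imports
    "HOL-Number_Theory.Residues"
    "HOL-Algebra.IntRing"
    "HOL-Algebra.UnivPoly"
    "HOL-Algebra.QuotRing"
    "HOL-Algebra.Ring_Divisibility"
    "HOL-Probability.Probability_Mass_Function"
begin

section \<open>Binary encodings\<close>

text \<open>Little-endian binary expansion, without superfluous zeros; the expansion of 0 is empty.\<close>

fun bits_of :: "nat \<Rightarrow> bool list" where
  "bits_of n = (if n = 0 then [] else odd n # bits_of (n div 2))"

declare bits_of.simps [simp del]

text \<open>
  All codes below are prefix-free, so that a concatenation of codes can be decoded uniquely.
  Each digit and each list entry is announced by the bit \<^term>\<open>True\<close>, and \<^term>\<open>False\<close> marks
  the end; the code is linear in the total bit length of the data.
\<close>

definition enc_list :: "('a \<Rightarrow> bool list) \<Rightarrow> 'a list \<Rightarrow> bool list" where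
  "enc_list e xs = concat (map (\<lambda>x. True # e x) xs) @ [False]"

definition enc_nat :: "nat \<Rightarrow> bool list" where
  "enc_nat n = enc_list (\<lambda>b. [b]) (bits_of n)"

definition enc_int :: "int \<Rightarrow> bool list" where
  "enc_int k = (k < 0) # enc_nat (nat \<bar>k\<bar>)"

definition enc_sparse :: "('a \<Rightarrow> bool list) \<Rightarrow> ('a \<times> nat) list \<Rightarrow> bool list" where
  "enc_sparse e ts = enc_list (\<lambda>(c, n). e c @ enc_nat n) ts"


section \<open>Sparse polynomials and non-divisibility\<close>

text \<open>
  A sparse polynomial is a list of (coefficient, exponent) pairs with distinct exponents, in any
  order, whose coefficients are (representations of) nonzero elements of the coefficient ring.
  The zero polynomial is the empty list.
\<close>

definition sparse_list :: "('a \<Rightarrow> bool) \<Rightarrow> ('a \<times> nat) list \<Rightarrow> bool" where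
  "sparse_list nonzero ts \<longleftrightarrow> distinct (map snd ts) \<and> (\<forall>(c, n) \<in> set ts. nonzero c)"

definition sparse_poly :: "('a, 'm) ring_scheme \<Rightarrow> ('a \<times> nat) list \<Rightarrow> nat \<Rightarrow> 'a" where
  "sparse_poly R ts =
     (\<Oplus>\<^bsub>UP R\<^esub> j \<in> {..<length ts}. up_ring.monom (UP R) (fst (ts ! j)) (snd (ts ! j)))"

definition dense_poly :: "('a, 'm) ring_scheme \<Rightarrow> 'a list \<Rightarrow> nat \<Rightarrow> 'a" where
  "dense_poly R cs = sparse_poly R (zip cs [0..<length cs])"

definition non_divides ::
  "('a, 'm) ring_scheme \<Rightarrow> ('a \<times> nat) list \<Rightarrow> ('a \<times> nat) list \<Rightarrow> bool" where
  "non_divides R g f \<longleftrightarrow> \<not> (sparse_poly R g divides\<^bsub>UP R\<^esub> sparse_poly R f)"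

text \<open>
  Decision problems are languages of bit strings: the set of the encodings of the YES instances.
  A string that does not encode an instance is a NO instance.
\<close>

definition nondiv_Z :: "bool list set" where
  "nondiv_Z = {enc_sparse enc_int g @ enc_sparse enc_int f | g f.
     sparse_list (\<lambda>c. c \<noteq> 0) g \<and> sparse_list (\<lambda>c. c \<noteq> 0) f \<and> non_divides \<Z> g f}"

text \<open>
  A finite field is presented either by a prime \<open>p\<close>, the elements being the integers in
  \<open>{0..<p}\<close>, or by a prime \<open>p\<close> together with the coefficient list (lowest degree first) of a
  monic irreducible polynomial \<open>mu\<close> over the prime field. In the second case the field is the
  quotient ring modulo \<open>mu\<close>, and an element is represented by the list of the \<open>deg mu\<close>
  coefficients of its reduced representative.
\<close>

abbreviation prime_field :: "nat \<Rightarrow> int ring" where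
  "prime_field p \<equiv> residue_ring (int p)"

definition prime_field_coeff :: "nat \<Rightarrow> int \<Rightarrow> bool" where
  "prime_field_coeff p c \<longleftrightarrow> c \<in> carrier (prime_field p) \<and> c \<noteq> 0"

definition ext_modulus :: "nat \<Rightarrow> int list \<Rightarrow> bool" where
  "ext_modulus p mu \<longleftrightarrow> mu \<noteq> [] \<and> set mu \<subseteq> carrier (prime_field p) \<and> last mu = 1 \<and>
     ring_irreducible\<^bsub>UP (prime_field p)\<^esub> (dense_poly (prime_field p) mu)"

definition ext_ideal :: "nat \<Rightarrow> int list \<Rightarrow> (nat \<Rightarrow> int) set" where
  "ext_ideal p mu = PIdl\<^bsub>UP (prime_field p)\<^esub> (dense_poly (prime_field p) mu)"

definition ext_field :: "nat \<Rightarrow> int list \<Rightarrow> (nat \<Rightarrow> int) set ring" where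
  "ext_field p mu = UP (prime_field p) Quot ext_ideal p mu"

definition ext_elem :: "nat \<Rightarrow> int list \<Rightarrow> int list \<Rightarrow> (nat \<Rightarrow> int) set" where
  "ext_elem p mu cs = ext_ideal p mu +>\<^bsub>UP (prime_field p)\<^esub> dense_poly (prime_field p) cs"

definition ext_field_coeff :: "nat \<Rightarrow> int list \<Rightarrow> int list \<Rightarrow> bool" where
  "ext_field_coeff p mu cs \<longleftrightarrow>
     length cs = length mu - 1 \<and> set cs \<subseteq> carrier (prime_field p) \<and> (\<exists>c \<in> set cs. c \<noteq> 0)"

definition nondiv_Fq_prime :: "bool list set" where
  "nondiv_Fq_prime =
     {False # enc_nat p @ enc_sparse enc_int g @ enc_sparse enc_int f | p g f.
        Factorial_Ring.prime p \<and>
        sparse_list (prime_field_coeff p) g \<and> sparse_list (prime_field_coeff p) f \<and>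
        non_divides (prime_field p) g f}"

definition nondiv_Fq_ext :: "bool list set" where
  "nondiv_Fq_ext =
     {True # enc_nat p @ enc_list enc_int mu @
        enc_sparse (enc_list enc_int) g @ enc_sparse (enc_list enc_int) f | p mu g f.
        Factorial_Ring.prime p \<and> ext_modulus p mu \<and>
        sparse_list (ext_field_coeff p mu) g \<and> sparse_list (ext_field_coeff p mu) f \<and>
        non_divides (ext_field p mu)
          (map (\<lambda>(c, n). (ext_elem p mu c, n)) g) (map (\<lambda>(c, n). (ext_elem p mu c, n)) f)}"

definition nondiv_Fq :: "bool list set" where
  "nondiv_Fq = nondiv_Fq_prime \<union> nondiv_Fq_ext"


section \<open>Randomized polynomial-time oracle computation\<close>

text \<open>
  The machine model is the random access machine of Aho, Hopcroft and Ullman under the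
  logarithmic cost criterion, with structured control flow, a coin-flipping instruction and an
  oracle instruction. It is polynomially equivalent to probabilistic oracle Turing machines:
  every operation is charged the bit lengths of its operands, its result and the addresses it
  uses, so a run of cost \<open>t\<close> only handles integers of at most \<open>t\<close> bits. The memory consists of
  finitely many named arrays of integers (a program mentions only finitely many names); a scalar
  variable is entry 0 of its array.
\<close>

type_synonym store = "string \<Rightarrow> nat \<Rightarrow> int"

datatype aexp =
    Num int
  | Get string aexp
  | Add aexp aexp
  | Sub aexp aexp
  | Mul aexp aexp
  | Div aexp aexp
  | Less aexp aexp

primrec aval :: "aexp \<Rightarrow> store \<Rightarrow> int" where
  "aval (Num k) s = k"
| "aval (Get x i) s = s x (nat (aval i s))"
| "aval (Add a b) s = aval a s + aval b s"
| "aval (Sub a b) s = aval a s - aval b s"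
| "aval (Mul a b) s = aval a s * aval b s"
| "aval (Div a b) s = aval a s div aval b s"
| "aval (Less a b) s = of_bool (aval a s < aval b s)"

definition int_size :: "int \<Rightarrow> nat" where
  "int_size k = 1 + length (bits_of (nat \<bar>k\<bar>))"

primrec acost :: "aexp \<Rightarrow> store \<Rightarrow> nat" where
  "acost (Num k) s = int_size k"
| "acost (Get x i) s = acost i s + int_size (aval (Get x i) s)"
| "acost (Add a b) s = acost a s + acost b s + int_size (aval (Add a b) s)"
| "acost (Sub a b) s = acost a s + acost b s + int_size (aval (Sub a b) s)"
| "acost (Mul a b) s = acost a s + acost b s + int_size (aval (Mul a b) s)"
| "acost (Div a b) s = acost a s + acost b s + int_size (aval (Div a b) s)"
| "acost (Less a b) s = acost a s + acost b s + int_size (aval (Less a b) s)"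

text \<open>
  \<open>Put x i a\<close> stores the value of \<open>a\<close> in entry \<open>i\<close> of \<open>x\<close>. \<open>Flip x\<close> stores a random bit in \<open>x\<close>.
  \<open>Query x y a\<close> asks the oracle about the string held in the first \<open>a\<close> entries of \<open>y\<close> (a nonzero
  entry stands for \<^term>\<open>True\<close>) and stores the answer in \<open>x\<close>. A condition holds if its value is nonzero.
\<close>

datatype com =
    Skip
  | Put string aexp aexp
  | Flip string
  | Query string string aexp
  | Then com com
  | Cond aexp com com
  | Loop aexp com

definition upd :: "store \<Rightarrow> string \<Rightarrow> nat \<Rightarrow> int \<Rightarrow> store" where
  "upd s x i k = s(x := (s x)(i := k))"

text \<open>
  \<open>exec Q c (s, r) t (s', r')\<close>: with oracle \<open>Q\<close>, the program \<open>c\<close> started in store \<open>s\<close> with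
  the coin tosses \<open>r\<close> still to come halts at cost \<open>t\<close> in store \<open>s'\<close>, with \<open>r'\<close> unused. A coin
  toss is impossible once the supply is exhausted.
\<close>

inductive exec ::
  "bool list set \<Rightarrow> com \<Rightarrow> store \<times> bool list \<Rightarrow> nat \<Rightarrow> store \<times> bool list \<Rightarrow> bool"
  for Q :: "bool list set" where
  Skip: "exec Q Skip (s, r) 1 (s, r)"
| Put: "exec Q (Put x i a) (s, r) (1 + acost i s + acost a s)
          (upd s x (nat (aval i s)) (aval a s), r)"
| Flip: "exec Q (Flip x) (s, b # r) 1 (upd s x 0 (of_bool b), r)"
| Query: "exec Q (Query x y a) (s, r) (1 + acost a s + nat (aval a s))
            (upd s x 0 (of_bool (map (\<lambda>i. s y i \<noteq> 0) [0..<nat (aval a s)] \<in> Q)), r)"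
| Then: "\<lbrakk>exec Q c1 u t1 v; exec Q c2 v t2 w\<rbrakk> \<Longrightarrow> exec Q (Then c1 c2) u (1 + t1 + t2) w"
| Cond_True: "\<lbrakk>aval a s \<noteq> 0; exec Q c1 (s, r) t v\<rbrakk> \<Longrightarrow>
    exec Q (Cond a c1 c2) (s, r) (1 + acost a s + t) v"
| Cond_False: "\<lbrakk>aval a s = 0; exec Q c2 (s, r) t v\<rbrakk> \<Longrightarrow>
    exec Q (Cond a c1 c2) (s, r) (1 + acost a s + t) v"
| Loop_False: "aval a s = 0 \<Longrightarrow> exec Q (Loop a c) (s, r) (1 + acost a s) (s, r)"
| Loop_True: "\<lbrakk>aval a s \<noteq> 0; exec Q c (s, r) t1 v; exec Q (Loop a c) v t2 w\<rbrakk> \<Longrightarrow>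
    exec Q (Loop a c) (s, r) (1 + acost a s + t1 + t2) w"

definition init_store :: "bool list \<Rightarrow> store" where
  "init_store w = (\<lambda>x i.
     if x = ''in'' \<and> i < length w then of_bool (w ! i)
     else if x = ''len'' \<and> i = 0 then int (length w)
     else 0)"

definition accepting :: "store \<Rightarrow> bool" where
  "accepting s \<longleftrightarrow> s ''out'' 0 \<noteq> 0"

text \<open>
  Since every toss costs 1, a run of cost at most \<open>m\<close> consults at most the first \<open>m\<close> of its
  coin tosses; so \<open>m\<close> uniform tosses determine the run. The time bound holds for all outcomes of
  the tosses, the answer may be wrong with probability at most 1/3.
\<close>

definition rand_poly_turing_reducible :: "bool list set \<Rightarrow> bool list set \<Rightarrow> bool" where
  "rand_poly_turing_reducible A B \<longleftrightarrow>
     (\<exists>(c :: com) (q :: nat poly). \<forall>w.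
        let m = poly q (length w); coins = {r :: bool list. length r = m} in
          (\<forall>r \<in> coins. \<exists>t \<le> m. \<exists>s r'. exec B c (init_store w, r) t (s, r')) \<and>
          measure_pmf.prob (pmf_of_set coins)
            {r. \<exists>t s r'. exec B c (init_store w, r) t (s, r') \<and> (accepting s \<longleftrightarrow> w \<in> A)} \<ge> 2 / 3)"

end

theory Submission
  imports Defs "HOL-Computational_Algebra.Polynomial_Factorial"
begin

text \<open>
  \<open>g\<close> divides \<open>f\<close> over the integers iff it does so over the rationals and the content of \<open>g\<close>
  divides that of \<open>f\<close>. The contents are compared directly, with Euclid's algorithm. If \<open>g\<close> does not
  divide \<open>f\<close> over the rationals, then the pseudo-remainder of \<open>f\<close> by \<open>g\<close> has a nonzero coefficient
  of at most exponential bit length, and every prime \<open>p\<close> that divides neither this coefficient nor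
  the leading coefficient of \<open>g\<close> witnesses the non-divisibility modulo \<open>p\<close>. By Chebyshev's bound,
  applied to \<open>lcm(1, \<dots>, 2^N)\<close>, a random \<open>N\<close>-bit number is such a prime with probability at least
  \<open>1 / (2N)\<close> once \<open>N\<close> is a large multiple of the input length, so \<open>N\<^sup>2\<close> trials suffice. No primality
  test is needed: a query with a composite \<open>p\<close> is not an instance, hence answered negatively, and a
  positive answer is always a proof of non-divisibility.

  For the running time, all programs are built from a loop that is repeated a fixed number \<open>N\<close> of
  times, and their only products are those in \<open>a mod b\<close>. Then the number of steps is polynomial for
  syntactic reasons, and so is the bit length of all values.
\<close>
subsection \<open>Primes\<close>

text \<open>Contents need the integer side because reduction modulo a prime loses them: 2 does not
  divide 1, but it is a unit modulo every odd prime. The exponential bit length stems from the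
  binary exponents: the degree of \<open>f\<close> can be close to 2^n, and each of up to deg f + 1
  elimination steps multiplies the bound on the coefficients by 2C. A nonzero number below 2^b has
  at most b prime divisors; with b = 2^(4(n+1)) these are few among the primes of 16(n+1) bits. A
  useful prime must also avoid every coefficient of \<open>f\<close> and \<open>g\<close>, since a
  sparse list has no zero coefficients. Divisibility modulo \<open>p\<close> is expressed as
  \<open>[:p:] dvd f - g * h\<close>, so that the polynomial algebra stays in
  \<open>int poly\<close>. The time bound must hold for malformed inputs and unlucky coins too. It
  is therefore separated from correctness: cost is bounded by the syntactic \<open>weight\<close>,
  and correctness is proved for the total semantics \<open>den\<close>. Correctness itself also has
  a part valid for arbitrary inputs: all parsed numbers fit into \<open>N\<close> bits, so writing
  them back is faithful whatever the parser has read.\<close>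

lemma Lcm_Suc: "Lcm {1..Suc n} = lcm (Suc n) (Lcm {1..n::nat})"
proof -
  have "{1..Suc n} = insert (Suc n) {1..n}" by auto
  then show ?thesis by simp
qed

lemma Lcm_pos: "Lcm {1..n::nat} > 0"
proof (induction n)
  case (Suc n)
  then show ?case unfolding Lcm_Suc by (intro lcm_pos_nat) auto
qed simp

text \<open>Induction on \<open>k\<close>. The reciprocals of \<open>k * (n choose k)\<close> form
  Leibniz's harmonic triangle: the entry at (n, k+1) is the entry at (n-1, k) minus the entry at (n,
  k). A common multiple of the two old denominators, with quotients \<open>a\<close> and
  \<open>b\<close>, is therefore \<open>a - b\<close> times the new one.\<close>

lemma binomial_dvd_Lcm: "1 \<le> k \<Longrightarrow> k \<le> n \<Longrightarrow> k * (n choose k) dvd Lcm {1..n}"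
proof (induction k arbitrary: n rule: nat_induct_at_least)
  case base
  then show ?case by (auto intro: dvd_Lcm)
next
  case (Suc k)
  then obtain m where n: "n = Suc m" and m: "k \<le> m" by (cases n) auto
  define L where "L = Lcm {1..n}"
  have "k * (m choose k) dvd Lcm {1..m}" using Suc m by auto
  also have "\<dots> dvd L" unfolding L_def n Lcm_Suc by simp
  finally obtain a where a: "L = k * (m choose k) * a" by (elim dvdE)
  have "k * (n choose k) dvd L" using Suc unfolding L_def by auto
  then obtain b where b: "L = k * (n choose k) * b" by (elim dvdE)
  have kn: "Suc k * (n choose Suc k) = n * (m choose k)" unfolding n by (metis mult.commute Suc_times_binomial_eq)
  have abs: "(n - k) * (n choose k) = n * (m choose k)"
    using binomial_absorb_comp[of n k] n by simp
  \<comment> \<open>the recurrence of Leibniz's harmonic triangle\<close>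
  have "int L = int (Suc k * (n choose Suc k)) * (int a - int b)"
  proof -
    have ch: "m choose k > 0" using m by simp
    have "int k * int (m choose k) * int a * int n = int n * int L" using a by (simp add: mult_ac)
    moreover have "int n * int (m choose k) * int k * int b = int (n - k) * int L"
    proof -
      have "n * (m choose k) * k * b = (n - k) * L" unfolding b abs[symmetric] by (simp add: mult_ac)
      then show ?thesis by (metis of_nat_mult)
    qed
    ultimately have "int n * int (m choose k) * (int a - int b) * int k = int k * int L"
      using Suc.prems n by (simp add: algebra_simps of_nat_diff)
    then have "int n * int (m choose k) * (int a - int b) = int L"
      using Suc.hyps by simp
    then show ?thesis unfolding kn by simp
  qed
  then have "int (Suc k * (n choose Suc k)) dvd int L" by (rule dvdI)
  then show ?case unfolding L_def by (simp only: int_dvd_int_iff)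
qed

text \<open>By absorption, \<open>n * (m choose k)\<close> divides the lcm for each of the
  \<open>n\<close> values \<open>k \<le> m\<close>. Summing the resulting inequalities gives
  \<open>n * 2 ^ m\<close> against \<open>n\<close> copies of the lcm.\<close>

lemma two_power_le_Lcm: "n \<ge> 1 \<Longrightarrow> 2 ^ (n - 1) \<le> Lcm {1..n::nat}"
proof -
  assume "n \<ge> 1"
  then obtain m where n: "n = Suc m" by (cases n) auto
  have "n * (m choose k) \<le> Lcm {1..n}" if "k \<le> m" for k
  proof -
    have "Suc k * (n choose Suc k) dvd Lcm {1..n}" by (rule binomial_dvd_Lcm) (use that n in auto)
    then have "Suc k * (n choose Suc k) \<le> Lcm {1..n}" using Lcm_pos by (rule dvd_imp_le)
    moreover have "Suc k * (n choose Suc k) = n * (m choose k)" unfolding n by (metis mult.commute Suc_times_binomial_eq)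
    ultimately show ?thesis by simp
  qed
  then have "(\<Sum>k\<le>m. n * (m choose k)) \<le> (\<Sum>k\<le>m. Lcm {1..n})" by (intro sum_mono) auto
  then have "n * 2 ^ m \<le> n * Lcm {1..n}"
    by (simp only: sum_distrib_left[symmetric] choose_row_sum) (simp add: n)
  then show ?thesis unfolding n mult_le_cancel1 by simp
qed

text \<open>The multiplicity in an lcm is a maximum, hence attained at a single number up to
  \<open>n\<close>, which the prime power divides. The second disjunct covers \<open>n = 0\<close>,
  where the power is 1.\<close>

lemma prime_power_dvd_Lcm:
  "Factorial_Ring.prime (p::nat) \<Longrightarrow> p ^ multiplicity p (Lcm {1..n}) \<le> n \<or> multiplicity p (Lcm {1..n}) = 0"
proof (induction n)
  case (Suc n)
  have m: "multiplicity p (Lcm {1..Suc n}) = max (multiplicity p (Suc n)) (multiplicity p (Lcm {1..n}))"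
    unfolding Lcm_Suc using Lcm_pos[of n] Suc.prems by (intro multiplicity_lcm) auto
  have "p ^ multiplicity p (Suc n) \<le> Suc n" by (rule dvd_imp_le[OF multiplicity_dvd]) simp
  then show ?case using Suc unfolding m by (auto simp: max_def)
qed simp

text \<open>In the prime factorization of the lcm only primes up to \<open>n\<close> occur, and each
  contributes a prime power of at most \<open>n\<close>.\<close>

lemma Lcm_le_power_card_primes: "Lcm {1..n::nat} \<le> n ^ card {p. Factorial_Ring.prime p \<and> p \<le> n}"
  if n: "n \<ge> 1"
proof -
  define L where "L = Lcm {1..n}"
  have fin: "finite {p::nat. Factorial_Ring.prime p \<and> p \<le> n}" by (rule finite_subset[of _ "{..n}"]) auto
  have sub: "prime_factors L \<subseteq> {p. Factorial_Ring.prime p \<and> p \<le> n}"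
  proof
    fix p assume p: "p \<in> prime_factors L"
    then have pp: "Factorial_Ring.prime p" and m: "multiplicity p L \<noteq> 0" by (auto simp: prime_factors_multiplicity)
    have "p ^ 1 \<le> p ^ multiplicity p L" using m pp by (intro power_increasing) (auto simp: prime_gt_0_nat Suc_leI)
    then show "p \<in> {p. Factorial_Ring.prime p \<and> p \<le> n}"
      using prime_power_dvd_Lcm[OF pp, of n] m pp by (auto simp: L_def)
  qed
  have "L = (\<Prod>p\<in>prime_factors L. p ^ multiplicity p L)"
    using prime_factorization_nat[of L] Lcm_pos[of n] by (simp add: L_def)
  also have "\<dots> \<le> (\<Prod>p\<in>prime_factors L. n)"
  proof (intro prod_mono conjI)
    fix p assume "p \<in> prime_factors L"
    then show "p ^ multiplicity p L \<le> n"
      using prime_power_dvd_Lcm[of p n] unfolding L_def[symmetric] by (auto simp: prime_factors_multiplicity)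
  qed auto
  also have "\<dots> = n ^ card (prime_factors L)" by simp
  also have "\<dots> \<le> n ^ card {p. Factorial_Ring.prime p \<and> p \<le> n}"
    using n by (intro power_increasing card_mono sub fin) auto
  finally show ?thesis by (simp add: L_def)
qed

text \<open>Chebyshev's lower bound at powers of two: there both estimates of the lcm are powers of
  2, so it suffices to compare exponents.\<close>

lemma card_primes_ge:
  assumes "N \<ge> 2"
  shows "2 ^ N \<le> N * card {p::nat. Factorial_Ring.prime p \<and> p < 2 ^ N} + 1"
proof -
  have "\<not> Factorial_Ring.prime ((2::nat) ^ N)" using assms by (auto simp: prime_power_iff)
  then have e: "{p::nat. Factorial_Ring.prime p \<and> p \<le> 2 ^ N} = {p. Factorial_Ring.prime p \<and> p < 2 ^ N}"
    by (auto simp: le_less)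
  have "(2::nat) ^ (2 ^ N - 1) \<le> (2 ^ N) ^ card {p::nat. Factorial_Ring.prime p \<and> p < 2 ^ N}"
    using order.trans[OF two_power_le_Lcm[of "2 ^ N"] Lcm_le_power_card_primes[of "2 ^ N"]]
    unfolding e by simp
  also have "\<dots> = 2 ^ (N * card {p::nat. Factorial_Ring.prime p \<and> p < 2 ^ N})" by (simp add: power_mult)
  finally show ?thesis by (simp add: le_diff_conv)
qed

text \<open>A nonzero number is at least the product of its distinct prime divisors, each of which
  is at least 2.\<close>

lemma card_prime_divisors:
  assumes "D \<noteq> (0::nat)" "D < 2 ^ b"
  shows "finite {p. Factorial_Ring.prime p \<and> p dvd D}" "card {p. Factorial_Ring.prime p \<and> p dvd D} \<le> b"
proof -
  have e: "{p. Factorial_Ring.prime p \<and> p dvd D} = prime_factors D" using assms by (auto simp: prime_factors_dvd)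
  show "finite {p. Factorial_Ring.prime p \<and> p dvd D}" unfolding e by simp
  have "2 ^ card (prime_factors D) = (\<Prod>p\<in>prime_factors D. 2)" by simp
  also have "\<dots> \<le> (\<Prod>p\<in>prime_factors D. p ^ multiplicity p D)"
  proof (intro prod_mono conjI)
    fix p assume "p \<in> prime_factors D"
    then have "p \<ge> 2" "multiplicity p D \<ge> 1" by (auto simp: prime_factors_multiplicity prime_ge_2_nat)
    then have "2 \<le> p ^ 1" by simp
    also have "\<dots> \<le> p ^ multiplicity p D" using \<open>p \<ge> 2\<close> \<open>multiplicity p D \<ge> 1\<close> by (intro power_increasing) auto
    finally show "2 \<le> p ^ multiplicity p D" .
  qed auto
  also have "\<dots> = D" using assms prime_factorization_nat[of D] by simp
  finally have "(2::nat) ^ card (prime_factors D) < 2 ^ b" using assms by linarith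
  then show "card {p. Factorial_Ring.prime p \<and> p dvd D} \<le> b" unfolding e by (auto dest: power_less_imp_less_exp)
qed

lemma card_good_primes:
  assumes "N = 16 * (n + 1)" "D \<noteq> (0::nat)" "D < 2 ^ (2 ^ (4 * (n + 1)))"
  shows "2 ^ N \<le> 2 * N * card {p::nat. Factorial_Ring.prime p \<and> p < 2 ^ N \<and> \<not> p dvd D}"
proof -
  define b :: nat where "b = 2 ^ (4 * (n + 1))"
  define P where "P = {p::nat. Factorial_Ring.prime p \<and> p < 2 ^ N}"
  define E where "E = {p::nat. Factorial_Ring.prime p \<and> p dvd D}"
  define G where "G = {p::nat. Factorial_Ring.prime p \<and> p < 2 ^ N \<and> \<not> p dvd D}"
  have fin: "finite P" "finite G" "finite E" and E: "card E \<le> b"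
    using card_prime_divisors[of D b] assms unfolding P_def G_def E_def b_def by (auto intro: finite_subset[of _ "{..<2^N}"])
  have "card P \<le> card (G \<union> E)" by (rule card_mono) (use fin in \<open>auto simp: P_def G_def E_def\<close>)
  also have "\<dots> \<le> card G + b" using card_Un_le[of G E] E by simp
  finally have 1: "N * card P \<le> N * card G + N * b" by (metis mult_le_mono2 distrib_left)
  have 2: "2 ^ N \<le> N * card P + 1" using card_primes_ge[of N] assms unfolding P_def by simp
  \<comment> \<open>Half of \<open>2 ^ N\<close> absorbs the primes dividing \<open>D\<close>: by
    \<open>k < 2 ^ k\<close> the left side is at most \<open>2 ^ (6 + 5 * k)\<close>, and
    \<open>6 + 5 * k \<le> 16 * k\<close>.\<close>
  have "2 * (N * b + 1) \<le> 2 ^ N"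
  proof -
    define k where "k = n + 1"
    have N: "N = 16 * k" and b: "b = 2 ^ (4 * k)" and k: "k \<ge> 1" using assms by (auto simp: k_def b_def)
    have "k < 2 ^ k" by (rule less_exp)
    then have "2 * (N * b + 1) \<le> 2 * (16 * 2 ^ k * b + 16 * 2 ^ k * b)"
      unfolding N by (intro mult_le_mono2 add_mono mult_le_mono1) (auto simp: b)
    also have "\<dots> = 2 ^ (6 + k + 4 * k)" by (simp only: b power_add) simp
    also have "\<dots> \<le> 2 ^ N" unfolding N using k by (intro power_increasing) auto
    finally show ?thesis .
  qed
  then show ?thesis using 1 2 unfolding G_def by simp
qed

subsection \<open>Divisibility of integer polynomials modulo a prime\<close>

text \<open>Schoolbook elimination of the leading term, with \<open>f\<close> multiplied by the
  leading coefficient of \<open>g\<close> in place of a division. The new coefficients are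
  differences of two products, hence the factor \<open>2 * C\<close> per step. The measure ranks 0
  below the nonzero constants, so that it also drops when the last step cancels everything.\<close>

lemma pseudo_division:
  fixes g :: "int poly"
  assumes g: "g \<noteq> 0" "\<And>i. \<bar>coeff g i\<bar> \<le> C"
  shows "(\<And>i. \<bar>coeff f i\<bar> \<le> A) \<Longrightarrow> \<exists>e q r. smult (lead_coeff g ^ e) f = g * q + r \<and>
    (r = 0 \<or> degree r < degree g) \<and> (\<forall>i. \<bar>coeff r i\<bar> \<le> A * (2 * C) ^ e) \<and> e \<le> Suc (degree f)"
proof (induction "if f = 0 then 0 else Suc (degree f)" arbitrary: f A rule: less_induct)
  case less
  show ?case
  proof (cases "f = 0 \<or> degree f < degree g")
    case True
    then show ?thesis using less.prems by (intro exI[of _ 0] exI[of _ 0] exI[of _ f]) auto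
  next
    case False
    define m where "m = monom (lead_coeff f) (degree f - degree g)"
    define f1 where "f1 = smult (lead_coeff g) f - m * g"
    have A: "A \<ge> 0" and C: "C \<ge> 0" using less.prems[of 0] g(2)[of 0] by linarith+
    have "coeff f1 (degree f) = 0"
      using False by (simp add: f1_def m_def coeff_monom_mult)
    moreover have "degree f1 \<le> degree f"
      unfolding f1_def using False
      by (intro degree_diff_le degree_smult_le order.trans[OF degree_mult_le])
        (auto simp: m_def degree_monom_eq)
    ultimately have d: "f1 = 0 \<or> degree f1 < degree f"
      by (metis leading_coeff_0_iff le_neq_implies_less)
    have b: "\<bar>coeff f1 i\<bar> \<le> A * (2 * C)" for i
    proof -
      have "\<bar>coeff (m * g) i\<bar> \<le> A * C"
        using mult_mono[OF less.prems[of "degree f"] g(2)[of "i - (degree f - degree g)"]] A C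
        by (auto simp: m_def coeff_monom_mult abs_mult)
      moreover have "\<bar>coeff (smult (lead_coeff g) f) i\<bar> \<le> A * C"
        using mult_mono[OF less.prems[of i] g(2)[of "degree g"]] A by (auto simp: abs_mult mult_ac)
      ultimately show ?thesis unfolding f1_def coeff_diff by linarith
    qed
    have "(if f1 = 0 then 0 else Suc (degree f1)) < (if f = 0 then 0 else Suc (degree f))"
      using d False by auto
    from less.hyps[OF this b] obtain e q r where 1: "smult (lead_coeff g ^ e) f1 = g * q + r"
      "r = 0 \<or> degree r < degree g" "\<And>i. \<bar>coeff r i\<bar> \<le> A * (2 * C) * (2 * C) ^ e" "e \<le> Suc (degree f1)"
      by blast
    \<comment> \<open>The case \<open>f1 = 0\<close> is separate because
      \<open>degree 0 = 0\<close>: for constant \<open>f\<close> the induction hypothesis would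
      allow \<open>e = 1\<close>, and then \<open>Suc e\<close> exceeds
      \<open>Suc (degree f)\<close>.\<close>
    show ?thesis
    proof (cases "f1 = 0")
      case True
      then have "smult (lead_coeff g) f = g * m" by (simp add: f1_def mult.commute)
      then show ?thesis using A C by (intro exI[of _ 1] exI[of _ m] exI[of _ 0]) auto
    next
      case f1: False
      have "smult (lead_coeff g ^ Suc e) f = smult (lead_coeff g ^ e) (f1 + m * g)"
        by (simp add: f1_def mult.commute)
      also have "\<dots> = g * (q + smult (lead_coeff g ^ e) m) + r"
        by (simp add: smult_add_right 1(1) algebra_simps)
      finally show ?thesis using 1 d f1
        by (intro exI[of _ "Suc e"] exI[of _ "q + smult (lead_coeff g ^ e) m"] exI[of _ r])
          (auto simp: mult_ac)
    qed
  qed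
qed

text \<open>Gauss's lemma: contents and primitive parts are multiplicative, so the primitive part of
  \<open>g\<close> divides that of \<open>f\<close>, and the content hypothesis supplies the missing
  constant factor.\<close>

lemma dvd_if_content_dvd:
  fixes f g :: "int poly"
  assumes "smult c f = g * q" "c \<noteq> 0" "g \<noteq> 0" "content g dvd content f"
  shows "g dvd f"
proof -
  have cont: "normalize c * content f = content g * content q"
    using arg_cong[OF assms(1), of content] by (simp add: content_mult)
  have "smult (c * content f) (primitive_part f) = smult c (smult (content f) (primitive_part f))"
    by (simp only: smult_smult)
  also have "\<dots> = smult (content g) (primitive_part g) * smult (content q) (primitive_part q)"
    by (simp only: content_times_primitive_part assms(1))
  also have "\<dots> = smult (content g * content q) (primitive_part g * primitive_part q)"
    by (simp only: mult_smult_left mult_smult_right smult_smult mult.commute)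
  also have "content g * content q = normalize c * content f" by (simp only: cont)
  finally have "smult (c * content f) (primitive_part f) = smult (normalize c * content f) (primitive_part g * primitive_part q)" .
  \<comment> \<open>Contents are normalized, so only \<open>\<bar>c\<bar>\<close> appears on the
    right; the sign of \<open>c\<close> moves into the polynomial factor before the constant is
    cancelled.\<close>
  then have "smult (c * content f) (primitive_part f) = smult (c * content f) (smult (sgn c) (primitive_part g * primitive_part q))"
    by (simp add: abs_mult_sgn mult_ac abs_sgn)
  then have "smult (c * content f) (primitive_part f - smult (sgn c) (primitive_part g * primitive_part q)) = 0"
    by (simp add: smult_diff_right)
  then have pf: "f = 0 \<or> primitive_part f = smult (sgn c) (primitive_part g * primitive_part q)"
    using assms(2) by simp
  obtain k where k: "content f = content g * k" using assms(4) by (elim dvdE)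
  show ?thesis
  proof (cases "f = 0")
    case False
    have "f = smult (content f) (primitive_part f)" by simp
    also have "\<dots> = smult (content g * k) (smult (sgn c) (primitive_part g * primitive_part q))"
      using pf False k by simp
    also have "\<dots> = smult (content g) (primitive_part g) * smult (k * sgn c) (primitive_part q)"
      by (simp only: mult_smult_left mult_smult_right smult_smult mult_ac)
    also have "\<dots> = g * smult (k * sgn c) (primitive_part q)" by simp
    finally show ?thesis by (rule dvdI)
  qed simp
qed

text \<open>Uniqueness of the remainder modulo \<open>p\<close>, where \<open>g\<close> keeps its
  degree. If \<open>r\<close> agrees with \<open>g * u\<close> modulo \<open>p\<close>, then so does
  it after the leading term of \<open>u\<close> is removed, until \<open>u\<close> is gone.\<close>

lemma const_dvd_remainder:
  fixes g r u :: "int poly"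
  assumes p: "Factorial_Ring.prime p" "\<not> p dvd lead_coeff g"
    and r: "r = 0 \<or> degree r < degree g"
  shows "[:p:] dvd r - g * u \<Longrightarrow> [:p:] dvd r"
proof (induction "if u = 0 then 0 else Suc (degree u)" arbitrary: u rule: less_induct)
  case less
  show ?case
  proof (cases "u = 0")
    case False
    define u' where "u' = u - monom (lead_coeff u) (degree u)"
    \<comment> \<open>The remainder has no coefficient at this degree, so \<open>p\<close> divides
      the product of the leading coefficients, hence that of \<open>u\<close>.\<close>
    have "coeff (r - g * u) (degree g + degree u) = - (lead_coeff g * lead_coeff u)"
      using r by (auto simp: coeff_mult_degree_sum coeff_eq_0)
    moreover have "p dvd coeff (r - g * u) (degree g + degree u)"
      using less.prems by (simp add: const_poly_dvd_iff)
    ultimately have "p dvd lead_coeff u" using p by (simp add: prime_dvd_mult_iff)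
    then have "[:p:] dvd monom (lead_coeff u) (degree u)" by (auto simp: const_poly_dvd_iff coeff_monom)
    then have "[:p:] dvd (r - g * u) + g * monom (lead_coeff u) (degree u)"
      using less.prems by (intro dvd_add dvd_mult)
    then have "[:p:] dvd r - g * u'" by (simp add: u'_def algebra_simps)
    moreover have "(if u' = 0 then 0 else Suc (degree u')) < (if u = 0 then 0 else Suc (degree u))"
    proof -
      have "coeff u' (degree u) = 0" "degree u' \<le> degree u"
        by (auto simp: u'_def intro: degree_diff_le degree_monom_le)
      then have "u' = 0 \<or> degree u' < degree u" by (metis leading_coeff_0_iff le_neq_implies_less)
      then show ?thesis using False by auto
    qed
    ultimately show ?thesis using less.hyps by blast
  qed (use less.prems in simp)
qed

text \<open>The witness is the product of the leading coefficients of \<open>g\<close> and of the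
  pseudo-remainder \<open>r\<close>. A prime not dividing it preserves the degree of
  \<open>g\<close> and leaves \<open>r\<close> nonzero, so \<open>r\<close> remains a nonzero
  remainder modulo that prime. Gauss's lemma excludes \<open>r = 0\<close>.\<close>

lemma exists_bad_product:
  fixes f g :: "int poly"
  assumes g: "g \<noteq> 0" "\<not> g dvd f" "content g dvd content f"
    and C: "\<And>i. \<bar>coeff g i\<bar> \<le> C" "\<And>i. \<bar>coeff f i\<bar> \<le> C"
  shows "\<exists>D. D \<noteq> 0 \<and> \<bar>D\<bar> \<le> C * (C * (2 * C) ^ Suc (degree f)) \<and>
    (\<forall>p. Factorial_Ring.prime p \<longrightarrow> \<not> p dvd D \<longrightarrow> (\<forall>h. \<not> [:p:] dvd f - g * h))"
proof -
  obtain e q r where 1: "smult (lead_coeff g ^ e) f = g * q + r" "r = 0 \<or> degree r < degree g"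
      "\<And>i. \<bar>coeff r i\<bar> \<le> C * (2 * C) ^ e" "e \<le> Suc (degree f)"
    using pseudo_division[OF g(1) C(1) C(2)] by blast
  have r: "r \<noteq> 0"
    using dvd_if_content_dvd[of "lead_coeff g ^ e" f g q] 1(1) g by auto
  have C1: "C \<ge> 1" using C(1)[of "degree g"] g(1) by (smt (verit) leading_coeff_0_iff)
  define D where "D = lead_coeff g * lead_coeff r"
  show ?thesis
  proof (intro exI[of _ D] conjI allI impI)
    show "D \<noteq> 0" using g r by (simp add: D_def)
    have 2: "\<bar>D\<bar> \<le> C * (C * (2 * C) ^ e)"
      unfolding D_def abs_mult by (intro mult_mono C(1) 1(3)) (use C1 in auto)
    have "C * (C * (2 * C) ^ e) \<le> C * (C * (2 * C) ^ Suc (degree f))"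
      using C1 1(4) by (intro mult_left_mono power_increasing) auto
    with 2 show "\<bar>D\<bar> \<le> C * (C * (2 * C) ^ Suc (degree f))" by (rule order.trans)
    fix p h assume p: "Factorial_Ring.prime p" "\<not> p dvd D"
    show "\<not> [:p:] dvd f - g * h"
    proof
      assume "[:p:] dvd f - g * h"
      then have "[:p:] dvd [:lead_coeff g ^ e:] * (f - g * h)" by (rule dvd_mult)
      also have "[:lead_coeff g ^ e:] * (f - g * h) = r - g * (smult (lead_coeff g ^ e) h - q)"
        using 1(1) by (simp add: algebra_simps smult_diff_right)
      finally have d: "[:p:] dvd r - g * (smult (lead_coeff g ^ e) h - q)" .
      have "\<not> p dvd lead_coeff g" using p(2) by (auto simp: D_def)
      from const_dvd_remainder[OF p(1) this 1(2) d] have "[:p:] dvd r" .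
      then show False using p(2) by (auto simp: const_poly_dvd_iff D_def)
    qed
  qed
qed

subsection \<open>Sparse polynomials over homomorphic images of the integers\<close>

definition spoly :: "(int \<times> nat) list \<Rightarrow> int poly" where
  "spoly ts = (\<Sum>j<length ts. Polynomial.monom (fst (ts ! j)) (snd (ts ! j)))"

text \<open>Treats the integers (with \<open>id\<close>) and the prime field (with reduction) at
  once. Surjectivity lets every cofactor in \<open>UP R\<close> be lifted to an
  \<open>int poly\<close>, which turns divisibility in \<open>UP R\<close> into a statement about
  integer polynomials.\<close>

locale int_image = R: cring R for R (structure) +
  fixes \<phi> :: "int \<Rightarrow> 'a"
  assumes closed [simp]: "\<phi> k \<in> carrier R"
    and surj: "x \<in> carrier R \<Longrightarrow> \<exists>k. \<phi> k = x"
    and zero: "\<phi> 0 = \<zero>"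
    and add: "\<phi> (k + l) = \<phi> k \<oplus> \<phi> l"
    and mult: "\<phi> (k * l) = \<phi> k \<otimes> \<phi> l"
begin

definition img :: "int poly \<Rightarrow> nat \<Rightarrow> 'a" where
  "img P = (\<lambda>n. \<phi> (Polynomial.coeff P n))"

lemma sum: "finite A \<Longrightarrow> \<phi> (\<Sum>i\<in>A. f i) = (\<Oplus>i\<in>A. \<phi> (f i))"
  by (induction A rule: finite_induct) (simp_all add: zero add R.finsum_insert Pi_def)

lemma img_up: "img P \<in> up R"
proof -
  have "bound \<zero> (Polynomial.degree P) (img P)"
    by (rule bound.intro) (auto simp: img_def Polynomial.coeff_eq_0 zero)
  then show ?thesis by (auto simp: up_def img_def)
qed

lemma img_surj: "f \<in> up R \<Longrightarrow> \<exists>P. img P = f"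
proof -
  assume f: "f \<in> up R"
  then obtain n where n: "\<And>m. n < m \<Longrightarrow> f m = \<zero>" by (auto simp: up_def bound_def)
  have "\<exists>k. \<phi> k = f i" for i using f surj[of "f i"] by (auto simp: up_def)
  then obtain c where c: "\<And>i. \<phi> (c i) = f i" by metis
  have "img (Poly (map c [0..<Suc n])) i = f i" for i
    using c[of i] n[of i] by (auto simp: img_def coeff_Poly_eq nth_default_def zero simp del: upt_Suc)
  then show ?thesis by blast
qed

lemma img_mult: "img (P * Q) = img P \<otimes>\<^bsub>UP R\<^esub> img Q"
  by (rule ext) (simp add: UP_def img_up, simp add: img_def Polynomial.coeff_mult sum mult)

lemma img_add: "img (P + Q) = img P \<oplus>\<^bsub>UP R\<^esub> img Q"
  by (rule ext) (simp add: UP_def img_up add, simp add: img_def add)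

lemma img_zero: "img 0 = \<zero>\<^bsub>UP R\<^esub>"
  by (rule ext) (simp add: UP_def img_def zero)

lemma img_monom: "img (Polynomial.monom c n) = up_ring.monom (UP R) (\<phi> c) n"
  by (rule ext) (simp add: UP_def img_def zero)

lemma img_sum: "finite A \<Longrightarrow> img (\<Sum>i\<in>A. f i) = (\<Oplus>\<^bsub>UP R\<^esub>i\<in>A. img (f i))"
proof -
  interpret U: cring "UP R" by (rule UP_cring.UP_cring) (simp add: UP_cring_def R.cring_axioms)
  have carr: "img P \<in> carrier (UP R)" for P using img_up by (simp add: UP_def)
  show "finite A \<Longrightarrow> img (\<Sum>i\<in>A. f i) = (\<Oplus>\<^bsub>UP R\<^esub>i\<in>A. img (f i))"
    by (induction A rule: finite_induct) (simp_all add: img_zero img_add carr Pi_def)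
qed

lemma sparse_poly_img: "sparse_poly R (map (\<lambda>(c, n). (\<phi> c, n)) ts) = img (spoly ts)"
proof -
  interpret U: cring "UP R" by (rule UP_cring.UP_cring) (simp add: UP_cring_def R.cring_axioms)
  have "img P \<in> carrier (UP R)" for P using img_up by (simp add: UP_def)
  then show ?thesis unfolding sparse_poly_def spoly_def img_sum[OF finite_lessThan]
    by (intro U.finsum_cong') (auto simp: img_monom[symmetric] case_prod_beta)
qed

lemma non_divides_iff:
  "non_divides R (map (\<lambda>(c, n). (\<phi> c, n)) g) (map (\<lambda>(c, n). (\<phi> c, n)) f) \<longleftrightarrow>
     (\<forall>h. img (spoly f) \<noteq> img (spoly g * h))"
proof -
  have "f \<in> range img" if "f \<in> up R" for f using img_surj[OF that] by blast
  then have "carrier (UP R) = range img" using img_up by (auto simp: UP_def)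
  then show ?thesis
    unfolding non_divides_def factor_def sparse_poly_img by (auto simp: img_mult)
qed

end

lemma non_divides_Z_iff: "non_divides \<Z> g f \<longleftrightarrow> \<not> spoly g dvd spoly f"
proof -
  interpret int_image "\<Z>" id
    by (intro int_image.intro int_image_axioms.intro int_is_cring) auto
  show ?thesis using non_divides_iff[of g f] by (auto simp: img_def dvd_def poly_eq_iff case_prod_beta fun_eq_iff)
qed

lemma non_divides_prime_field_iff:
  assumes "Factorial_Ring.prime p"
  shows "non_divides (prime_field p) (map (\<lambda>(c, n). (c mod int p, n)) g) (map (\<lambda>(c, n). (c mod int p, n)) f) \<longleftrightarrow>
    (\<forall>h. \<not> [:int p:] dvd spoly f - spoly g * h)"
proof -
  have p: "int p > 1" using prime_gt_1_nat[OF assms] by simp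
  interpret r: residues "int p" "prime_field p" by unfold_locales (use p in auto)
  interpret int_image "prime_field p" "\<lambda>k. k mod int p"
  proof (intro int_image.intro int_image_axioms.intro r.cring)
    show "\<exists>k. k mod int p = x" if "x \<in> carrier (prime_field p)" for x
      using that by (intro exI[of _ x]) (auto simp: r.res_carrier_eq)
  qed (use p in \<open>simp_all add: r.res_carrier_eq r.res_zero_eq r.res_add_eq r.res_mult_eq mod_simps\<close>)
  show ?thesis unfolding non_divides_iff
    by (simp add: img_def fun_eq_iff const_poly_dvd_iff mod_eq_dvd_iff)
qed

lemma coeff_spoly:
  assumes "distinct (map snd ts)" "(c, n) \<in> set ts"
  shows "Polynomial.coeff (spoly ts) n = c"
proof -
  obtain j where j: "j < length ts" "ts ! j = (c, n)" using assms(2) by (auto simp: in_set_conv_nth)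
  have "i = j" if "i < length ts" "snd (ts ! i) = n" for i
  proof -
    have "map snd ts ! i = map snd ts ! j" using that j by (simp del: nth_map add: nth_map[of _ ts snd])
    then show ?thesis using nth_eq_iff_index_eq[OF assms(1), of i j] that(1) j(1) by simp
  qed
  note uniq = this
  have "Polynomial.coeff (spoly ts) n = (\<Sum>i<length ts. if snd (ts ! i) = n then fst (ts ! i) else 0)"
    by (simp add: spoly_def Polynomial.coeff_sum)
  also have "\<dots> = (\<Sum>i<length ts. if i = j then c else 0)"
  proof (intro sum.cong refl)
    fix i assume "i \<in> {..<length ts}"
    then show "(if snd (ts ! i) = n then fst (ts ! i) else 0) = (if i = j then c else 0)"
      using uniq[of i] arg_cong[OF j(2), of fst] arg_cong[OF j(2), of snd] by (cases "i = j") auto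
  qed
  also have "\<dots> = c" using j by simp
  finally show ?thesis .
qed

lemma coeff_spoly_notin: "n \<notin> snd ` set ts \<Longrightarrow> Polynomial.coeff (spoly ts) n = 0"
  unfolding spoly_def Polynomial.coeff_sum
  by (intro sum.neutral) (use nth_mem in \<open>fastforce simp: image_iff\<close>)

lemma content_spoly_dvd_iff:
  assumes "distinct (map snd ts)"
  shows "d dvd content (spoly ts) \<longleftrightarrow> (\<forall>c\<in>fst ` set ts. d dvd c)"
proof -
  have "d dvd content (spoly ts) \<longleftrightarrow> (\<forall>n. d dvd Polynomial.coeff (spoly ts) n)"
    unfolding const_poly_dvd_iff_dvd_content[symmetric] const_poly_dvd_iff ..
  also have "\<dots> \<longleftrightarrow> (\<forall>c\<in>fst ` set ts. d dvd c)"
  proof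
    assume "\<forall>n. d dvd Polynomial.coeff (spoly ts) n"
    then show "\<forall>c\<in>fst ` set ts. d dvd c" using coeff_spoly[OF assms] by fastforce
  next
    assume a: "\<forall>c\<in>fst ` set ts. d dvd c"
    show "\<forall>n. d dvd Polynomial.coeff (spoly ts) n"
    proof
      fix n
      show "d dvd Polynomial.coeff (spoly ts) n"
      proof (cases "n \<in> snd ` set ts")
        case True
        then obtain c where "(c, n) \<in> set ts" by force
        then show ?thesis using a coeff_spoly[OF assms] by force
      qed (simp add: coeff_spoly_notin)
    qed
  qed
  finally show ?thesis .
qed

subsection \<open>Programs with bounded loops\<close>

type_synonym config = "store \<times> bool list"

datatype prog =
    Nop
  | Asg string aexp aexp
  | Toss string
  | Ask string string aexp
  | Sq prog prog
  | If aexp prog prog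
  | Rep prog

text \<open>\<open>Rep p\<close> repeats \<open>p\<close> as often as the value of the variable \<open>N\<close> says, so that every program
  terminates; \<open>Ask\<close> does nothing if the query is not shorter than the value of \<open>M\<close>.\<close>

primrec den :: "bool list set \<Rightarrow> prog \<Rightarrow> config \<Rightarrow> config" where
  "den Q Nop u = u"
| "den Q (Asg x i a) u = (upd (fst u) x (nat (aval i (fst u))) (aval a (fst u)), snd u)"
| "den Q (Toss x) u = (upd (fst u) x 0 (of_bool (hd (snd u))), tl (snd u))"
| "den Q (Ask x y a) u =
     (if aval a (fst u) < fst u ''M'' 0
      then (upd (fst u) x 0 (of_bool (map (\<lambda>i. fst u y i \<noteq> 0) [0..<nat (aval a (fst u))] \<in> Q)), snd u)
      else u)"
| "den Q (Sq p1 p2) u = den Q p2 (den Q p1 u)"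
| "den Q (If a p1 p2) u = (if aval a (fst u) \<noteq> 0 then den Q p1 u else den Q p2 u)"
| "den Q (Rep p) u = (den Q p ^^ nat (fst u ''N'' 0)) u"

text \<open>The argument \<open>d\<close> is the loop nesting depth. The counter of a loop at depth
  \<open>d\<close> is entry \<open>d\<close> of the array \<open>#\<close>, so nested loops use
  different counters.\<close>

primrec comp :: "nat \<Rightarrow> prog \<Rightarrow> com" where
  "comp d Nop = Skip"
| "comp d (Asg x i a) = Put x i a"
| "comp d (Toss x) = Flip x"
| "comp d (Ask x y a) = Cond (Less a (Get ''M'' (Num 0))) (Query x y a) Skip"
| "comp d (Sq p1 p2) = Then (comp d p1) (comp d p2)"
| "comp d (If a p1 p2) = Cond a (comp d p1) (comp d p2)"
| "comp d (Rep p) = Then (Put ''#'' (Num (int d)) (Num 0))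
     (Loop (Less (Get ''#'' (Num (int d))) (Get ''N'' (Num 0)))
       (Then (comp (Suc d) p)
         (Put ''#'' (Num (int d)) (Add (Get ''#'' (Num (int d))) (Num 1)))))"

primrec avars :: "aexp \<Rightarrow> string set" where
  "avars (Num k) = {}"
| "avars (Get x i) = insert x (avars i)"
| "avars (Add a b) = avars a \<union> avars b"
| "avars (Sub a b) = avars a \<union> avars b"
| "avars (Mul a b) = avars a \<union> avars b"
| "avars (Div a b) = avars a \<union> avars b"
| "avars (Less a b) = avars a \<union> avars b"

text \<open>A product may only occur as \<open>(d div b) * b\<close>, whose absolute value is at most
  \<open>\<bar>d\<bar> + \<bar>b\<bar>\<close>; so the bit lengths grow by a constant in each step.\<close>

fun tame :: "aexp \<Rightarrow> bool" where
  "tame (Num k) = True"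
| "tame (Get x i) = tame i"
| "tame (Add a b) = (tame a \<and> tame b)"
| "tame (Sub a b) = (tame a \<and> tame b)"
| "tame (Mul (Div d c) b) = (tame d \<and> c = b \<and> tame b)"
| "tame (Mul a b) = False"
| "tame (Div a b) = (tame a \<and> tame b)"
| "tame (Less a b) = (tame a \<and> tame b)"

primrec asize :: "aexp \<Rightarrow> nat" where
  "asize (Num k) = int_size k"
| "asize (Get x i) = 1 + asize i"
| "asize (Add a b) = 1 + asize a + asize b"
| "asize (Sub a b) = 1 + asize a + asize b"
| "asize (Mul a b) = 1 + asize a + asize b"
| "asize (Div a b) = 1 + asize a + asize b"
| "asize (Less a b) = 1 + asize a + asize b"

primrec mods :: "prog \<Rightarrow> string set" where
  "mods Nop = {}"
| "mods (Asg x i a) = {x}"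
| "mods (Toss x) = {x}"
| "mods (Ask x y a) = {x}"
| "mods (Sq p1 p2) = mods p1 \<union> mods p2"
| "mods (If a p1 p2) = mods p1 \<union> mods p2"
| "mods (Rep p) = mods p"

primrec toss_free :: "prog \<Rightarrow> bool" where
  "toss_free Nop = True"
| "toss_free (Asg x i a) = True"
| "toss_free (Toss x) = False"
| "toss_free (Ask x y a) = True"
| "toss_free (Sq p1 p2) = (toss_free p1 \<and> toss_free p2)"
| "toss_free (If a p1 p2) = (toss_free p1 \<and> toss_free p2)"
| "toss_free (Rep p) = toss_free p"

definition good_exp :: "aexp \<Rightarrow> bool" where
  "good_exp a \<longleftrightarrow> tame a \<and> ''#'' \<notin> avars a"

text \<open>The array \<open>#\<close> belongs to the compiled loops, while \<open>N\<close> and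
  \<open>M\<close> must keep their values so that all loop and query bounds are known in
  advance.\<close>

definition good_var :: "string \<Rightarrow> bool" where
  "good_var x \<longleftrightarrow> x \<noteq> ''#'' \<and> x \<noteq> ''N'' \<and> x \<noteq> ''M''"

primrec good :: "prog \<Rightarrow> bool" where
  "good Nop = True"
| "good (Asg x i a) = (good_var x \<and> good_exp i \<and> good_exp a)"
| "good (Toss x) = good_var x"
| "good (Ask x y a) = (good_var x \<and> y \<noteq> ''#'' \<and> good_exp a)"
| "good (Sq p1 p2) = (good p1 \<and> good p2)"
| "good (If a p1 p2) = (good_exp a \<and> good p1 \<and> good p2)"
| "good (Rep p) = good p"

lemma frame: "x \<notin> mods p \<Longrightarrow> fst (den Q p u) x = fst u x"
proof (induction p arbitrary: u)
  case (Rep p)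
  have "fst ((den Q p ^^ n) u) x = fst u x" for n
    using Rep by (induction n) auto
  then show ?case by simp
qed (auto simp: upd_def)

lemma den_toss_free: "toss_free p \<Longrightarrow> snd (den Q p u) = snd u"
proof (induction p arbitrary: u)
  case (Rep p)
  have "snd ((den Q p ^^ n) u) = snd u" for n
    using Rep by (induction n) auto
  then show ?case by simp
qed auto

lemma good_mods: "good p \<Longrightarrow> ''N'' \<notin> mods p \<and> ''M'' \<notin> mods p \<and> ''#'' \<notin> mods p"
  by (induction p) (auto simp: good_var_def)

subsection \<open>Cost\<close>

lemma bits_of_0 [simp]: "bits_of 0 = []"
  by (simp add: bits_of.simps)

lemma bits_of_pos: "n > 0 \<Longrightarrow> bits_of n = odd n # bits_of (n div 2)"
  by (simp add: bits_of.simps)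

lemma length_bits_of_le: "n < 2 ^ k \<Longrightarrow> length (bits_of n) \<le> k"
proof (induction n arbitrary: k rule: less_induct)
  case (less n)
  show ?case
  proof (cases "n = 0")
    case False
    then obtain k' where k': "k = Suc k'" using less.prems by (cases k) auto
    have "n div 2 < 2 ^ k'" using less.prems k' by auto
    then show ?thesis using less.IH[of "n div 2" k'] False k' by (simp add: bits_of_pos)
  qed simp
qed

lemma less_power_length_bits_of: "n < 2 ^ length (bits_of n)"
proof (induction n rule: less_induct)
  case (less n)
  show ?case
  proof (cases "n = 0")
    case False
    then show ?thesis using less.IH[of "n div 2"] by (simp add: bits_of_pos)
  qed simp
qed

lemma int_size_le: "\<bar>k\<bar> < 2 ^ B \<Longrightarrow> int_size k \<le> Suc B"
proof -
  assume "\<bar>k\<bar> < 2 ^ B"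
  then have "nat \<bar>k\<bar> < 2 ^ B" by (simp add: nat_less_iff)
  then show ?thesis using length_bits_of_le by (simp add: int_size_def)
qed

lemma less_power_int_size: "\<bar>k\<bar> < 2 ^ (int_size k)"
proof -
  have "nat \<bar>k\<bar> < 2 ^ (length (bits_of (nat \<bar>k\<bar>)))" by (rule less_power_length_bits_of)
  also have "\<dots> \<le> 2 ^ (int_size k)" by (simp add: int_size_def)
  finally show ?thesis by (simp add: nat_less_iff)
qed

definition bnd :: "nat \<Rightarrow> store \<Rightarrow> bool" where
  "bnd B s \<longleftrightarrow> (\<forall>x i. \<bar>s x i\<bar> < 2 ^ B)"

lemma bnd_mono: "bnd B s \<Longrightarrow> B \<le> B' \<Longrightarrow> bnd B' s"
  unfolding bnd_def by (meson less_le_trans one_le_numeral power_increasing)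

lemma bnd_upd: "bnd B s \<Longrightarrow> \<bar>k\<bar> < 2 ^ B \<Longrightarrow> bnd B (upd s x i k)"
  by (auto simp: bnd_def upd_def)

lemma abs_div_le: "\<bar>a div b\<bar> \<le> \<bar>a :: int\<bar>"
proof -
  have nonneg: "\<bar>a div b\<bar> \<le> \<bar>a\<bar>" if "b > 0" for a b :: int
  proof (cases "a \<ge> 0")
    case True
    then show ?thesis using that zdiv_mono2[of a 1 b] by (simp add: pos_imp_zdiv_nonneg_iff)
  next
    case False
    then have "a div b \<ge> a" using that zdiv_mono2_neg[of a 1 b] by simp
    moreover have "a div b \<le> 0" using False that by (simp add: div_nonpos_pos_le0)
    ultimately show ?thesis by simp
  qed
  show ?thesis using nonneg[of b a] nonneg[of "-b" "-a"] by (cases "b = 0") (auto simp: linorder_neq_iff)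
qed

lemma abs_mod_le: "b \<noteq> 0 \<Longrightarrow> \<bar>a mod b\<bar> < \<bar>b :: int\<bar>"
  by (cases "b > 0") (auto simp: abs_mod_less)

lemma abs_div_mult_le: "\<bar>a div b * b\<bar> \<le> \<bar>a\<bar> + \<bar>b :: int\<bar>"
proof (cases "b = 0")
  case False
  have "a div b * b = a - a mod b" by (simp add: minus_mod_eq_div_mult)
  then show ?thesis using abs_mod_le[OF False, of a] by linarith
qed simp

text \<open>Evaluation adds a number of bits that depends on the expression alone. A general product
  would double the bit length, and iterating it would make the length exponential; this is what
  \<open>tame\<close> rules out.\<close>

lemma aval_bound: "tame a \<Longrightarrow> bnd B s \<Longrightarrow> \<bar>aval a s\<bar> < 2 ^ (B + asize a)"
proof (induction a rule: tame.induct)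
  case (1 k)
  have "\<bar>k\<bar> < 2 ^ (int_size k)" by (rule less_power_int_size)
  also have "\<dots> \<le> 2 ^ (B + int_size k)" by simp
  finally show ?case by simp
next
  case (2 x i)
  have "bnd (B + asize (Get x i)) s" by (rule bnd_mono[OF 2(3)]) simp
  then show ?case by (simp add: bnd_def)
next
  case (3 a b)
  define m where "m = B + asize a + asize b"
  have "\<bar>aval a s\<bar> < 2 ^ (B + asize a)" "\<bar>aval b s\<bar> < 2 ^ (B + asize b)" using 3 by auto
  moreover have "(2::int) ^ (B + asize a) \<le> 2 ^ m" "(2::int) ^ (B + asize b) \<le> 2 ^ m"
    unfolding m_def by (intro power_increasing; simp)+
  moreover have "(2::int) ^ (B + asize (Add a b)) = 2 * 2 ^ m" by (simp add: m_def add_ac)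
  ultimately show ?case unfolding aval.simps by linarith
next
  case (4 a b)
  define m where "m = B + asize a + asize b"
  have "\<bar>aval a s\<bar> < 2 ^ (B + asize a)" "\<bar>aval b s\<bar> < 2 ^ (B + asize b)" using 4 by auto
  moreover have "(2::int) ^ (B + asize a) \<le> 2 ^ m" "(2::int) ^ (B + asize b) \<le> 2 ^ m"
    unfolding m_def by (intro power_increasing; simp)+
  moreover have "(2::int) ^ (B + asize (Sub a b)) = 2 * 2 ^ m" by (simp add: m_def add_ac)
  ultimately show ?case unfolding aval.simps by linarith
next
  case (5 d c b)
  define m where "m = B + asize d + asize b"
  have "\<bar>aval d s\<bar> < 2 ^ (B + asize d)" "\<bar>aval b s\<bar> < 2 ^ (B + asize b)" using 5 by auto
  moreover have "(2::int) ^ (B + asize d) \<le> 2 ^ m" "(2::int) ^ (B + asize b) \<le> 2 ^ m"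
    unfolding m_def by (intro power_increasing; simp)+
  moreover have "(2::int) ^ (B + asize (Mul (Div d c) b)) \<ge> 2 * 2 ^ m"
    using power_increasing[of "Suc m" "B + asize (Mul (Div d c) b)" "2::int"] by (simp add: m_def)
  moreover have "\<bar>aval (Mul (Div d c) b) s\<bar> \<le> \<bar>aval d s\<bar> + \<bar>aval b s\<bar>"
    using 5 abs_div_mult_le by simp
  ultimately show ?case by linarith
next
  case (7 a b)
  have "\<bar>aval (Div a b) s\<bar> \<le> \<bar>aval a s\<bar>" by (simp add: abs_div_le)
  also have "\<bar>aval a s\<bar> < 2 ^ (B + asize a)" using 7 by auto
  also have "(2::int) ^ (B + asize a) \<le> 2 ^ (B + asize (Div a b))" by (intro power_increasing) auto
  finally show ?case .
next
  case (8 a b)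
  have "(1::int) < 2 ^ (B + asize (Less a b))" using one_less_power[of "2::int" "B + asize (Less a b)"] by simp
  then show ?case by (simp del: asize.simps)
qed auto

lemma acost_bound: "tame a \<Longrightarrow> bnd B s \<Longrightarrow> acost a s \<le> asize a * (1 + B + asize a)"
proof (induction a rule: tame.induct)
  case (1 k)
  show ?case by simp
next
  case (2 x i)
  have "int_size (s x (nat (aval i s))) \<le> Suc B" by (rule int_size_le) (use 2 in \<open>auto simp: bnd_def\<close>)
  moreover have "acost i s \<le> asize i * (1 + B + asize i)" using 2 by auto
  ultimately show ?case by (simp add: algebra_simps)
next
  case (3 a b)
  have "int_size (aval (Add a b) s) \<le> Suc (B + asize (Add a b))"
    by (rule int_size_le, rule aval_bound) (use 3 in auto)
  moreover have "acost a s \<le> asize a * (1 + B + asize a)" "acost b s \<le> asize b * (1 + B + asize b)" using 3 by auto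
  ultimately show ?case by (simp add: algebra_simps)
next
  case (4 a b)
  have "int_size (aval (Sub a b) s) \<le> Suc (B + asize (Sub a b))"
    by (rule int_size_le, rule aval_bound) (use 4 in auto)
  moreover have "acost a s \<le> asize a * (1 + B + asize a)" "acost b s \<le> asize b * (1 + B + asize b)" using 4 by auto
  ultimately show ?case by (simp add: algebra_simps)
next
  case (5 d c b)
  have "int_size (aval (Mul (Div d c) b) s) \<le> Suc (B + asize (Mul (Div d c) b))"
    by (rule int_size_le, rule aval_bound) (use 5 in auto)
  moreover have "int_size (aval (Div d c) s) \<le> Suc (B + asize (Div d c))"
    by (rule int_size_le, rule aval_bound) (use 5 in auto)
  moreover have "acost d s \<le> asize d * (1 + B + asize d)" "acost c s \<le> asize c * (1 + B + asize c)"
      "acost b s \<le> asize b * (1 + B + asize b)" using 5 by auto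
  ultimately show ?case by (simp add: algebra_simps)
next
  case (7 a b)
  have "int_size (aval (Div a b) s) \<le> Suc (B + asize (Div a b))"
    by (rule int_size_le, rule aval_bound) (use 7 in auto)
  moreover have "acost a s \<le> asize a * (1 + B + asize a)" "acost b s \<le> asize b * (1 + B + asize b)" using 7 by auto
  ultimately show ?case by (simp add: algebra_simps)
next
  case (8 a b)
  have "int_size (aval (Less a b) s) \<le> Suc (B + asize (Less a b))"
    by (rule int_size_le, rule aval_bound) (use 8 in auto)
  moreover have "acost a s \<le> asize a * (1 + B + asize a)" "acost b s \<le> asize b * (1 + B + asize b)" using 8 by auto
  ultimately show ?case by (simp add: algebra_simps)
qed auto

section \<open>Simulation of bounded-loop programs by the machine\<close>

definition counter :: "nat \<Rightarrow> aexp" where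
  "counter d = Get ''#'' (Num (int d))"

definition guard :: "nat \<Rightarrow> aexp" where
  "guard d = Less (counter d) (Get ''N'' (Num 0))"

definition next_count :: "nat \<Rightarrow> aexp" where
  "next_count d = Add (counter d) (Num 1)"

definition put_weight :: "aexp \<Rightarrow> aexp \<Rightarrow> nat" where
  "put_weight i a = 1 + asize i + asize a"

text \<open>Only \<open>Rep\<close> multiplies, and only by \<open>N\<close>. Hence for a fixed
  program the weight is a polynomial in \<open>N\<close> and \<open>M\<close>.\<close>

primrec weight :: "nat \<Rightarrow> nat \<Rightarrow> nat \<Rightarrow> prog \<Rightarrow> nat" where
  "weight N M d Nop = 1"
| "weight N M d (Asg x i a) = put_weight i a"
| "weight N M d (Toss x) = 1"
| "weight N M d (Ask x y a) = 3 + asize (Less a (Get ''M'' (Num 0))) + asize a + M"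
| "weight N M d (Sq p1 p2) = 1 + weight N M d p1 + weight N M d p2"
| "weight N M d (If a p1 p2) = 1 + asize a + weight N M d p1 + weight N M d p2"
| "weight N M d (Rep p) = 2 + put_weight (Num (int d)) (Num 0) + asize (guard d) +
     N * (2 + asize (guard d) + weight N M (Suc d) p + put_weight (Num (int d)) (next_count d))"

text \<open>The semantics \<open>den\<close> has no loop counters, so machine stores are compared
  with its stores only outside \<open>#\<close>.\<close>

definition agree :: "store \<Rightarrow> store \<Rightarrow> bool" where
  "agree s s' \<longleftrightarrow> (\<forall>x. x \<noteq> ''#'' \<longrightarrow> s x = s' x)"

text \<open>\<open>W\<close> bounds at once the number of steps, the growth of the bit lengths and the number of coins
  consumed.\<close>

definition runs :: "bool list set \<Rightarrow> com \<Rightarrow> nat \<Rightarrow> nat \<Rightarrow> nat \<Rightarrow> config \<Rightarrow> config \<Rightarrow> bool" where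
  "runs Q c d B W u u' \<longleftrightarrow> (\<exists>t s1. exec Q c u t (s1, snd u') \<and> agree s1 (fst u') \<and> t \<le> W * (1 + B + W) \<and>
     bnd (B + W) s1 \<and> (\<forall>j<d. s1 ''#'' j = fst u ''#'' j) \<and> length (snd u) \<le> length (snd u') + W)"

lemma agree_aval: "agree s s' \<Longrightarrow> ''#'' \<notin> avars a \<Longrightarrow> aval a s = aval a s'"
  by (induction a) (auto simp: agree_def)

text \<open>The bound \<open>W * (1 + B + W)\<close> is closed under sequencing: the second piece
  starts with bit length \<open>B + W1\<close>, and this increase is covered because the total
  \<open>W\<close> is inside the parentheses.\<close>

lemma cost_add: "t1 \<le> W1 * (1 + B + W1) \<Longrightarrow> t2 \<le> W2 * (1 + (B + W1) + W2) \<Longrightarrow>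
   t0 \<le> W0 * (1 + B + W0) \<Longrightarrow> W0 + W1 + W2 \<le> W \<Longrightarrow> t0 + t1 + t2 \<le> W * (1 + B + (W::nat))"
proof -
  assume a: "t1 \<le> W1 * (1 + B + W1)" "t2 \<le> W2 * (1 + (B + W1) + W2)" "t0 \<le> W0 * (1 + B + W0)" "W0 + W1 + W2 \<le> W"
  have "t0 + t1 + t2 \<le> W0 * (1 + B + W) + W1 * (1 + B + W) + W2 * (1 + B + W)"
  proof (intro add_mono)
    show "t0 \<le> W0 * (1 + B + W)" by (rule order.trans[OF a(3)]) (use a(4) in \<open>intro mult_le_mono; simp\<close>)
    show "t1 \<le> W1 * (1 + B + W)" by (rule order.trans[OF a(1)]) (use a(4) in \<open>intro mult_le_mono; simp\<close>)
    show "t2 \<le> W2 * (1 + B + W)" by (rule order.trans[OF a(2)]) (use a(4) in \<open>intro mult_le_mono; simp\<close>)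
  qed
  also have "\<dots> = (W0 + W1 + W2) * (1 + B + W)" by (simp add: algebra_simps)
  also have "\<dots> \<le> W * (1 + B + W)" using a(4) by (rule mult_le_mono1)
  finally show ?thesis .
qed

lemma runs_weaken: "runs Q c d B W u u' \<Longrightarrow> W \<le> W' \<Longrightarrow> runs Q c d B W' u u'"
proof -
  assume r: "runs Q c d B W u u'" and W: "W \<le> W'"
  then have "W * (1 + B + W) \<le> W' * (1 + B + W')" by (intro mult_le_mono) auto
  then show ?thesis using r W unfolding runs_def
    by (meson bnd_mono add_left_mono order.trans)
qed

lemma exec_Put_bound:
  assumes "tame i" "tame a" "bnd B s"
  shows "\<exists>t. exec Q (Put x i a) (s, r) t (upd s x (nat (aval i s)) (aval a s), r) \<and>
    t \<le> put_weight i a * (1 + B + put_weight i a) \<and> bnd (B + put_weight i a) (upd s x (nat (aval i s)) (aval a s))"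
proof (intro exI conjI)
  show "exec Q (Put x i a) (s, r) (1 + acost i s + acost a s) (upd s x (nat (aval i s)) (aval a s), r)"
    by (rule exec.Put)
  show "1 + acost i s + acost a s \<le> put_weight i a * (1 + B + put_weight i a)"
    using acost_bound[OF assms(1,3)] acost_bound[OF assms(2,3)] by (simp add: put_weight_def algebra_simps)
  have "bnd (B + asize a) s" "\<bar>aval a s\<bar> < 2 ^ (B + asize a)"
    using aval_bound[OF assms(2,3)] bnd_mono[OF assms(3)] by auto
  then show "bnd (B + put_weight i a) (upd s x (nat (aval i s)) (aval a s))"
    by (intro bnd_mono[OF bnd_upd]) (auto simp: put_weight_def)
qed

text \<open>Here \<open>n\<close> counts the rounds still to come, so the counter stands at
  \<open>N - n\<close>. The body has one bound \<open>W\<close> for every bit length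
  \<open>B\<close>, as \<open>B\<close> increases from round to round.\<close>

lemma runs_Rep_loop:
  assumes body: "\<And>B s s' r. agree s s' \<Longrightarrow> bnd B s \<Longrightarrow> s ''N'' 0 = int N \<Longrightarrow> s ''M'' 0 = int M \<Longrightarrow>
      length r \<ge> W \<Longrightarrow> runs Q c (Suc d) B W (s, r) (den Q p (s', r))"
    and p: "good p"
  shows "agree s s' \<Longrightarrow> bnd B s \<Longrightarrow> s ''N'' 0 = int N \<Longrightarrow> s ''M'' 0 = int M \<Longrightarrow>
      s ''#'' d = int N - int n \<Longrightarrow>
      length r \<ge> n * (2 + asize (guard d) + W + put_weight (Num (int d)) (next_count d)) \<Longrightarrow>
      runs Q (Loop (guard d) (Then c (Put ''#'' (Num (int d)) (next_count d)))) d B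
        (1 + asize (guard d) + n * (2 + asize (guard d) + W + put_weight (Num (int d)) (next_count d)))
        (s, r) ((den Q p ^^ n) (s', r))"
proof (induction n arbitrary: B s s' r)
  case 0
  have cost: "acost (guard d) s \<le> asize (guard d) * (1 + B + asize (guard d))"
    by (rule acost_bound) (auto simp: guard_def counter_def 0)
  have "exec Q (Loop (guard d) (Then c (Put ''#'' (Num (int d)) (next_count d)))) (s, r) (1 + acost (guard d) s) (s, r)"
    by (rule exec.Loop_False) (use 0 in \<open>auto simp: guard_def counter_def\<close>)
  moreover have "1 + acost (guard d) s \<le> (1 + asize (guard d)) * (1 + B + (1 + asize (guard d)))"
    using cost by (simp add: algebra_simps)
  moreover have "bnd (B + (1 + asize (guard d))) s" using 0(2) by (rule bnd_mono) simp
  ultimately show ?case using 0(1) unfolding runs_def by (intro exI[of _ "1 + acost (guard d) s"] exI[of _ s]) auto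
next
  case (Suc n)
  define G where "G = asize (guard d)"
  define P where "P = put_weight (Num (int d)) (next_count d)"
  obtain s2' r2 where u2: "den Q p (s', r) = (s2', r2)" by fastforce
  have "runs Q c (Suc d) B W (s, r) (den Q p (s', r))"
    using Suc.prems by (intro body) auto
  then obtain t1 s1 where 1: "exec Q c (s, r) t1 (s1, r2)" "agree s1 s2'" "t1 \<le> W * (1 + B + W)"
      "bnd (B + W) s1" "\<forall>j<Suc d. s1 ''#'' j = s ''#'' j" "length r \<le> length r2 + W"
    unfolding u2 runs_def by auto
  define s2 where "s2 = upd s1 ''#'' d (s1 ''#'' d + 1)"
  have aux: "nat (aval (Num (int d)) s1) = d" "aval (next_count d) s1 = s1 ''#'' d + 1"
    by (auto simp: next_count_def counter_def)
  obtain t2 where 2: "exec Q (Put ''#'' (Num (int d)) (next_count d)) (s1, r2) t2 (s2, r2)"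
      "t2 \<le> P * (1 + (B + W) + P)" "bnd (B + W + P) s2"
    using exec_Put_bound[of "Num (int d)" "next_count d" "B + W" s1 Q "''#''" r2] 1(4)
    unfolding aux s2_def[symmetric] P_def[symmetric] by (auto simp: next_count_def counter_def)
  have frame_N: "s2' ''N'' = s' ''N''" "s2' ''M'' = s' ''M''"
    using frame[of "''N''" p Q "(s', r)"] frame[of "''M''" p Q "(s', r)"] good_mods[OF p] u2 by auto
  have s2: "agree s2 s2'" "s2 ''N'' 0 = int N" "s2 ''M'' 0 = int M" "s2 ''#'' d = int N - int n"
    using 1(2,5) Suc.prems frame_N by (auto simp: s2_def upd_def agree_def)
  have len: "length r2 \<ge> n * (2 + G + W + P)" using 1(6) Suc.prems(6) by (simp add: G_def P_def)
  define W3 where "W3 = 1 + G + n * (2 + G + W + P)"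
  have "runs Q (Loop (guard d) (Then c (Put ''#'' (Num (int d)) (next_count d)))) d (B + W + P) W3
        (s2, r2) ((den Q p ^^ n) (s2', r2))"
    using Suc.IH[OF s2(1) 2(3) s2(2-4)] len unfolding G_def P_def W3_def by simp
  then obtain t3 s3 where 3: "exec Q (Loop (guard d) (Then c (Put ''#'' (Num (int d)) (next_count d)))) (s2, r2) t3
        (s3, snd ((den Q p ^^ n) (s2', r2)))" "agree s3 (fst ((den Q p ^^ n) (s2', r2)))"
      "t3 \<le> W3 * (1 + (B + W + P) + W3)" "bnd (B + W + P + W3) s3" "\<forall>j<d. s3 ''#'' j = s2 ''#'' j"
      "length r2 \<le> length (snd ((den Q p ^^ n) (s2', r2))) + W3"
    unfolding runs_def by auto
  have den: "(den Q p ^^ Suc n) (s', r) = (den Q p ^^ n) (s2', r2)"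
    by (simp add: funpow_swap1 u2)
  have cost: "acost (guard d) s \<le> G * (1 + B + G)"
    unfolding G_def by (rule acost_bound) (auto simp: guard_def counter_def Suc.prems)
  let ?t = "1 + acost (guard d) s + (1 + t1 + t2) + t3"
  have "exec Q (Loop (guard d) (Then c (Put ''#'' (Num (int d)) (next_count d)))) (s, r) ?t
     (s3, snd ((den Q p ^^ n) (s2', r2)))"
    by (rule exec.Loop_True[OF _ exec.Then[OF 1(1) 2(1)] 3(1)]) (use Suc.prems in \<open>auto simp: guard_def counter_def\<close>)
  moreover have "?t \<le> (W3 + (2 + G + W + P)) * (1 + B + (W3 + (2 + G + W + P)))"
  proof -
    have a: "0 + t1 + t2 \<le> (W + P) * (1 + B + (W + P))"
      by (rule cost_add[OF 1(3) 2(2)]) auto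
    have b: "(2 + acost (guard d) s) \<le> (2 + G) * (1 + B + (2 + G))" using cost by (simp add: algebra_simps)
    have "(2 + acost (guard d) s) + (0 + t1 + t2) + t3 \<le> (W3 + (2 + G + W + P)) * (1 + B + (W3 + (2 + G + W + P)))"
      by (rule cost_add[OF a _ b]) (use 3(3) in \<open>auto simp: add_ac\<close>)
    then show ?thesis by simp
  qed
  moreover have "bnd (B + (W3 + (2 + G + W + P))) s3" using 3(4) by (rule bnd_mono) simp
  moreover have "\<forall>j<d. s3 ''#'' j = s ''#'' j" using 3(5) 1(5) by (auto simp: s2_def upd_def)
  moreover have "length r \<le> length (snd ((den Q p ^^ n) (s2', r2))) + (W3 + (2 + G + W + P))"
    using 3(6) 1(6) by simp
  ultimately have "runs Q (Loop (guard d) (Then c (Put ''#'' (Num (int d)) (next_count d)))) d B (W3 + (2 + G + W + P))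
     (s, r) ((den Q p ^^ Suc n) (s', r))"
    unfolding runs_def den using 3(2) by (intro exI[of _ ?t] exI[of _ s3]) simp
  then show ?case by (simp add: W3_def G_def P_def add_ac)
qed

text \<open>Induction on the program. \<open>runs\<close> includes that entries of \<open>#\<close>
  below \<open>d\<close> survive, so an inner loop never damages the counter of an enclosing one.
  The assumption on \<open>r\<close> guarantees that each toss finds a coin.\<close>

lemma comp_runs:
  assumes "good p" "agree s s'" "bnd B s" "s ''N'' 0 = int N" "s ''M'' 0 = int M" "length r \<ge> weight N M d p"
  shows "runs Q (comp d p) d B (weight N M d p) (s, r) (den Q p (s', r))"
  using assms
proof (induction p arbitrary: d s s' B r)
  case Nop
  have "bnd (B + 1) s" using Nop(3) by (rule bnd_mono) simp
  then show ?case
    using Nop exec.Skip[of Q s r] unfolding runs_def by (intro exI[of _ 1] exI[of _ s]) auto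
next
  case (Asg x i a)
  have e: "aval i s = aval i s'" "aval a s = aval a s'"
    using Asg by (auto intro!: agree_aval simp: good_exp_def)
  obtain t where "exec Q (Put x i a) (s, r) t (upd s x (nat (aval i s)) (aval a s), r)"
    "t \<le> put_weight i a * (1 + B + put_weight i a)" "bnd (B + put_weight i a) (upd s x (nat (aval i s)) (aval a s))"
    using exec_Put_bound[of i a B s Q x r] Asg by (auto simp: good_exp_def)
  then show ?case using Asg unfolding runs_def
    by (intro exI[of _ t] exI[of _ "upd s x (nat (aval i s)) (aval a s)"])
      (auto simp: e agree_def upd_def good_var_def)
next
  case (Toss x)
  then obtain b r' where r: "r = b # r'" by (cases r) auto
  have "(1::int) < 2 ^ (B + 1)" by (rule one_less_power) auto
  then have "bnd (B + 1) (upd s x 0 (of_bool b))"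
    by (intro bnd_upd bnd_mono[OF Toss(3)]) auto
  then show ?case
    using Toss exec.Flip[of Q x s b r'] unfolding runs_def r
    by (intro exI[of _ 1] exI[of _ "upd s x 0 (of_bool b)"]) (auto simp: agree_def upd_def good_var_def)
next
  case (Ask x y a)
  have e: "aval a s = aval a s'" using Ask by (auto intro!: agree_aval simp: good_exp_def)
  have M: "s' ''M'' 0 = int M" using Ask by (auto simp: agree_def)
  define g where "g = Less a (Get ''M'' (Num 0))"
  have cg: "acost g s \<le> asize g * (1 + B + asize g)" by (rule acost_bound) (use Ask in \<open>auto simp: g_def good_exp_def\<close>)
  have ca: "acost a s \<le> asize a * (1 + B + asize a)" by (rule acost_bound) (use Ask in \<open>auto simp: good_exp_def\<close>)
  define W where "W = 3 + asize g + asize a + M"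
  have W: "weight N M d (Ask x y a) = W" by (simp add: W_def g_def)
  show ?case
  proof (cases "aval a s < int M")
    case True
    define b :: int where "b = of_bool (map (\<lambda>i. s y i \<noteq> 0) [0..<nat (aval a s)] \<in> Q)"
    have b': "b = of_bool (map (\<lambda>i. s' y i \<noteq> 0) [0..<nat (aval a s')] \<in> Q)"
      using Ask by (auto simp: b_def e agree_def)
    let ?t = "1 + acost g s + (1 + acost a s + nat (aval a s))"
    have "exec Q (comp d (Ask x y a)) (s, r) ?t (upd s x 0 b, r)"
      unfolding comp.simps g_def[symmetric] b_def
      by (rule exec.Cond_True[OF _ exec.Query]) (use True Ask in \<open>auto simp: g_def\<close>)
    moreover have "?t \<le> W * (1 + B + W)"
    proof -
      have "?t \<le> asize g * (1 + B + asize g) + asize a * (1 + B + asize a) + (2 + M) * 1"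
        using cg ca True by simp
      also have "\<dots> \<le> asize g * (1 + B + W) + asize a * (1 + B + W) + (2 + M) * (1 + B + W)"
        by (intro add_mono mult_le_mono) (auto simp: W_def)
      also have "\<dots> = (2 + asize g + asize a + M) * (1 + B + W)" by (simp add: algebra_simps)
      also have "\<dots> \<le> W * (1 + B + W)" by (intro mult_le_mono) (auto simp: W_def)
      finally show ?thesis .
    qed
    moreover have "bnd (B + W) (upd s x 0 b)"
      by (rule bnd_upd, rule bnd_mono[OF Ask(3)]) (auto intro: one_less_power simp: b_def W_def)
    ultimately show ?thesis unfolding runs_def W
      using Ask True by (intro exI[of _ ?t] exI[of _ "upd s x 0 b"]) (auto simp: agree_def upd_def good_var_def b' e)
  next
    case False
    let ?t = "1 + acost g s + 1"
    have "exec Q (comp d (Ask x y a)) (s, r) ?t (s, r)"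
      unfolding comp.simps g_def[symmetric]
      by (rule exec.Cond_False[OF _ exec.Skip]) (use False Ask in \<open>auto simp: g_def\<close>)
    moreover have "?t \<le> W * (1 + B + W)"
    proof -
      have "?t \<le> asize g * (1 + B + asize g) + 2 * 1" using cg by simp
      also have "\<dots> \<le> asize g * (1 + B + W) + 2 * (1 + B + W)"
        by (intro add_mono mult_le_mono) (auto simp: W_def)
      also have "\<dots> = (2 + asize g) * (1 + B + W)" by (simp add: algebra_simps)
      also have "\<dots> \<le> W * (1 + B + W)" by (intro mult_le_mono) (auto simp: W_def)
      finally show ?thesis .
    qed
    moreover have "bnd (B + W) s" using Ask(3) by (rule bnd_mono) simp
    ultimately show ?thesis unfolding runs_def W
      using Ask False M e by (intro exI[of _ ?t] exI[of _ s]) auto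
  qed
next
  case (Sq p1 p2)
  define W1 where "W1 = weight N M d p1"
  define W2 where "W2 = weight N M d p2"
  obtain s1' r1 where u1: "den Q p1 (s', r) = (s1', r1)" by fastforce
  have "runs Q (comp d p1) d B W1 (s, r) (den Q p1 (s', r))"
    unfolding W1_def by (rule Sq.IH(1)) (use Sq.prems in auto)
  then obtain t1 s1 where 1: "exec Q (comp d p1) (s, r) t1 (s1, r1)" "agree s1 s1'" "t1 \<le> W1 * (1 + B + W1)"
      "bnd (B + W1) s1" "\<forall>j<d. s1 ''#'' j = s ''#'' j" "length r \<le> length r1 + W1"
    unfolding u1 runs_def by auto
  have "s1' ''N'' = s' ''N''" "s1' ''M'' = s' ''M''"
    using frame[of "''N''" p1 Q "(s', r)"] frame[of "''M''" p1 Q "(s', r)"] good_mods[of p1] Sq.prems(1) u1 by auto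
  then have NM: "s1 ''N'' 0 = int N" "s1 ''M'' 0 = int M" using 1(2) Sq.prems by (auto simp: agree_def)
  have "runs Q (comp d p2) d (B + W1) W2 (s1, r1) (den Q p2 (s1', r1))"
    unfolding W2_def by (rule Sq.IH(2)) (use Sq.prems 1 NM in \<open>auto simp: W1_def\<close>)
  then obtain t2 s2 where 2: "exec Q (comp d p2) (s1, r1) t2 (s2, snd (den Q p2 (s1', r1)))"
      "agree s2 (fst (den Q p2 (s1', r1)))" "t2 \<le> W2 * (1 + (B + W1) + W2)"
      "bnd (B + W1 + W2) s2" "\<forall>j<d. s2 ''#'' j = s1 ''#'' j" "length r1 \<le> length (snd (den Q p2 (s1', r1))) + W2"
    unfolding runs_def by auto
  have "exec Q (comp d (Sq p1 p2)) (s, r) (1 + t1 + t2) (s2, snd (den Q p2 (s1', r1)))"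
    unfolding comp.simps by (rule exec.Then[OF 1(1) 2(1)])
  moreover have "1 + t1 + t2 \<le> (1 + W1 + W2) * (1 + B + (1 + W1 + W2))"
    by (rule cost_add[OF 1(3) 2(3), of 1 1]) auto
  moreover have "bnd (B + (1 + W1 + W2)) s2" using 2(4) by (rule bnd_mono) simp
  moreover have "length r \<le> length (snd (den Q p2 (s1', r1))) + (1 + W1 + W2)" using 1(6) 2(6) by simp
  moreover have "weight N M d (Sq p1 p2) = 1 + W1 + W2" by (simp add: W1_def W2_def)
  ultimately show ?case unfolding runs_def using 1(5) 2(2,5) u1
    by (intro exI[of _ "1 + t1 + t2"] exI[of _ s2]) auto
next
  case (If a p1 p2)
  have e: "aval a s = aval a s'" using If.prems by (auto intro!: agree_aval simp: good_exp_def)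
  have ca: "acost a s \<le> asize a * (1 + B + asize a)" by (rule acost_bound) (use If.prems in \<open>auto simp: good_exp_def\<close>)
  define p where "p = (if aval a s \<noteq> 0 then p1 else p2)"
  have "runs Q (comp d p) d B (weight N M d p) (s, r) (den Q p (s', r))"
    using If by (auto simp: p_def)
  moreover define W where "W = weight N M d p"
  ultimately obtain t1 s1 where 1: "exec Q (comp d p) (s, r) t1 (s1, snd (den Q p (s', r)))" "agree s1 (fst (den Q p (s', r)))"
      "t1 \<le> W * (1 + B + W)"
      "bnd (B + W) s1" "\<forall>j<d. s1 ''#'' j = s ''#'' j" "length r \<le> length (snd (den Q p (s', r))) + W"
    unfolding runs_def by auto
  have "exec Q (comp d (If a p1 p2)) (s, r) (1 + acost a s + t1) (s1, snd (den Q p (s', r)))"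
    using 1(1) exec.Cond_True[of a s Q "comp d p1" r t1] exec.Cond_False[of a s Q "comp d p2" r t1]
    by (auto simp: p_def split: if_splits)
  moreover have "(1 + acost a s) + 0 + t1 \<le> (1 + asize a + W) * (1 + B + (1 + asize a + W))"
    by (rule cost_add[where ?W1.0 = 0 and ?W2.0 = W and ?W0.0 = "1 + asize a"])
      (use 1(3) ca in \<open>auto simp: algebra_simps\<close>)
  moreover have "bnd (B + (1 + asize a + W)) s1" using 1(4) by (rule bnd_mono) simp
  ultimately have "runs Q (comp d (If a p1 p2)) d B (1 + asize a + W) (s, r) (den Q p (s', r))"
    unfolding runs_def using 1(2,5,6) by (intro exI[of _ "1 + acost a s + t1"] exI[of _ s1]) auto
  moreover have "den Q (If a p1 p2) (s', r) = den Q p (s', r)" by (auto simp: p_def e)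
  moreover have "1 + asize a + W \<le> weight N M d (If a p1 p2)" by (auto simp: W_def p_def)
  ultimately show ?case by (metis runs_weaken)
next
  case (Rep p)
  define s0 where "s0 = upd s ''#'' d 0"
  define P0 where "P0 = put_weight (Num (int d)) (Num 0)"
  have aux: "nat (aval (Num (int d)) s) = d" "aval (Num 0) s = 0" by auto
  obtain t0 where 0: "exec Q (Put ''#'' (Num (int d)) (Num 0)) (s, r) t0 (s0, r)"
      "t0 \<le> P0 * (1 + B + P0)" "bnd (B + P0) s0"
    using exec_Put_bound[of "Num (int d)" "Num 0" B s Q "''#''" r] Rep.prems(3)
    unfolding aux s0_def[symmetric] P0_def[symmetric] by auto
  define W where "W = 1 + asize (guard d) + N * (2 + asize (guard d) + weight N M (Suc d) p +
         put_weight (Num (int d)) (next_count d))"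
  have Wr: "weight N M d (Rep p) = 1 + P0 + W" by (simp add: W_def P0_def)
  let ?u = "(den Q p ^^ N) (s', r)"
  have den: "den Q (Rep p) (s', r) = ?u" using Rep.prems by (auto simp: agree_def)
  have "runs Q (Loop (guard d) (Then (comp (Suc d) p) (Put ''#'' (Num (int d)) (next_count d)))) d (B + P0)
        (1 + asize (guard d) + N * (2 + asize (guard d) + weight N M (Suc d) p +
         put_weight (Num (int d)) (next_count d))) (s0, r) ?u"
  proof (rule runs_Rep_loop)
    show "runs Q (comp (Suc d) p) (Suc d) B (weight N M (Suc d) p) (s, r) (den Q p (s', r))"
      if "agree s s'" "bnd B s" "s ''N'' 0 = int N" "s ''M'' 0 = int M" "weight N M (Suc d) p \<le> length r" for B s s' r
      by (rule Rep.IH) (use Rep.prems(1) that in auto)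
  qed (use Rep.prems 0 in \<open>auto simp: s0_def upd_def agree_def\<close>)
  then obtain t1 s1 where 1: "exec Q (Loop (guard d) (Then (comp (Suc d) p) (Put ''#'' (Num (int d)) (next_count d)))) (s0, r) t1 (s1, snd ?u)"
      "agree s1 (fst ?u)" "t1 \<le> W * (1 + (B + P0) + W)" "bnd (B + P0 + W) s1" "\<forall>j<d. s1 ''#'' j = s0 ''#'' j"
      "length r \<le> length (snd ?u) + W"
    unfolding runs_def W_def[symmetric] by auto
  have "exec Q (comp d (Rep p)) (s, r) (1 + t0 + t1) (s1, snd ?u)"
    using exec.Then[OF 0(1) 1(1)] by (simp add: guard_def next_count_def counter_def)
  moreover have "1 + t0 + t1 \<le> (1 + P0 + W) * (1 + B + (1 + P0 + W))"
    by (rule cost_add[OF 0(2) 1(3), of 1 1]) auto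
  moreover have "bnd (B + (1 + P0 + W)) s1" using 1(4) by (rule bnd_mono) simp
  moreover have "\<forall>j<d. s1 ''#'' j = s ''#'' j" using 1(5) by (auto simp: s0_def upd_def)
  ultimately show ?case unfolding den Wr runs_def using 1(2,6)
    by (intro exI[of _ "1 + t0 + t1"] exI[of _ s1]) auto
qed

subsection \<open>Polynomial bounds\<close>

definition poly_bounded :: "(nat \<Rightarrow> nat) \<Rightarrow> bool" where
  "poly_bounded f \<longleftrightarrow> (\<exists>q :: nat poly. \<forall>n. f n \<le> poly q n)"

lemma poly_bounded_const [simp]: "poly_bounded (\<lambda>_. c)"
  unfolding poly_bounded_def by (rule exI[of _ "[:c:]"]) simp

lemma poly_bounded_id [simp]: "poly_bounded (\<lambda>n. n)"
  unfolding poly_bounded_def by (rule exI[of _ "[:0, 1:]"]) simp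

lemma poly_bounded_add: "poly_bounded f \<Longrightarrow> poly_bounded g \<Longrightarrow> poly_bounded (\<lambda>n. f n + g n)"
  unfolding poly_bounded_def by (metis poly_add add_mono)

lemma poly_bounded_mult: "poly_bounded f \<Longrightarrow> poly_bounded g \<Longrightarrow> poly_bounded (\<lambda>n. f n * g n)"
  unfolding poly_bounded_def by (metis poly_mult mult_le_mono)

lemma poly_bounded_weight:
  assumes "poly_bounded N" "poly_bounded M"
  shows "poly_bounded (\<lambda>n. weight (N n) (M n) d p)"
  by (induction p arbitrary: d)
     (auto intro!: poly_bounded_add poly_bounded_mult assms simp del: add_Suc add_Suc_right add_2_eq_Suc')

text \<open>One number serves as the bit length of the random candidates and as the repetition count
  of every loop; its square is both the cap \<open>M\<close> on query lengths and the number of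
  trials. The factor 16 is the one in \<open>card_good_primes\<close>; it also allows two Euclidean
  rounds per input bit.\<close>

definition rounds :: "nat \<Rightarrow> nat" where
  "rounds n = 16 * (n + 1)"

definition start :: "bool list \<Rightarrow> store" where
  "start w = upd (upd (init_store w) ''N'' 0 (int (rounds (length w))))
     ''M'' 0 (int (rounds (length w) * rounds (length w)))"

text \<open>Written as raw machine code, because these products are not \<open>tame\<close> and a
  \<open>good\<close> program may not assign to \<open>N\<close> and \<open>M\<close>.\<close>

definition prelude :: "com \<Rightarrow> com" where
  "prelude c =
     Then (Put ''N'' (Num 0) (Mul (Num 16) (Add (Get ''len'' (Num 0)) (Num 1))))
       (Then (Put ''M'' (Num 0) (Mul (Get ''N'' (Num 0)) (Get ''N'' (Num 0)))) c)"

lemma int_size_le_abs: "int_size k \<le> Suc (nat \<bar>k\<bar>)"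
proof (rule int_size_le)
  have "nat \<bar>k\<bar> < 2 ^ nat \<bar>k\<bar>" by (rule less_exp)
  then have "int (nat \<bar>k\<bar>) < int (2 ^ nat \<bar>k\<bar>)" by (simp only: of_nat_less_iff)
  then show "\<bar>k\<bar> < 2 ^ nat \<bar>k\<bar>" by simp
qed

lemma exec_prelude:
  assumes "exec Q c (start w, r) t v"
  shows "\<exists>t' \<le> t + (100 + 10 * rounds (length w) + 10 * rounds (length w) * rounds (length w)).
    exec Q (prelude c) (init_store w, r) t' v"
proof -
  define n where "n = length w"
  define R where "R = rounds n"
  define s1 where "s1 = upd (init_store w) ''N'' 0 (int R)"
  have len: "init_store w ''len'' 0 = int n" by (simp add: init_store_def n_def)
  let ?a = "Mul (Num 16) (Add (Get ''len'' (Num 0)) (Num 1))"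
  let ?b = "Mul (Get ''N'' (Num 0)) (Get ''N'' (Num 0))"
  have 1: "aval ?a (init_store w) = int R" by (simp add: len R_def rounds_def)
  have 2: "aval ?b s1 = int (R * R)" by (simp add: s1_def upd_def)
  have st: "start w = upd s1 ''M'' 0 (int (R * R))" by (simp add: start_def s1_def R_def n_def)
  define t1 where "t1 = 1 + acost (Num 0) (init_store w) + acost ?a (init_store w)"
  define t2 where "t2 = 1 + acost (Num 0) s1 + acost ?b s1"
  have "exec Q (prelude c) (init_store w, r) (1 + t1 + (1 + t2 + t)) v"
    unfolding prelude_def
  proof (rule exec.Then)
    show "exec Q (Put ''N'' (Num 0) ?a) (init_store w, r) t1 (s1, r)"
      using exec.Put[of Q "''N''" "Num 0" ?a "init_store w" r] unfolding 1 t1_def s1_def by simp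
    show "exec Q (Then (Put ''M'' (Num 0) ?b) c) (s1, r) (1 + t2 + t) v"
    proof (rule exec.Then)
      show "exec Q (Put ''M'' (Num 0) ?b) (s1, r) t2 (start w, r)"
        using exec.Put[of Q "''M''" "Num 0" ?b s1 r] unfolding 2 t2_def st by simp
    qed (fact assms)
  qed
  moreover have "t1 \<le> 40 + 3 * R"
  proof -
    have "nat (int n + 1) = n + 1" "nat (16 * int n + 16) = 16 * n + 16" by simp_all
    then show ?thesis
      using int_size_le_abs[of 16] int_size_le_abs[of "0::int"] int_size_le_abs[of "1::int"]
        int_size_le_abs[of "int n"] int_size_le_abs[of "int n + 1"] int_size_le_abs[of "16 * int n + 16"]
      by (simp add: t1_def len R_def rounds_def)
  qed
  moreover have "t2 \<le> 10 + 2 * R + R * R"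
    using int_size_le_abs[of "0::int"] int_size_le_abs[of "int R"] int_size_le_abs[of "int R * int R"]
    by (simp add: t2_def s1_def upd_def nat_mult_distrib)
  ultimately show ?thesis
    by (intro exI[of _ "1 + t1 + (1 + t2 + t)"]) (auto simp: R_def n_def)
qed

lemma bnd_start: "bnd (1 + rounds (length w) * rounds (length w)) (start w)"
proof -
  define R where "R = rounds (length w)"
  have less: "int k < 2 ^ (1 + R * R)" if "k \<le> R * R" for k
  proof -
    have "k < 2 ^ k" by (rule less_exp)
    also have "\<dots> \<le> 2 ^ (1 + R * R)" using that by (intro power_increasing) auto
    finally have "int k < int (2 ^ (1 + R * R))" by (simp only: of_nat_less_iff)
    then show ?thesis by simp
  qed
  have R: "R > 0" "length w \<le> R" by (auto simp: R_def rounds_def)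
  have "R * 1 \<le> R * R" by (rule mult_le_mono) (use R in auto)
  then have RR: "length w \<le> R * R" "R \<le> R * R" "0 < R * R" using R by linarith+
  have "bnd (1 + R * R) (init_store w)"
    using less[of "length w"] less[of 1] less[of 0] RR by (auto simp: bnd_def init_store_def)
  then show ?thesis unfolding start_def R_def[symmetric]
    using less[of R] less[of "R * R"] RR by (intro bnd_upd) (simp_all del: of_nat_mult)
qed

text \<open>Acceptance reads only \<open>out\<close>, which the loop counters leave alone, so the
  verdict of \<open>den\<close> is that of the machine. The condition on \<open>m\<close> provides
  \<open>N\<close> coins for each of \<open>N * N\<close> trials.\<close>

theorem reducible_by_prog:
  assumes good: "good p"
    and prob: "\<And>w m. m \<ge> rounds (length w) ^ 3 \<Longrightarrow>
      measure_pmf.prob (pmf_of_set {r. length r = m}) {r. accepting (fst (den B p (start w, r))) \<longleftrightarrow> w \<in> A} \<ge> 2 / 3"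
  shows "rand_poly_turing_reducible A B"
proof -
  define W where "W n = weight (rounds n) (rounds n * rounds n) 0 p" for n
  define T where "T n = W n * (1 + (1 + rounds n * rounds n) + W n) +
    (100 + 10 * rounds n + 10 * rounds n * rounds n)" for n
  have R: "poly_bounded rounds" unfolding rounds_def[abs_def]
    by (intro poly_bounded_mult poly_bounded_add) simp_all
  have W: "poly_bounded W" unfolding W_def[abs_def]
    by (intro poly_bounded_weight poly_bounded_mult R)
  have "poly_bounded (\<lambda>n. T n + W n + rounds n * (rounds n * rounds n))" unfolding T_def
    by (intro poly_bounded_mult poly_bounded_add W R) simp_all
  \<comment> \<open>The three summands bound the running time, the coins demanded by
    \<open>comp_runs\<close> and the coins demanded by the probability hypothesis.\<close>
  then obtain q where q: "\<And>n. T n + W n + rounds n * (rounds n * rounds n) \<le> poly q n"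
    unfolding poly_bounded_def by blast
  have run: "\<exists>t \<le> m. \<exists>s. exec B (prelude (comp 0 p)) (init_store w, r) t (s, snd (den B p (start w, r))) \<and>
      agree s (fst (den B p (start w, r)))"
    if m: "m = poly q (length w)" and r: "length r = m" for w m r
  proof -
    have "runs B (comp 0 p) 0 (1 + rounds (length w) * rounds (length w)) (W (length w)) (start w, r) (den B p (start w, r))"
      unfolding W_def
      by (rule comp_runs[OF good _ bnd_start])
        (use q[of "length w"] m r in \<open>auto simp: agree_def start_def upd_def W_def\<close>)
    then obtain t s where "exec B (comp 0 p) (start w, r) t (s, snd (den B p (start w, r)))"
      "agree s (fst (den B p (start w, r)))"
      "t \<le> W (length w) * (1 + (1 + rounds (length w) * rounds (length w)) + W (length w))"
      unfolding runs_def by blast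
    moreover from this exec_prelude[OF this(1)] obtain t' where
      "exec B (prelude (comp 0 p)) (init_store w, r) t' (s, snd (den B p (start w, r)))" "t' \<le> T (length w)"
      unfolding T_def by (meson add_right_mono order.trans)
    moreover have "t' \<le> m" using q[of "length w"] m \<open>t' \<le> T (length w)\<close> by linarith
    ultimately show ?thesis by blast
  qed
  show ?thesis unfolding rand_poly_turing_reducible_def Let_def
  proof (intro exI[of _ "prelude (comp 0 p)"] exI[of _ q] allI conjI)
    fix w :: "bool list"
    let ?m = "poly q (length w)"
    show "\<forall>r\<in>{r. length r = ?m}. \<exists>t\<le>?m. \<exists>s r'. exec B (prelude (comp 0 p)) (init_store w, r) t (s, r')"
      using run by blast
    have "2 / 3 \<le> measure_pmf.prob (pmf_of_set {r. length r = ?m}) {r. accepting (fst (den B p (start w, r))) \<longleftrightarrow> w \<in> A}"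
      by (rule prob) (use q[of "length w"] in \<open>auto simp: power3_eq_cube\<close>)
    \<comment> \<open>Coin lists of other lengths have probability zero, and \<open>run\<close>
      speaks only about lists of length \<open>?m\<close>.\<close>
    also have "\<dots> = measure_pmf.prob (pmf_of_set {r. length r = ?m})
        ({r. accepting (fst (den B p (start w, r))) \<longleftrightarrow> w \<in> A} \<inter> {r. length r = ?m})"
    proof -
      have "finite {r :: bool list. length r = ?m}" "{r :: bool list. length r = ?m} \<noteq> {}"
        using finite_lists_length_eq[of "UNIV :: bool set" ?m] Ex_list_of_length[of ?m] by auto
      then show ?thesis by (metis measure_Int_set_pmf set_pmf_of_set)
    qed
    also have "\<dots> \<le> measure_pmf.prob (pmf_of_set {r. length r = ?m})
        {r. \<exists>t s r'. exec B (prelude (comp 0 p)) (init_store w, r) t (s, r') \<and> accepting s = (w \<in> A)}"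
    proof (rule measure_pmf.finite_measure_mono)
      have acc: "accepting s = accepting s'" if "agree s s'" for s s'
        using that by (auto simp: agree_def accepting_def)
      show "{r. accepting (fst (den B p (start w, r))) \<longleftrightarrow> w \<in> A} \<inter> {r. length r = ?m}
        \<subseteq> {r. \<exists>t s r'. exec B (prelude (comp 0 p)) (init_store w, r) t (s, r') \<and> accepting s = (w \<in> A)}"
        using run acc by blast
    qed simp
    finally show "2 / 3 \<le> measure_pmf.prob (pmf_of_set {r. length r = ?m})
        {r. \<exists>t s r'. exec B (prelude (comp 0 p)) (init_store w, r) t (s, r') \<and> accepting s = (w \<in> A)}" .
  qed
qed

subsection \<open>Encodings\<close>

abbreviation enc_poly :: "(int \<times> nat) list \<Rightarrow> bool list" where
  "enc_poly \<equiv> enc_sparse enc_int"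

abbreviation nonzero_terms :: "(int \<times> nat) list \<Rightarrow> bool" where
  "nonzero_terms \<equiv> sparse_list (\<lambda>c. c \<noteq> 0)"

text \<open>The continuations \<open>u\<close> and \<open>v\<close> make the property stable under
  concatenation; with both empty it is injectivity.\<close>

definition prefix_code :: "('a \<Rightarrow> bool list) \<Rightarrow> bool" where
  "prefix_code e \<longleftrightarrow> (\<forall>x y u v. e x @ u = e y @ v \<longrightarrow> x = y \<and> u = v)"

lemma enc_list_simps [simp]:
  "enc_list e [] = [False]" "enc_list e (x # xs) = True # e x @ enc_list e xs"
  by (simp_all add: enc_list_def)

lemma prefix_code_enc_list:
  assumes "prefix_code e"
  shows "prefix_code (enc_list e)"
proof -
  have "enc_list e xs @ u = enc_list e ys @ v \<Longrightarrow> xs = ys \<and> u = v" for xs ys u v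
  proof (induction xs arbitrary: ys)
    case Nil
    then show ?case by (cases ys) auto
  next
    case (Cons x xs)
    then obtain y ys' where ys: "ys = y # ys'" by (cases ys) auto
    with Cons.prems have "e x @ (enc_list e xs @ u) = e y @ (enc_list e ys' @ v)" by simp
    then have "x = y \<and> enc_list e xs @ u = enc_list e ys' @ v"
      using assms unfolding prefix_code_def by blast
    then show ?case using Cons.IH ys by blast
  qed
  then show ?thesis unfolding prefix_code_def by blast
qed

lemma bits_of_inject: "bits_of m = bits_of n \<Longrightarrow> m = n"
proof (induction m arbitrary: n rule: less_induct)
  case (less m)
  show ?case
  proof (cases "m = 0 \<or> n = 0")
    case True
    then show ?thesis using less.prems by (cases "m = 0"; cases "n = 0") (auto simp: bits_of_pos)
  next
    case False
    then have "odd m = odd n" "bits_of (m div 2) = bits_of (n div 2)" using less.prems by (auto simp: bits_of_pos)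
    then have "m div 2 = n div 2" "odd m = odd n" using less.IH[of "m div 2" "n div 2"] False by auto
    then show ?thesis by presburger
  qed
qed

lemma prefix_code_enc_nat: "prefix_code enc_nat"
proof -
  have "prefix_code (enc_list (\<lambda>b. [b]))" by (rule prefix_code_enc_list) (auto simp: prefix_code_def)
  then show ?thesis using bits_of_inject unfolding prefix_code_def enc_nat_def by blast
qed

lemma prefix_code_enc_int: "prefix_code enc_int"
  unfolding prefix_code_def
proof (intro allI impI)
  fix x y u v
  assume "enc_int x @ u = enc_int y @ v"
  then have sgn: "(x < 0) = (y < 0)" and "enc_nat (nat \<bar>x\<bar>) @ u = enc_nat (nat \<bar>y\<bar>) @ v"
    by (simp_all add: enc_int_def)
  then have "nat \<bar>x\<bar> = nat \<bar>y\<bar> \<and> u = v"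
    using prefix_code_enc_nat unfolding prefix_code_def by blast
  then show "x = y \<and> u = v" using sgn by linarith
qed

lemma prefix_code_enc_sparse:
  assumes "prefix_code e"
  shows "prefix_code (enc_sparse e)"
proof -
  have "prefix_code (\<lambda>(c, n). e c @ enc_nat n)"
    unfolding prefix_code_def
  proof (intro allI impI)
    fix x y :: "'a \<times> nat" and u v
    assume a: "(case x of (c, n) \<Rightarrow> e c @ enc_nat n) @ u = (case y of (c, n) \<Rightarrow> e c @ enc_nat n) @ v"
    obtain c n c' n' where xy: "x = (c, n)" "y = (c', n')" by (cases x, cases y)
    with a have "e c @ (enc_nat n @ u) = e c' @ (enc_nat n' @ v)" by simp
    then have "c = c' \<and> enc_nat n @ u = enc_nat n' @ v" using assms unfolding prefix_code_def by blast
    then have "c = c' \<and> n = n' \<and> u = v" using prefix_code_enc_nat unfolding prefix_code_def by blast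
    then show "x = y \<and> u = v" using xy by simp
  qed
  then show ?thesis unfolding enc_sparse_def[abs_def] by (rule prefix_code_enc_list)
qed

lemmas enc_sparse_int_prefix = prefix_code_enc_sparse[OF prefix_code_enc_int, unfolded prefix_code_def, rule_format]

lemma nondiv_Z_iff:
  "enc_poly g @ enc_poly f \<in> nondiv_Z \<longleftrightarrow>
     nonzero_terms g \<and> nonzero_terms f \<and> \<not> spoly g dvd spoly f"
proof
  assume "enc_poly g @ enc_poly f \<in> nondiv_Z"
  then obtain g' f' where 1: "enc_poly g @ enc_poly f = enc_poly g' @ enc_poly f'"
    "nonzero_terms g' \<and> nonzero_terms f' \<and> non_divides \<Z> g' f'"
    unfolding nondiv_Z_def by blast
  \<comment> \<open>The empty continuation gives the last code the shape required by the prefix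
    property.\<close>
  have "g = g'" "enc_poly f @ [] = enc_poly f' @ []" using enc_sparse_int_prefix[OF 1(1)] by auto
  moreover from this have "f = f'" using enc_sparse_int_prefix by blast
  ultimately show "nonzero_terms g \<and> nonzero_terms f \<and> \<not> spoly g dvd spoly f"
    using 1(2) by (simp add: non_divides_Z_iff)
next
  assume "nonzero_terms g \<and> nonzero_terms f \<and> \<not> spoly g dvd spoly f"
  then show "enc_poly g @ enc_poly f \<in> nondiv_Z"
    unfolding nondiv_Z_def by (auto simp: non_divides_Z_iff)
qed

section \<open>Oracle queries for a candidate prime\<close>

definition reduce :: "nat \<Rightarrow> (int \<times> nat) list \<Rightarrow> (int \<times> nat) list" where
  "reduce p ts = map (\<lambda>(c, n). (c mod int p, n)) ts"

definition question :: "nat \<Rightarrow> (int \<times> nat) list \<Rightarrow> (int \<times> nat) list \<Rightarrow> bool list" where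
  "question p g f = False # enc_nat p @ enc_poly (reduce p g) @ enc_poly (reduce p f)"

text \<open>\<open>reduce\<close> keeps terms whose coefficient becomes 0, and such a list is not
  sparse. Thus a prime dividing some coefficient yields a string that is not an instance.\<close>

lemma sparse_reduce_iff:
  assumes "p > 0"
  shows "sparse_list (prime_field_coeff p) (reduce p ts) \<longleftrightarrow>
    distinct (map snd ts) \<and> (\<forall>c\<in>fst ` set ts. \<not> int p dvd c)"
proof -
  have "map snd (reduce p ts) = map snd ts" by (auto simp: reduce_def)
  moreover have "(\<forall>(c, n)\<in>set (reduce p ts). prime_field_coeff p c) \<longleftrightarrow> (\<forall>c\<in>fst ` set ts. \<not> int p dvd c)"
  proof -
    have "prime_field_coeff p (c mod int p) \<longleftrightarrow> \<not> int p dvd c" for c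
      using assms by (auto simp: prime_field_coeff_def residue_ring_def dvd_eq_mod_eq_0)
    then show ?thesis by (simp add: reduce_def case_prod_beta)
  qed
  ultimately show ?thesis unfolding sparse_list_def by simp
qed

lemma question_in_iff:
  "question p g f \<in> nondiv_Fq \<longleftrightarrow> Factorial_Ring.prime p \<and>
     (distinct (map snd g) \<and> (\<forall>c\<in>fst ` set g. \<not> int p dvd c)) \<and>
     (distinct (map snd f) \<and> (\<forall>c\<in>fst ` set f. \<not> int p dvd c)) \<and>
     (\<forall>h. \<not> [:int p:] dvd spoly f - spoly g * h)" (is "_ \<longleftrightarrow> ?R")
proof -
  have eq: "Factorial_Ring.prime p \<and> sparse_list (prime_field_coeff p) (reduce p g) \<and>
      sparse_list (prime_field_coeff p) (reduce p f) \<and>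
      non_divides (prime_field p) (reduce p g) (reduce p f) \<longleftrightarrow> ?R"
  proof (cases "Factorial_Ring.prime p")
    case True
    then have "p > 0" by (rule prime_gt_0_nat)
    then show ?thesis
      using non_divides_prime_field_iff[OF True, of g f] True
      unfolding reduce_def[symmetric] by (simp only: sparse_reduce_iff simp_thms)
  qed simp
  show ?thesis
  proof
    assume "question p g f \<in> nondiv_Fq"
    \<comment> \<open>The leading bit \<open>False\<close> excludes the presentation by an extension
      field.\<close>
    then obtain p' g' f' where 1: "enc_nat p @ enc_poly (reduce p g) @ enc_poly (reduce p f) =
        enc_nat p' @ enc_poly g' @ enc_poly f'"
      "Factorial_Ring.prime p'" "sparse_list (prime_field_coeff p') g'" "sparse_list (prime_field_coeff p') f'"
      "non_divides (prime_field p') g' f'"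
      unfolding nondiv_Fq_def nondiv_Fq_prime_def nondiv_Fq_ext_def question_def by auto
    have 2: "p = p'" "enc_poly (reduce p g) @ enc_poly (reduce p f) = enc_poly g' @ enc_poly f'"
      using 1(1) prefix_code_enc_nat unfolding prefix_code_def by blast+
    have "reduce p g = g'" "enc_poly (reduce p f) @ [] = enc_poly f' @ []"
      using enc_sparse_int_prefix[OF 2(2)] by auto
    moreover from this have "reduce p f = f'" using enc_sparse_int_prefix by blast
    ultimately show ?R using 1 2 eq by blast
  next
    assume ?R
    then have "Factorial_Ring.prime p \<and> sparse_list (prime_field_coeff p) (reduce p g) \<and>
      sparse_list (prime_field_coeff p) (reduce p f) \<and> non_divides (prime_field p) (reduce p g) (reduce p f)"
      by (rule iffD2[OF eq])
    then have "question p g f \<in> nondiv_Fq_prime"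
      unfolding nondiv_Fq_prime_def question_def mem_Collect_eq
      by (intro exI[of _ p] exI[of _ "reduce p g"] exI[of _ "reduce p f"] conjI refl) simp_all
    then show "question p g f \<in> nondiv_Fq" by (simp add: nondiv_Fq_def)
  qed
qed

lemma length_enc_nat: "length (enc_nat n) = 2 * length (bits_of n) + 1"
proof -
  have "length (enc_list (\<lambda>b. [b]) bs) = 2 * length bs + 1" for bs :: "bool list"
    by (induction bs) auto
  then show ?thesis by (simp add: enc_nat_def)
qed

lemma length_enc_int: "length (enc_int k) = 2 * length (bits_of (nat \<bar>k\<bar>)) + 2"
  by (simp add: enc_int_def length_enc_nat)

lemma enc_sparse_simps [simp]:
  "enc_sparse e [] = [False]"
  "enc_sparse e ((c, n) # ts) = True # e c @ enc_nat n @ enc_sparse e ts"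
  by (simp_all add: enc_sparse_def)

lemma length_enc_sparse_int:
  "(c, n) \<in> set ts \<Longrightarrow> length ts + length (bits_of (nat \<bar>c\<bar>)) + length (bits_of n) \<le> length (enc_poly ts)"
  "length ts \<le> length (enc_poly ts)"
proof -
  show le: "length ts \<le> length (enc_poly ts)" for ts
    by (induction ts) auto
  show "(c, n) \<in> set ts \<Longrightarrow> length ts + length (bits_of (nat \<bar>c\<bar>)) + length (bits_of n) \<le> length (enc_poly ts)"
  proof (induction ts)
    case (Cons t ts)
    then show ?case using le[of ts]
      by (cases t) (auto simp: length_enc_nat length_enc_int)
  qed simp
qed

subsection \<open>The success probability of a single query\<close>

definition content_ok :: "(int \<times> nat) list \<Rightarrow> (int \<times> nat) list \<Rightarrow> bool" where
  "content_ok g f \<longleftrightarrow> (\<forall>c\<in>fst ` set f. Gcd (fst ` set g) dvd c)"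

text \<open>With distinct exponents the listed coefficients are exactly those that determine the
  content. For empty \<open>g\<close> both gcds are 0, and 0 divides only 0; so the content test
  alone settles the zero divisor.\<close>

lemma content_ok_iff:
  assumes "distinct (map snd g)" "distinct (map snd f)"
  shows "content_ok g f \<longleftrightarrow> content (spoly g) dvd content (spoly f)"
proof -
  have "Gcd (fst ` set g) = content (spoly g)"
  proof (rule associated_eqI)
    show "Gcd (fst ` set g) dvd content (spoly g)"
      unfolding content_spoly_dvd_iff[OF assms(1)] by (auto intro: Gcd_dvd)
    show "content (spoly g) dvd Gcd (fst ` set g)"
      using content_spoly_dvd_iff[OF assms(1), of "content (spoly g)"] by (auto intro: Gcd_greatest)
    show "normalize (content (spoly g)) = content (spoly g)" by (rule normalize_content)
  qed simp
  then show ?thesis unfolding content_ok_def content_spoly_dvd_iff[OF assms(2)] by simp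
qed

text \<open>The error is one-sided: an integral factorization survives reduction modulo any
  \<open>p\<close>, so a dividing pair is never accepted.\<close>

lemma dvd_imp_no_success:
  assumes "distinct (map snd g)" "distinct (map snd f)" "spoly g dvd spoly f"
  shows "content_ok g f" "question p g f \<notin> nondiv_Fq"
proof -
  obtain h where h: "spoly f = spoly g * h" using assms(3) by (elim dvdE)
  show "content_ok g f" unfolding content_ok_iff[OF assms(1,2)] h content_mult by simp
  have "[:int p:] dvd spoly f - spoly g * h" by (simp add: h)
  then show "question p g f \<notin> nondiv_Fq" unfolding question_in_iff by blast
qed

text \<open>It suffices that the prime avoids \<open>D * E\<close>: the factor \<open>D\<close>
  preserves the non-divisibility, and \<open>E\<close>, the product of all coefficients, keeps the
  reduced lists sparse.\<close>

lemma many_successes: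
  assumes sp: "nonzero_terms g" "nonzero_terms f"
    and nd: "\<not> spoly g dvd spoly f" and ok: "content_ok g f"
    and n: "n = length (enc_poly g @ enc_poly f)"
  shows "2 ^ rounds n \<le> 2 * rounds n * card {p. p < 2 ^ rounds n \<and> question p g f \<in> nondiv_Fq}"
proof -
  have dist: "distinct (map snd g)" "distinct (map snd f)" using sp by (auto simp: sparse_list_def)
  have small: "\<bar>c\<bar> \<le> 2 ^ n \<and> e < 2 ^ n" if "(c, e) \<in> set g \<union> set f" for c e
  proof -
    have "length (bits_of (nat \<bar>c\<bar>)) \<le> n" "length (bits_of e) \<le> n"
      using that length_enc_sparse_int(1)[of c e g] length_enc_sparse_int(1)[of c e f] by (auto simp: n)
    then have "nat \<bar>c\<bar> < 2 ^ n" "e < 2 ^ n"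
      using less_power_length_bits_of[of "nat \<bar>c\<bar>"] less_power_length_bits_of[of e]
      by (meson less_le_trans one_le_numeral power_increasing)+
    then show ?thesis by (simp add: nat_less_iff)
  qed
  have coeff: "\<bar>Polynomial.coeff (spoly ts) i\<bar> \<le> 2 ^ n" if ts: "ts = g \<or> ts = f" for ts i
  proof (cases "i \<in> snd ` set ts")
    case True
    then obtain c where c: "(c, i) \<in> set ts" by force
    then have "Polynomial.coeff (spoly ts) i = c" using coeff_spoly[of ts c i] ts dist by auto
    then show ?thesis using small[of c i] c ts by auto
  qed (simp add: coeff_spoly_notin)
  have n1: "length g + length f \<le> n" using length_enc_sparse_int(2)[of g] length_enc_sparse_int(2)[of f] by (simp add: n)
  have g0: "spoly g \<noteq> 0"
  proof
    assume "spoly g = 0"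
    then have "content (spoly f) = 0" using ok unfolding content_ok_iff[OF dist] by simp
    then show False using nd by simp
  qed
  \<comment> \<open>Exponents are written in binary with at most \<open>n\<close> bits, so the
    degree may be exponential in the input length. This is the source of the doubly exponential
    bound on \<open>D\<close>.\<close>
  have deg: "Suc (Polynomial.degree (spoly f)) \<le> 2 ^ n"
  proof (cases "spoly f = 0")
    case False
    then have "Polynomial.coeff (spoly f) (Polynomial.degree (spoly f)) \<noteq> 0" by simp
    then have "Polynomial.degree (spoly f) \<in> snd ` set f" using coeff_spoly_notin by blast
    then show ?thesis using small by force
  qed auto
  obtain D where D: "D \<noteq> 0" "\<bar>D\<bar> \<le> 2 ^ n * (2 ^ n * (2 * 2 ^ n) ^ Suc (Polynomial.degree (spoly f)))"
    "\<And>p h. Factorial_Ring.prime p \<Longrightarrow> \<not> p dvd D \<Longrightarrow> \<not> [:p:] dvd spoly f - spoly g * h"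
  proof -
    have "\<And>i. \<bar>Polynomial.coeff (spoly g) i\<bar> \<le> 2 ^ n" "\<And>i. \<bar>Polynomial.coeff (spoly f) i\<bar> \<le> 2 ^ n"
      by (rule coeff; simp)+
    moreover have "content (spoly g) dvd content (spoly f)" using ok content_ok_iff[OF dist] by simp
    ultimately show ?thesis using that exists_bad_product[OF g0 nd, of "2 ^ n"] by metis
  qed
  define E where "E = (\<Prod>(c, e)\<leftarrow>g @ f. c)"
  have E0: "E \<noteq> 0" using sp by (auto simp: E_def sparse_list_def prod_list_zero_iff)
  have Eb: "\<bar>E\<bar> \<le> (2 ^ n) ^ length (g @ f)"
  proof -
    have "\<bar>\<Prod>(c, e)\<leftarrow>ts. c\<bar> \<le> (2 ^ n) ^ length ts" if "set ts \<subseteq> set g \<union> set f" for ts :: "(int \<times> nat) list"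
      using that
    proof (induction ts)
      case (Cons t ts)
      obtain c e where t: "t = (c, e)" by (cases t)
      have "\<bar>c\<bar> \<le> 2 ^ n" using small[of c e] Cons.prems t by auto
      moreover have "\<bar>\<Prod>(c, e)\<leftarrow>ts. c\<bar> \<le> (2 ^ n) ^ length ts" using Cons by auto
      ultimately have "\<bar>c * (\<Prod>(c, e)\<leftarrow>ts. c)\<bar> \<le> 2 ^ n * (2 ^ n) ^ length ts"
        unfolding abs_mult by (intro mult_mono) auto
      then show ?case by (simp only: t list.map prod_list.Cons prod.case length_Cons power_Suc)
    qed simp
    from this[of "g @ f"] show ?thesis unfolding E_def by (simp only: set_append subset_refl)
  qed
  define F where "F = nat \<bar>D * E\<bar>"
  have F0: "F \<noteq> 0" using D E0 by (simp add: F_def)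
  have "\<bar>D * E\<bar> \<le> 2 ^ n * (2 ^ n * (2 * 2 ^ n) ^ (2 ^ n)) * (2 ^ n) ^ n"
    unfolding abs_mult
  proof (rule mult_mono)
    show "\<bar>D\<bar> \<le> 2 ^ n * (2 ^ n * (2 * 2 ^ n) ^ (2 ^ n))"
    proof (rule order.trans[OF D(2)])
      have "(1::int) \<le> 2 ^ n" by simp
      then have "(1::int) \<le> 2 * 2 ^ n" by linarith
      then have "(2 * 2 ^ n :: int) ^ Suc (Polynomial.degree (spoly f)) \<le> (2 * 2 ^ n) ^ (2 ^ n)"
        by (rule power_increasing[OF deg])
      then show "2 ^ n * (2 ^ n * (2 * 2 ^ n) ^ Suc (Polynomial.degree (spoly f)))
        \<le> (2::int) ^ n * (2 ^ n * (2 * 2 ^ n) ^ (2 ^ n))"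
        by (intro mult_left_mono) simp_all
    qed
    show "\<bar>E\<bar> \<le> (2 ^ n) ^ n"
    proof (rule order.trans[OF Eb])
      show "(2 ^ n :: int) ^ length (g @ f) \<le> (2 ^ n) ^ n"
        by (rule power_increasing) (use n1 in simp_all)
    qed
  qed auto
  also have "(2::int) * 2 ^ n = 2 ^ (n + 1)" by simp
  also have "2 ^ n * (2 ^ n * (2 ^ (n + 1)) ^ (2 ^ n)) * (2 ^ n) ^ n = (2::int) ^ (n + (n + (n + 1) * 2 ^ n) + n * n)"
    by (simp only: power_mult[symmetric] power_add[symmetric])
  also have "(2::int) ^ (n + (n + (n + 1) * 2 ^ n) + n * n) < 2 ^ (2 ^ (4 * (n + 1)))"
  proof (rule power_strict_increasing)
    \<comment> \<open>With \<open>n < z\<close> and \<open>1 \<le> z\<close>, every summand of the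
      exponent is at most a multiple of \<open>z * z\<close>, four such in total.\<close>
    define z :: nat where "z = 2 ^ n"
    have "n < z" unfolding z_def by (rule less_exp)
    then have "n + n \<le> 2 * z" "(n + 1) * z \<le> z * z" "n * n \<le> z * z" "1 * z \<le> z * z"
      by (intro mult_le_mono; simp; fail | simp)+
    then have "n + (n + (n + 1) * 2 ^ n) + n * n \<le> 4 * (z * z)" unfolding z_def[symmetric] by simp
    also have "\<dots> = 2 ^ (2 * n + 2)" by (simp add: z_def power_add mult_2)
    also have "\<dots> < 2 ^ (4 * (n + 1))" by (rule power_strict_increasing) auto
    finally show "n + (n + (n + 1) * 2 ^ n) + n * n < 2 ^ (4 * (n + 1))" .
  qed simp
  finally have Fb: "F < 2 ^ 2 ^ (4 * (n + 1))" unfolding F_def by (simp add: nat_less_iff)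
  have "2 ^ rounds n \<le> 2 * rounds n * card {p. Factorial_Ring.prime p \<and> p < 2 ^ rounds n \<and> \<not> p dvd F}"
    by (rule card_good_primes[OF _ F0 Fb]) (simp add: rounds_def)
  also have "\<dots> \<le> 2 * rounds n * card {p. p < 2 ^ rounds n \<and> question p g f \<in> nondiv_Fq}"
  proof (intro mult_le_mono2 card_mono)
    show "{p. Factorial_Ring.prime p \<and> p < 2 ^ rounds n \<and> \<not> p dvd F}
       \<subseteq> {p. p < 2 ^ rounds n \<and> question p g f \<in> nondiv_Fq}"
    proof safe
      fix p assume p: "Factorial_Ring.prime p" "\<not> p dvd F"
      have "\<not> int p dvd D * E" using p(2) unfolding F_def by (metis int_dvd_int_iff dvd_abs_iff abs_ge_zero nat_0_le)
      then have pD: "\<not> int p dvd D" and pE: "\<not> int p dvd E" by auto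
      have "\<not> int p dvd c" if "c \<in> fst ` set g \<union> fst ` set f" for c
      proof -
        have "c \<in> set (map (\<lambda>(c, e). c) (g @ f))" using that by force
        then have "c dvd E" unfolding E_def by (rule prod_list_dvd)
        then show ?thesis using pE dvd_trans by blast
      qed
      then show "question p g f \<in> nondiv_Fq"
        unfolding question_in_iff using p dist D(3)[of "int p"] pD by auto
    qed
  qed auto
  finally show ?thesis .
qed

subsection \<open>The program\<close>

abbreviation V :: "string \<Rightarrow> aexp" where
  "V x \<equiv> Get x (Num 0)"

abbreviation Let1 :: "string \<Rightarrow> aexp \<Rightarrow> prog" where
  "Let1 x a \<equiv> Asg x (Num 0) a"

abbreviation Inc :: "string \<Rightarrow> int \<Rightarrow> prog" where
  "Inc x k \<equiv> Let1 x (Add (V x) (Num k))"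

abbreviation Rem :: "aexp \<Rightarrow> aexp \<Rightarrow> aexp" where
  "Rem a b \<equiv> Sub a (Mul (Div a b) b)"

abbreviation Rem2 :: "aexp \<Rightarrow> aexp" where
  "Rem2 a \<equiv> Rem a (Num 2)"

primrec block :: "prog list \<Rightarrow> prog" where
  "block [] = Nop"
| "block (p # ps) = Sq p (block ps)"

text \<open>\<open>i\<close> is the reading position, \<open>v\<close> the value so far and
  \<open>w\<close> the place value of the next digit, doubled by addition. A digit takes two
  entries, the announcing bit and the digit itself.\<close>

definition read_digit :: prog where
  "read_digit = block
     [If (Get ''in'' (Add (V ''i'') (Num 1))) (Let1 ''v'' (Add (V ''v'') (V ''w''))) Nop,
      Let1 ''w'' (Add (V ''w'') (V ''w'')), Inc ''i'' 2]"

definition read_nat :: prog where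
  "read_nat = block
     [Let1 ''v'' (Num 0), Let1 ''w'' (Num 1), Rep (If (Get ''in'' (V ''i'')) read_digit Nop), Inc ''i'' 1]"

text \<open>The step of 2 passes the announcing bit of the term and the sign bit, which is kept in
  \<open>s\<close>.\<close>

definition read_term :: prog where
  "read_term = block
     [Let1 ''s'' (Get ''in'' (Add (V ''i'') (Num 1))), Inc ''i'' 2, read_nat,
      Asg ''C'' (V ''k'') (V ''v''), If (V ''s'') (Asg ''C'' (V ''k'') (Sub (Num 0) (V ''v''))) Nop,
      read_nat, Asg ''E'' (V ''k'') (V ''v''), Inc ''k'' 1]"

definition read_poly :: prog where
  "read_poly = block [Rep (If (Get ''in'' (V ''i'')) read_term Nop), Inc ''i'' 1]"

text \<open>Both polynomials share the arrays \<open>C\<close> and \<open>E\<close>, since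
  \<open>k\<close> is not reset: entries below \<open>n\<close> belong to the divisor
  \<open>g\<close>, those from \<open>n\<close> up to \<open>m\<close> to \<open>f\<close>.\<close>

definition parse :: prog where
  "parse = block [read_poly, Let1 ''n'' (V ''k''), read_poly, Let1 ''m'' (V ''k'')]"

definition emit_bit :: "aexp \<Rightarrow> prog" where
  "emit_bit a = block [Asg ''y'' (V ''l'') a, Inc ''l'' 1]"

definition emit_digit :: prog where
  "emit_digit = block [emit_bit (Num 1), emit_bit (Rem2 (V ''v'')), Let1 ''v'' (Div (V ''v'') (Num 2))]"

definition emit_nat :: prog where
  "emit_nat = block [Rep (If (V ''v'') emit_digit Nop), emit_bit (Num 0)]"

text \<open>Negative values of \<open>c\<close> occur only for \<open>p = 0\<close>, when the
  coefficients are copied unreduced; for positive \<open>p\<close> the sign bit is always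
  \<open>False\<close>.\<close>

definition emit_term :: prog where
  "emit_term = block
     [emit_bit (Num 1), Let1 ''c'' (Rem (Get ''C'' (V ''k'')) (V ''p'')), emit_bit (Less (V ''c'') (Num 0)),
      Let1 ''v'' (V ''c''), If (Less (V ''c'') (Num 0)) (Let1 ''v'' (Sub (Num 0) (V ''c''))) Nop, emit_nat,
      Let1 ''v'' (Get ''E'' (V ''k'')), emit_nat, Inc ''k'' 1]"

definition emit_poly :: prog where
  "emit_poly = block [Rep (If (Less (V ''k'') (V ''h'')) emit_term Nop), emit_bit (Num 0)]"

definition emit :: prog where
  "emit = block
     [Let1 ''l'' (Num 0), emit_bit (Num 0), Let1 ''v'' (V ''p''), emit_nat, Let1 ''k'' (Num 0),
      Let1 ''h'' (V ''n''), emit_poly, Let1 ''h'' (V ''m''), emit_poly]"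

text \<open>
  The parser checks nothing. The input is well-formed iff writing down the parsed terms again gives
  back the input; with \<open>p = 0\<close> the query writer leaves the coefficients as they are, since \<open>c mod 0 = c\<close>,
  and produces two extra leading bits for \<open>p\<close>.
\<close>

definition compare :: prog where
  "compare = block
     [Let1 ''x'' (Sub (V ''l'') (Add (V ''len'') (Num 2))), Let1 ''j'' (Num 0),
      Rep (If (Less (V ''j'') (V ''len''))
        (block [If (Sub (Get ''in'' (V ''j'')) (Get ''y'' (Add (V ''j'') (Num 2)))) (Let1 ''x'' (Num 1)) Nop,
           Inc ''j'' 1]) Nop)]"

text \<open>The outer difference is nonzero iff the entries \<open>j\<close> and \<open>k\<close>
  belong to different polynomials; equal exponents are an error only within one polynomial.
  \<open>x\<close> is the error flag.\<close>

definition check_exponent :: prog where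
  "check_exponent = block
     [If (Sub (Less (V ''j'') (V ''n'')) (Less (V ''k'') (V ''n''))) Nop
        (If (Sub (Get ''E'' (V ''j'')) (Get ''E'' (V ''k''))) Nop (Let1 ''x'' (Num 1))),
      Inc ''j'' 1]"

definition check_term :: prog where
  "check_term = block
     [If (Get ''C'' (V ''k'')) Nop (Let1 ''x'' (Num 1)), Let1 ''j'' (Num 0),
      Rep (If (Less (V ''j'') (V ''k'')) check_exponent Nop), Inc ''k'' 1]"

definition check :: prog where
  "check = block [Let1 ''k'' (Num 0), Rep (If (Less (V ''k'') (V ''m'')) check_term Nop)]"

definition euclid_step :: prog where
  "euclid_step = block
     [Let1 ''t'' (Rem (V ''a'') (V ''b'')), Let1 ''a'' (V ''b''), Let1 ''b'' (V ''t'')]"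

definition gcd_step :: prog where
  "gcd_step = block [Let1 ''b'' (Get ''C'' (V ''k'')), Rep (If (V ''b'') euclid_step Nop), Inc ''k'' 1]"

definition content_step :: prog where
  "content_step = block [If (Rem (Get ''C'' (V ''k'')) (V ''a'')) (Let1 ''r'' (Num 1)) Nop, Inc ''k'' 1]"

text \<open>\<open>a\<close> and \<open>r\<close> are still 0 from the initial store, and 0 is
  neutral for the gcd. The gcd loop leaves \<open>k = n\<close>, so the divisibility loop resumes at
  the first term of \<open>f\<close>. If \<open>a = 0\<close>, the remainder is the coefficient
  itself, as it should be.\<close>

definition contents :: prog where
  "contents = block
     [Let1 ''k'' (Num 0), Rep (If (Less (V ''k'') (V ''n'')) gcd_step Nop),
      Rep (If (Less (V ''k'') (V ''m'')) content_step Nop)]"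

definition toss_digit :: prog where
  "toss_digit = block [Toss ''d'', Let1 ''p'' (Add (Add (V ''p'') (V ''p'')) (V ''d''))]"

text \<open>
  If \<open>p\<close> divides a coefficient, then the query contains a zero coefficient; it is then not an
  instance, and the answer is negative.
\<close>

definition trial :: prog where
  "trial = block
     [Let1 ''p'' (Num 0), Rep toss_digit, emit, Let1 ''q'' (Num 0), Ask ''q'' ''y'' (V ''l''),
      If (V ''q'') (Let1 ''r'' (Num 1)) Nop]"

text \<open>The nested \<open>Rep\<close> yields \<open>N * N\<close> trials. They run on malformed
  inputs as well; only the last line consults \<open>x\<close>, and \<open>out\<close> is 0 by
  default, which means rejection.\<close>

definition main :: prog where
  "main = block
     [parse, emit, compare, check, contents, Rep (Rep trial),
      If (V ''x'') Nop (Let1 ''out'' (V ''r''))]"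

lemmas prog_defs = read_digit_def read_nat_def read_term_def read_poly_def parse_def emit_bit_def
  emit_digit_def emit_nat_def emit_term_def emit_poly_def emit_def compare_def check_exponent_def
  check_term_def check_def euclid_step_def gcd_step_def content_step_def contents_def toss_digit_def
  trial_def main_def

lemma good_main: "good main"
  by (simp add: prog_defs good_var_def good_exp_def)

lemma mods_prog:
  "mods read_digit = {''v'', ''w'', ''i''}"
  "mods read_nat = {''v'', ''w'', ''i''}"
  "mods read_term = {''v'', ''w'', ''i'', ''s'', ''C'', ''E'', ''k''}"
  "mods read_poly = {''v'', ''w'', ''i'', ''s'', ''C'', ''E'', ''k''}"
  "mods parse = {''v'', ''w'', ''i'', ''s'', ''C'', ''E'', ''k'', ''n'', ''m''}"
  "mods (emit_bit a) = {''y'', ''l''}"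
  "mods emit_digit = {''y'', ''l'', ''v''}"
  "mods emit_nat = {''y'', ''l'', ''v''}"
  "mods emit_term = {''y'', ''l'', ''v'', ''c'', ''k''}"
  "mods emit_poly = {''y'', ''l'', ''v'', ''c'', ''k''}"
  "mods emit = {''y'', ''l'', ''v'', ''c'', ''k'', ''h''}"
  "mods compare = {''x'', ''j''}"
  "mods check_exponent = {''x'', ''j''}"
  "mods check_term = {''x'', ''j'', ''k''}"
  "mods check = {''x'', ''j'', ''k''}"
  "mods euclid_step = {''t'', ''a'', ''b''}"
  "mods gcd_step = {''t'', ''a'', ''b'', ''k''}"
  "mods content_step = {''r'', ''k''}"
  "mods contents = {''t'', ''a'', ''b'', ''k'', ''r''}"
  "mods toss_digit = {''d'', ''p''}"
  "mods trial = {''d'', ''p'', ''y'', ''l'', ''v'', ''c'', ''k'', ''h'', ''q'', ''r''}"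
  by (auto simp: prog_defs)

lemma toss_free_prog:
  "toss_free parse" "toss_free emit" "toss_free compare" "toss_free check" "toss_free contents"
  by (auto simp: prog_defs)

lemma frame_power: "x \<notin> mods p \<Longrightarrow> fst ((den Q p ^^ n) u) x = fst u x"
  by (induction n) (auto simp: frame)

lemma upd_apply: "upd s x i k y = (if y = x then (s x)(i := k) else s y)"
  by (simp add: upd_def)

declare den.simps [simp del]

lemmas den_simps = den.simps(1-6) block.simps

lemma rep_inv:
  assumes "I 0 u" "\<And>k u. k < N \<Longrightarrow> I k u \<Longrightarrow> I (Suc k) (den Q p u)"
  shows "I N ((den Q p ^^ N) u)"
proof -
  have "k \<le> N \<Longrightarrow> I k ((den Q p ^^ k) u)" for k
    by (induction k) (use assms in auto)
  then show ?thesis by simp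
qed

text \<open>A for-loop inside a fixed number of rounds: after \<open>t\<close> rounds the index is
  \<open>min (K + t) H\<close>. Once it reaches \<open>H\<close> the guard fails and the remaining
  rounds are idle.\<close>

lemma rep_for:
  fixes I :: "nat \<Rightarrow> store \<Rightarrow> bool"
  assumes "I K (fst u)" "K \<le> H" "H - K \<le> N"
    and step: "\<And>k u. K \<le> k \<Longrightarrow> k < H \<Longrightarrow> I k (fst u) \<Longrightarrow> I (Suc k) (fst (den Q p u))"
    and guard: "\<And>k s. K \<le> k \<Longrightarrow> k \<le> H \<Longrightarrow> I k s \<Longrightarrow> aval g s \<noteq> 0 \<longleftrightarrow> k < H"
  shows "I H (fst ((den Q (If g p Nop) ^^ N) u))"
proof -
  have "I (min (K + t) H) (fst ((den Q (If g p Nop) ^^ t) u))" for t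
  proof (induction t)
    case 0
    then show ?case using assms(1,2) by (simp add: min_def)
  next
    case (Suc t)
    let ?u = "(den Q (If g p Nop) ^^ t) u"
    show ?case
    proof (cases "K + t < H")
      case True
      then have I: "I (K + t) (fst ?u)" using Suc by (simp del: den.simps)
      then have "aval g (fst ?u) \<noteq> 0" using guard[of "K + t" "fst ?u"] True by (simp del: den.simps)
      then have "(den Q (If g p Nop) ^^ Suc t) u = den Q p ?u" by (simp only: funpow.simps o_apply den.simps if_True not_False_eq_True)
      then show ?thesis using step[OF _ True I] True by (simp del: den.simps funpow.simps)
    next
      case False
      then have I: "I H (fst ?u)" using Suc by (simp del: den.simps)
      then have "aval g (fst ?u) = 0" using guard[of H "fst ?u"] assms(2) by (simp del: den.simps)
      then have "(den Q (If g p Nop) ^^ Suc t) u = ?u" by (simp only: funpow.simps o_apply den.simps if_False not_True_eq_False simp_thms)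
      then show ?thesis using I False by (simp del: den.simps funpow.simps)
    qed
  qed
  moreover have "min (K + N) H = H" using assms(2,3) by simp
  ultimately show ?thesis by metis
qed

subsection \<open>Reading the input\<close>

definition inp :: "bool list \<Rightarrow> nat \<Rightarrow> int" where
  "inp w = (\<lambda>i. of_bool (i < length w \<and> w ! i))"

lemma inp_drop:
  assumes "drop pos w = b # rest"
  shows "inp w pos = of_bool b" "drop (Suc pos) w = rest"
proof -
  have l: "pos < length w" using assms by (metis drop_all list.distinct(1) not_le_imp_less)
  then have "w ! pos = b" using assms by (metis hd_drop_conv_nth list.sel(1))
  then show "inp w pos = of_bool b" using l by (simp add: inp_def)
  show "drop (Suc pos) w = rest" using assms by (simp add: drop_Suc drop_tl)
qed

lemma drop_append: "drop pos w = xs @ rest \<Longrightarrow> drop (pos + length xs) w = rest"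
  by (metis add.commute append_eq_conv_conj drop_drop)

lemma nat_int_plus [simp]: "nat (int k + 1) = Suc k" "nat (int k + 2) = Suc (Suc k)"
  by simp_all

primrec bval :: "bool list \<Rightarrow> nat" where
  "bval [] = 0"
| "bval (b # bs) = of_bool b + 2 * bval bs"

lemma bval_snoc: "bval (bs @ [b]) = bval bs + 2 ^ length bs * of_bool b"
  by (induction bs) auto

lemma bval_bits_of [simp]: "bval (bits_of n) = n"
proof (induction n rule: less_induct)
  case (less n)
  then show ?case by (cases "n = 0") (auto simp: bits_of_pos)
qed

definition digits :: "bool list \<Rightarrow> bool list" where
  "digits bs = concat (map (\<lambda>b. [True, b]) bs)"

lemma digits_simps [simp]:
  "digits [] = []" "digits (b # bs) = True # b # digits bs" "length (digits bs) = 2 * length bs"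
proof -
  show "length (digits bs) = 2 * length bs" by (induction bs) (auto simp: digits_def)
qed (auto simp: digits_def)

lemma enc_nat_digits: "enc_nat n = digits (bits_of n) @ [False]"
  by (simp add: enc_nat_def enc_list_def digits_def)

lemma inp_digits:
  "drop pos w = digits bs @ False # rest \<Longrightarrow>
    (\<forall>k<length bs. inp w (pos + 2 * k) = 1 \<and> inp w (Suc (pos + 2 * k)) = of_bool (bs ! k)) \<and>
    inp w (pos + 2 * length bs) = 0"
proof (induction bs arbitrary: pos)
  case Nil
  then show ?case using inp_drop[of pos w False rest] by simp
next
  case (Cons b bs)
  then have 1: "inp w pos = 1" "drop (Suc pos) w = b # digits bs @ False # rest"
    using inp_drop[of pos w True] by auto
  from inp_drop[OF 1(2)] have 2: "inp w (Suc pos) = of_bool b" "drop (Suc (Suc pos)) w = digits bs @ False # rest" by auto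
  from Cons.IH[OF 2(2)] 1(1) 2(1) show ?case
    by (simp add: All_less_Suc2)
qed

lemma read_nat_spec:
  assumes "fst u ''in'' = inp w" "fst u ''i'' 0 = int pos" "fst u ''N'' 0 = int N"
    and d: "drop pos w = enc_nat n @ rest" and N: "length (bits_of n) \<le> N"
  shows "fst (den Q read_nat u) ''v'' 0 = int n" "fst (den Q read_nat u) ''i'' 0 = int (pos + length (enc_nat n))"
proof -
  define bs where "bs = bits_of n"
  have w: "\<And>k. k < length bs \<Longrightarrow> inp w (pos + 2 * k) = 1 \<and> inp w (Suc (pos + 2 * k)) = of_bool (bs ! k)"
      "inp w (pos + 2 * length bs) = 0"
    using inp_digits[of pos w bs rest] d by (auto simp: bs_def enc_nat_digits)
  define u1 where "u1 = den Q (Let1 ''w'' (Num 1)) (den Q (Let1 ''v'' (Num 0)) u)"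
  define I where "I k s \<longleftrightarrow> s ''in'' = inp w \<and> s ''i'' 0 = int (pos + 2 * k) \<and>
     s ''v'' 0 = int (bval (take k bs)) \<and> s ''w'' 0 = 2 ^ k" for k and s :: store
  have "I (length bs) (fst ((den Q (If (Get ''in'' (V ''i'')) read_digit Nop) ^^ N) u1))"
  proof (rule rep_for[where K = 0])
    show "I 0 (fst u1)" using assms by (simp add: I_def u1_def den_simps upd_apply)
    show "length bs - 0 \<le> N" using N by (simp add: bs_def)
    fix k assume k: "k < length bs"
    fix u :: "config" assume I: "I k (fst u)"
    have "bval (take (Suc k) bs) = bval (take k bs) + 2 ^ k * of_bool (bs ! k)"
      using bval_snoc[of "take k bs" "bs ! k"] k by (simp add: take_Suc_conv_app_nth)
    moreover have "nat (int pos + 2 * int k + 1) = Suc (pos + 2 * k)" by simp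
    ultimately show "I (Suc k) (fst (den Q read_digit u))"
      using I w(1)[OF k] by (auto simp: I_def read_digit_def den_simps upd_apply)
  next
    fix k s assume "k \<le> length bs" "I k s"
    moreover have "nat (int pos + 2 * int k) = pos + 2 * k" by simp
    ultimately show "(aval (Get ''in'' (V ''i'')) s \<noteq> 0) = (k < length bs)"
      using w by (cases "k = length bs") (auto simp: I_def)
  qed simp
  moreover have "den Q read_nat u = den Q (Inc ''i'' 1) ((den Q (If (Get ''in'' (V ''i'')) read_digit Nop) ^^ N) u1)"
    using assms(3) by (simp add: read_nat_def den_simps den.simps(7) u1_def upd_apply)
  ultimately show "fst (den Q read_nat u) ''v'' 0 = int n" "fst (den Q read_nat u) ''i'' 0 = int (pos + length (enc_nat n))"
    by (simp_all add: I_def den_simps upd_apply enc_nat_digits bs_def)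
qed

text \<open>This holds for arbitrary input: at most \<open>N\<close> digits are read, and the value
  stays below the place value \<open>w\<close>. It makes the write-back test meaningful for
  malformed strings.\<close>

lemma read_nat_bound:
  assumes "fst u ''N'' 0 = int N"
  shows "0 \<le> fst (den Q read_nat u) ''v'' 0 \<and> fst (den Q read_nat u) ''v'' 0 < 2 ^ N"
proof -
  define u1 where "u1 = den Q (Let1 ''w'' (Num 1)) (den Q (Let1 ''v'' (Num 0)) u)"
  define I where "I k u \<longleftrightarrow> (\<exists>e\<le>k. 0 \<le> fst u ''v'' 0 \<and> fst u ''v'' 0 < 2 ^ e \<and> fst u ''w'' 0 = 2 ^ e)"
    for k and u :: "config"
  have "I N ((den Q (If (Get ''in'' (V ''i'')) read_digit Nop) ^^ N) u1)"
  proof (rule rep_inv)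
    show "I 0 u1" by (simp add: I_def u1_def den_simps upd_apply)
    fix k u assume "I k u"
    then obtain e where e: "e \<le> k" "0 \<le> fst u ''v'' 0" "fst u ''v'' 0 < 2 ^ e" "fst u ''w'' 0 = 2 ^ e"
      by (auto simp: I_def)
    have 1: "0 \<le> fst (den Q read_digit u) ''v'' 0" "fst (den Q read_digit u) ''v'' 0 < 2 ^ Suc e"
      "fst (den Q read_digit u) ''w'' 0 = 2 ^ Suc e"
      using e by (auto simp: read_digit_def den_simps upd_apply)
    show "I (Suc k) (den Q (If (Get ''in'' (V ''i'')) read_digit Nop) u)"
    proof (cases "aval (Get ''in'' (V ''i'')) (fst u) = 0")
      case True
      then show ?thesis using e unfolding I_def den.simps by (intro exI[of _ e]) simp
    next
      case False
      then show ?thesis using 1 e(1) unfolding I_def den.simps by (intro exI[of _ "Suc e"]) simp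
    qed
  qed
  moreover have "den Q read_nat u = den Q (Inc ''i'' 1) ((den Q (If (Get ''in'' (V ''i'')) read_digit Nop) ^^ N) u1)"
    using assms by (simp add: read_nat_def den_simps den.simps(7) u1_def upd_apply)
  ultimately obtain e where e: "e \<le> N" "0 \<le> fst (den Q read_nat u) ''v'' 0" "fst (den Q read_nat u) ''v'' 0 < 2 ^ e"
    by (auto simp: I_def den_simps upd_apply)
  have "(2::int) ^ e \<le> 2 ^ N" using e(1) by (intro power_increasing) auto
  then show ?thesis using e by linarith
qed

definition terms :: "store \<Rightarrow> nat \<Rightarrow> nat \<Rightarrow> (int \<times> nat) list" where
  "terms s a b = map (\<lambda>j. (s ''C'' j, nat (s ''E'' j))) [a..<b]"

text \<open>This is what the writer needs: its digit loops have \<open>N\<close> rounds, and its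
  exponents must be nonnegative.\<close>

definition small :: "nat \<Rightarrow> store \<Rightarrow> bool" where
  "small N s \<longleftrightarrow> (\<forall>j. \<bar>s ''C'' j\<bar> < 2 ^ N \<and> 0 \<le> s ''E'' j \<and> s ''E'' j < 2 ^ N)"

lemma terms_Suc: "a \<le> b \<Longrightarrow> terms s a (Suc b) = terms s a b @ [(s ''C'' b, nat (s ''E'' b))]"
  by (simp add: terms_def)

lemma length_terms [simp]: "length (terms s a b) = b - a"
  by (simp add: terms_def)

lemma terms_append: "a \<le> b \<Longrightarrow> b \<le> c \<Longrightarrow> terms s a c = terms s a b @ terms s b c"
  unfolding terms_def map_append[symmetric] by (metis le_Suc_ex upt_add_eq_append)

lemma terms_cong: "(\<And>j. a \<le> j \<Longrightarrow> j < b \<Longrightarrow> s ''C'' j = s' ''C'' j \<and> s ''E'' j = s' ''E'' j) \<Longrightarrow> terms s a b = terms s' a b"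
  by (auto simp: terms_def)

text \<open>Splits the program into stages, for use both in the exact analysis on well-formed input
  and in the size bound on arbitrary input.\<close>

lemma read_term_effect:
  fixes u :: "config"
  assumes "fst u ''k'' 0 = int K" "fst u ''N'' 0 = int N"
  obtains u1 u2 u3 u4 where
    "u1 = den Q (Inc ''i'' 2) (den Q (Let1 ''s'' (Get ''in'' (Add (V ''i'') (Num 1)))) u)"
    "u2 = den Q read_nat u1"
    "fst u3 = (fst u2)(''C'' := (fst u2 ''C'')(K := if fst u2 ''s'' 0 \<noteq> 0 then - fst u2 ''v'' 0 else fst u2 ''v'' 0))"
    "u4 = den Q read_nat u3"
    "fst (den Q read_term u) = (fst u4)(''E'' := (fst u4 ''E'')(K := fst u4 ''v'' 0), ''k'' := (fst u4 ''k'')(0 := int (Suc K)))"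
    "fst u4 ''N'' 0 = int N" "fst u3 ''N'' 0 = int N" "fst u2 ''N'' 0 = int N" "fst u1 ''N'' 0 = int N"
proof -
  define u1 where "u1 = den Q (Inc ''i'' 2) (den Q (Let1 ''s'' (Get ''in'' (Add (V ''i'') (Num 1)))) u)"
  define u2 where "u2 = den Q read_nat u1"
  define u3 where "u3 = den Q (If (V ''s'') (Asg ''C'' (V ''k'') (Sub (Num 0) (V ''v''))) Nop)
    (den Q (Asg ''C'' (V ''k'') (V ''v'')) u2)"
  define u4 where "u4 = den Q read_nat u3"
  have e: "den Q read_term u = den Q (Inc ''k'' 1) (den Q (Asg ''E'' (V ''k'') (V ''v'')) u4)"
    by (simp only: read_term_def block.simps den.simps(1,5) u1_def u2_def u3_def u4_def)
  have k2: "fst u2 ''k'' 0 = int K"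
    unfolding u2_def u1_def using assms by (simp add: frame mods_prog)
  have k4: "fst u4 ''k'' 0 = int K"
    unfolding u4_def u3_def using k2 by (simp add: frame mods_prog)
  show ?thesis
  proof (rule that[OF u1_def u2_def _ u4_def])
    show "fst u3 = (fst u2)(''C'' := (fst u2 ''C'')(K := if fst u2 ''s'' 0 \<noteq> 0 then - fst u2 ''v'' 0 else fst u2 ''v'' 0))"
      using k2 by (auto simp: u3_def den_simps upd_def fun_eq_iff)
    show "fst (den Q read_term u) = (fst u4)(''E'' := (fst u4 ''E'')(K := fst u4 ''v'' 0), ''k'' := (fst u4 ''k'')(0 := int (Suc K)))"
      using k4 unfolding e by (auto simp: den_simps upd_def fun_eq_iff)
  qed (use assms in \<open>simp_all add: u4_def u3_def u2_def u1_def frame mods_prog\<close>)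
qed

lemma read_term_spec:
  assumes "fst u ''in'' = inp w" "fst u ''i'' 0 = int pos" "fst u ''N'' 0 = int N" "fst u ''k'' 0 = int K"
    and d: "drop pos w = True # enc_int c @ enc_nat n @ rest"
    and N: "length (bits_of (nat \<bar>c\<bar>)) \<le> N" "length (bits_of n) \<le> N"
  shows "terms (fst (den Q read_term u)) 0 (Suc K) = terms (fst u) 0 K @ [(c, n)]"
    "fst (den Q read_term u) ''k'' 0 = int (Suc K)"
    "fst (den Q read_term u) ''i'' 0 = int (pos + length (True # enc_int c @ enc_nat n))"
proof -
  obtain u1 u2 u3 u4 where u:
    "u1 = den Q (Inc ''i'' 2) (den Q (Let1 ''s'' (Get ''in'' (Add (V ''i'') (Num 1)))) u)"
    "u2 = den Q read_nat u1"
    "fst u3 = (fst u2)(''C'' := (fst u2 ''C'')(K := if fst u2 ''s'' 0 \<noteq> 0 then - fst u2 ''v'' 0 else fst u2 ''v'' 0))"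
    "u4 = den Q read_nat u3"
    "fst (den Q read_term u) = (fst u4)(''E'' := (fst u4 ''E'')(K := fst u4 ''v'' 0), ''k'' := (fst u4 ''k'')(0 := int (Suc K)))"
    "fst u3 ''N'' 0 = int N" "fst u1 ''N'' 0 = int N"
    using read_term_effect[OF assms(4,3)] by metis
  have "drop (Suc pos) w = (c < 0) # enc_nat (nat \<bar>c\<bar>) @ enc_nat n @ rest"
    using inp_drop(2)[OF d] by (simp add: enc_int_def)
  from inp_drop[OF this] have s: "inp w (Suc pos) = of_bool (c < 0)"
    and d1: "drop (Suc (Suc pos)) w = enc_nat (nat \<bar>c\<bar>) @ enc_nat n @ rest" by auto
  have 1: "fst u1 ''in'' = inp w" "fst u1 ''i'' 0 = int (Suc (Suc pos))" "fst u1 ''s'' 0 = of_bool (c < 0)"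
    "fst u1 ''C'' = fst u ''C''" "fst u1 ''E'' = fst u ''E''"
    using assms s by (simp_all add: u(1) den_simps upd_apply)
  define pos2 where "pos2 = Suc (Suc pos) + length (enc_nat (nat \<bar>c\<bar>))"
  have 2: "fst u2 ''v'' 0 = \<bar>c\<bar>" "fst u2 ''i'' 0 = int pos2"
    using read_nat_spec[OF 1(1,2) u(7) d1 N(1), of Q] by (simp_all add: u(2) pos2_def)
  have f2: "fst u2 ''in'' = inp w" "fst u2 ''s'' 0 = of_bool (c < 0)" "fst u2 ''C'' = fst u ''C''" "fst u2 ''E'' = fst u ''E''"
    using 1 by (simp_all add: u(2) frame mods_prog)
  have 3: "fst u3 ''in'' = inp w" "fst u3 ''i'' 0 = int pos2" "fst u3 ''C'' = (fst u ''C'')(K := c)" "fst u3 ''E'' = fst u ''E''"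
    using 2 f2 by (auto simp: u(3) fun_eq_iff)
  have d2: "drop pos2 w = enc_nat n @ rest" unfolding pos2_def by (rule drop_append[OF d1])
  have 4: "fst u4 ''v'' 0 = int n" "fst u4 ''i'' 0 = int (pos2 + length (enc_nat n))"
    using read_nat_spec[OF 3(1,2) u(6) d2 N(2), of Q] by (simp_all add: u(4))
  have f4: "fst u4 ''C'' = (fst u ''C'')(K := c)" "fst u4 ''E'' = fst u ''E''"
    using 3 by (simp_all add: u(4) frame mods_prog)
  show "fst (den Q read_term u) ''k'' 0 = int (Suc K)" by (simp add: u(5))
  show "fst (den Q read_term u) ''i'' 0 = int (pos + length (True # enc_int c @ enc_nat n))"
    using 4(2) by (simp add: u(5) pos2_def enc_int_def)
  have "terms (fst (den Q read_term u)) 0 K = terms (fst u) 0 K"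
    by (rule terms_cong) (simp add: u(5) f4)
  then show "terms (fst (den Q read_term u)) 0 (Suc K) = terms (fst u) 0 K @ [(c, n)]"
    by (simp add: terms_Suc) (simp add: u(5) f4 4)
qed

lemma read_term_small:
  assumes "fst u ''k'' 0 = int K" "fst u ''N'' 0 = int N" "small N (fst u)"
  shows "small N (fst (den Q read_term u))" "fst (den Q read_term u) ''k'' 0 = int (Suc K)"
proof -
  obtain u1 u2 u3 u4 where u:
    "u1 = den Q (Inc ''i'' 2) (den Q (Let1 ''s'' (Get ''in'' (Add (V ''i'') (Num 1)))) u)"
    "u2 = den Q read_nat u1"
    "fst u3 = (fst u2)(''C'' := (fst u2 ''C'')(K := if fst u2 ''s'' 0 \<noteq> 0 then - fst u2 ''v'' 0 else fst u2 ''v'' 0))"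
    "u4 = den Q read_nat u3"
    "fst (den Q read_term u) = (fst u4)(''E'' := (fst u4 ''E'')(K := fst u4 ''v'' 0), ''k'' := (fst u4 ''k'')(0 := int (Suc K)))"
    "fst u3 ''N'' 0 = int N" "fst u1 ''N'' 0 = int N"
    using read_term_effect[OF assms(1,2)] by metis
  show "fst (den Q read_term u) ''k'' 0 = int (Suc K)" by (simp add: u(5))
  have "0 \<le> fst u2 ''v'' 0 \<and> fst u2 ''v'' 0 < 2 ^ N" "0 \<le> fst u4 ''v'' 0 \<and> fst u4 ''v'' 0 < 2 ^ N"
    unfolding u(2,4) by (intro read_nat_bound u)+
  moreover have "fst u2 ''C'' = fst u ''C''" "fst u4 ''E'' = fst u ''E''" "fst u4 ''C'' = fst u3 ''C''"
    using u(3) by (simp_all add: u(1,2,4) frame mods_prog)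
  ultimately show "small N (fst (den Q read_term u))"
    using assms(3) by (auto simp: small_def u(3,5))
qed

lemma read_poly_spec:
  assumes "fst u ''in'' = inp w" "fst u ''i'' 0 = int pos" "fst u ''N'' 0 = int N" "fst u ''k'' 0 = int K"
    and d: "drop pos w = enc_poly ts @ rest" and N: "length (enc_poly ts) \<le> N"
  shows "terms (fst (den Q read_poly u)) 0 (K + length ts) = terms (fst u) 0 K @ ts"
    "fst (den Q read_poly u) ''k'' 0 = int (K + length ts)"
    "fst (den Q read_poly u) ''i'' 0 = int (pos + length (enc_poly ts))"
proof -
  define tpos where "tpos k = pos + length (concat (map (\<lambda>(c, n). True # enc_int c @ enc_nat n) (take k ts)))" for k
  have drop_tpos: "drop (tpos k) w = enc_poly (drop k ts) @ rest" for k
  proof -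
    have "enc_poly (xs @ ys) = concat (map (\<lambda>(c, n). True # enc_int c @ enc_nat n) xs) @ enc_poly ys" for xs ys
      by (induction xs) auto
    from this[of "take k ts" "drop k ts"] show ?thesis
      unfolding tpos_def using d by (intro drop_append) simp
  qed
  have tpos_Suc: "tpos (Suc k) = tpos k + length (True # enc_int (fst (ts ! k)) @ enc_nat (snd (ts ! k)))" if "k < length ts" for k
    using that by (simp add: tpos_def take_Suc_conv_app_nth case_prod_beta)
  have enc_tpos: "drop (tpos k) w = True # enc_int (fst (ts ! k)) @ enc_nat (snd (ts ! k)) @ (enc_poly (drop (Suc k) ts) @ rest)"
    if "k < length ts" for k
    using drop_tpos[of k] that by (cases "ts ! k") (simp add: Cons_nth_drop_Suc[symmetric])
  have bits: "length (bits_of (nat \<bar>fst (ts ! k)\<bar>)) \<le> N" "length (bits_of (snd (ts ! k))) \<le> N" if "k < length ts" for k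
    using length_enc_sparse_int(1)[of "fst (ts ! k)" "snd (ts ! k)" ts] that N by auto
  define I where "I k s \<longleftrightarrow> s ''in'' = inp w \<and> s ''N'' 0 = int N \<and> s ''i'' 0 = int (tpos k) \<and>
     s ''k'' 0 = int (K + k) \<and> terms s 0 (K + k) = terms (fst u) 0 K @ take k ts" for k and s :: store
  have "I (length ts) (fst ((den Q (If (Get ''in'' (V ''i'')) read_term Nop) ^^ N) u))"
  proof (rule rep_for[where K = 0])
    show "I 0 (fst u)" using assms by (simp add: I_def tpos_def)
    show "length ts - 0 \<le> N" using N length_enc_sparse_int(2)[of ts] by simp
    fix k assume k: "k < length ts"
    fix u :: "config" assume I: "I k (fst u)"
    note spec = read_term_spec[where N = N and K = "K + k", OF _ _ _ _ enc_tpos[OF k] bits[OF k], of u Q]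
    show "I (Suc k) (fst (den Q read_term u))"
      using I spec k by (simp add: I_def frame mods_prog tpos_Suc take_Suc_conv_app_nth)
  next
    fix k s assume k: "k \<le> length ts" "I k s"
    have "inp w (tpos k) = of_bool (k < length ts)"
    proof (cases "k = length ts")
      case True
      then show ?thesis using drop_tpos[of k] inp_drop(1)[of "tpos k" w False rest] by simp
    next
      case False
      then show ?thesis using enc_tpos[of k] inp_drop(1)[of "tpos k" w True] k by simp
    qed
    then show "(aval (Get ''in'' (V ''i'')) s \<noteq> 0) = (k < length ts)"
      using k by (auto simp: I_def)
  qed simp
  moreover have "den Q read_poly u = den Q (Inc ''i'' 1) ((den Q (If (Get ''in'' (V ''i'')) read_term Nop) ^^ N) u)"
    using assms(3) by (simp add: read_poly_def den_simps den.simps(7))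
  moreover have "tpos (length ts) + 1 = pos + length (enc_poly ts)"
    by (simp add: tpos_def enc_sparse_def enc_list_def case_prod_unfold)
  ultimately show "terms (fst (den Q read_poly u)) 0 (K + length ts) = terms (fst u) 0 K @ ts"
    "fst (den Q read_poly u) ''k'' 0 = int (K + length ts)"
    "fst (den Q read_poly u) ''i'' 0 = int (pos + length (enc_poly ts))"
    by (simp_all add: I_def den_simps upd_apply terms_def)
qed

lemma read_poly_small:
  assumes "fst u ''k'' 0 = int K" "fst u ''N'' 0 = int N" "small N (fst u)"
  shows "small N (fst (den Q read_poly u)) \<and>
    (\<exists>K'. K \<le> K' \<and> K' \<le> K + N \<and> fst (den Q read_poly u) ''k'' 0 = int K')"
proof -
  define I where "I k u \<longleftrightarrow> fst u ''N'' 0 = int N \<and> small N (fst u) \<and>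
     (\<exists>K'. K \<le> K' \<and> K' \<le> K + k \<and> fst u ''k'' 0 = int K')" for k and u :: "config"
  have "I N ((den Q (If (Get ''in'' (V ''i'')) read_term Nop) ^^ N) u)"
  proof (rule rep_inv)
    show "I 0 u" using assms by (simp add: I_def)
    fix k u assume "I k u"
    then obtain K' where K': "fst u ''N'' 0 = int N" "small N (fst u)" "K \<le> K'" "K' \<le> K + k" "fst u ''k'' 0 = int K'"
      by (auto simp: I_def)
    show "I (Suc k) (den Q (If (Get ''in'' (V ''i'')) read_term Nop) u)"
    proof (cases "aval (Get ''in'' (V ''i'')) (fst u) = 0")
      case True
      then show ?thesis using K' unfolding I_def den.simps by (intro conjI exI[of _ K']) simp_all
    next
      case False
      then show ?thesis using K' read_term_small[OF K'(5,1,2), of Q] unfolding I_def den.simps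
        by (intro conjI exI[of _ "Suc K'"]) (simp_all add: frame mods_prog)
    qed
  qed
  moreover have "den Q read_poly u = den Q (Inc ''i'' 1) ((den Q (If (Get ''in'' (V ''i'')) read_term Nop) ^^ N) u)"
    using assms(2) by (simp add: read_poly_def den_simps den.simps(7))
  ultimately show ?thesis by (simp add: I_def den_simps upd_apply small_def)
qed

lemma parse_spec:
  assumes "fst u ''in'' = inp w" "fst u ''i'' 0 = 0" "fst u ''N'' 0 = int N" "fst u ''k'' 0 = 0"
    and w: "w = enc_poly g @ enc_poly f" and N: "length w \<le> N"
  shows "terms (fst (den Q parse u)) 0 (length g) = g"
    "terms (fst (den Q parse u)) (length g) (length g + length f) = f"
    "fst (den Q parse u) ''n'' 0 = int (length g)" "fst (den Q parse u) ''m'' 0 = int (length g + length f)"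
proof -
  define u1 where "u1 = den Q read_poly u"
  define u2 where "u2 = den Q (Let1 ''n'' (V ''k'')) u1"
  define u3 where "u3 = den Q read_poly u2"
  have e: "den Q parse u = den Q (Let1 ''m'' (V ''k'')) u3"
    by (simp only: parse_def block.simps den.simps(1,5) u1_def u2_def u3_def)
  have 1: "terms (fst u1) 0 (length g) = g" "fst u1 ''k'' 0 = int (length g)"
     "fst u1 ''i'' 0 = int (length (enc_poly g))"
    using read_poly_spec[where pos = 0 and K = 0 and N = N and ts = g and rest = "enc_poly f", of u w Q] assms
    by (simp_all add: u1_def terms_def)
  have 2: "fst u2 ''in'' = inp w" "fst u2 ''N'' 0 = int N" "fst u2 ''k'' 0 = int (length g)"
     "fst u2 ''i'' 0 = int (length (enc_poly g))" "terms (fst u2) 0 (length g) = g"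
     "fst u2 ''n'' 0 = int (length g)"
    using 1 assms(1,3) by (simp_all add: u2_def den_simps upd_apply terms_def) (simp_all add: u1_def frame mods_prog)
  have 3: "terms (fst u3) 0 (length g + length f) = g @ f" "fst u3 ''k'' 0 = int (length g + length f)"
    using read_poly_spec[OF 2(1,4,2,3), of f "[]" Q] w N 2(5) by (simp_all add: u3_def)
  have "terms (fst u3) 0 (length g) @ terms (fst u3) (length g) (length g + length f) = g @ f"
    using 3(1) terms_append[of 0 "length g" "length g + length f" "fst u3"] by simp
  then have "terms (fst u3) 0 (length g) = g" "terms (fst u3) (length g) (length g + length f) = f"
    using append_eq_append_conv[of "terms (fst u3) 0 (length g)" g] by simp_all
  moreover have "fst u3 ''n'' 0 = int (length g)" using 2(6) by (simp add: u3_def frame mods_prog)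
  ultimately show "terms (fst (den Q parse u)) 0 (length g) = g"
    "terms (fst (den Q parse u)) (length g) (length g + length f) = f"
    "fst (den Q parse u) ''n'' 0 = int (length g)" "fst (den Q parse u) ''m'' 0 = int (length g + length f)"
    using 3(2) by (simp_all add: e den_simps upd_apply terms_def)
qed

lemma parse_small:
  assumes "fst u ''N'' 0 = int N" "fst u ''k'' 0 = 0" "small N (fst u)"
  shows "small N (fst (den Q parse u)) \<and> (\<exists>n m. fst (den Q parse u) ''n'' 0 = int n \<and>
    fst (den Q parse u) ''m'' 0 = int m \<and> n \<le> N \<and> n \<le> m \<and> m \<le> n + N)"
proof -
  define u1 where "u1 = den Q read_poly u"
  define u2 where "u2 = den Q (Let1 ''n'' (V ''k'')) u1"
  define u3 where "u3 = den Q read_poly u2"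
  have e: "den Q parse u = den Q (Let1 ''m'' (V ''k'')) u3"
    by (simp only: parse_def block.simps den.simps(1,5) u1_def u2_def u3_def)
  obtain n where 1: "small N (fst u1)" "n \<le> N" "fst u1 ''k'' 0 = int n"
    using read_poly_small[of u 0 N Q] assms unfolding u1_def by auto
  have 2: "small N (fst u2)" "fst u2 ''k'' 0 = int n" "fst u2 ''n'' 0 = int n" "fst u2 ''N'' 0 = int N"
    using 1 assms(1) by (simp_all add: u2_def den_simps upd_apply small_def) (simp_all add: u1_def frame mods_prog)
  obtain m where 3: "small N (fst u3)" "n \<le> m" "m \<le> n + N" "fst u3 ''k'' 0 = int m"
    using read_poly_small[OF 2(2,4,1), of Q] unfolding u3_def by auto
  have "fst u3 ''n'' 0 = int n" using 2(3) by (simp add: u3_def frame mods_prog)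
  then show ?thesis using 1(2) 3 by (intro conjI exI[of _ n] exI[of _ m]) (simp_all add: e den_simps upd_apply small_def)
qed

subsection \<open>Writing a query\<close>

text \<open>Only the first \<open>l\<close> entries of the buffer count; leftovers of earlier
  queries may follow them.\<close>

definition outs :: "store \<Rightarrow> bool list \<Rightarrow> bool" where
  "outs s S \<longleftrightarrow> s ''l'' 0 = int (length S) \<and> (\<forall>i<length S. s ''y'' i = of_bool (S ! i))"

lemma outs_cong: "s ''l'' = s' ''l'' \<Longrightarrow> s ''y'' = s' ''y'' \<Longrightarrow> outs s S = outs s' S"
  by (simp add: outs_def)

lemma emit_bit_spec:
  assumes "outs (fst u) S" "aval a (fst u) = of_bool b"
  shows "outs (fst (den Q (emit_bit a) u)) (S @ [b])"
  using assms by (auto simp: emit_bit_def den_simps upd_apply outs_def nth_append less_Suc_eq)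

lemma emit_digit_spec:
  assumes "outs (fst u) S" "fst u ''v'' 0 = int n"
  shows "outs (fst (den Q emit_digit u)) (S @ [True, odd n])" "fst (den Q emit_digit u) ''v'' 0 = int (n div 2)"
proof -
  define u1 where "u1 = den Q (emit_bit (Num 1)) u"
  define u2 where "u2 = den Q (emit_bit (Rem2 (V ''v''))) u1"
  have e: "den Q emit_digit u = den Q (Let1 ''v'' (Div (V ''v'') (Num 2))) u2"
    by (simp only: emit_digit_def block.simps den.simps(1,5) u1_def u2_def)
  have 1: "outs (fst u1) (S @ [True])" "fst u1 ''v'' 0 = int n"
    unfolding u1_def using emit_bit_spec[OF assms(1), of "Num 1" True Q] assms(2) by (simp_all add: frame mods_prog)
  have "int n - int n div 2 * 2 = of_bool (odd n)"
    using odd_iff_mod_2_eq_one[of "int n"] by (simp add: minus_div_mult_eq_mod mod_2_eq_odd)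
  then have 2: "outs (fst u2) (S @ [True] @ [odd n])" "fst u2 ''v'' 0 = int n"
    unfolding u2_def using emit_bit_spec[OF 1(1), of "Rem2 (V ''v'')" "odd n" Q] 1(2) by (simp_all add: frame mods_prog)
  show "outs (fst (den Q emit_digit u)) (S @ [True, odd n])" "fst (den Q emit_digit u) ''v'' 0 = int (n div 2)"
    using 2 by (simp_all add: e den_simps upd_apply outs_def zdiv_int)
qed

lemma bits_of_div_power: "bits_of (n div 2 ^ k) = drop k (bits_of n)"
proof (induction k)
  case (Suc k)
  have "n div 2 ^ Suc k = n div 2 ^ k div 2" by (metis div_mult2_eq power_Suc2)
  moreover have "bits_of (m div 2) = tl (bits_of m)" for m
    by (cases "m = 0") (simp_all add: bits_of_pos)
  ultimately show ?case using Suc by (simp add: drop_Suc tl_drop)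
qed simp

lemma digits_append: "digits (xs @ ys) = digits xs @ digits ys"
  by (simp add: digits_def)

lemma emit_nat_spec:
  assumes "outs (fst u) S" "fst u ''v'' 0 = int n" "fst u ''N'' 0 = int N" "n < 2 ^ N"
  shows "outs (fst (den Q emit_nat u)) (S @ enc_nat n)"
proof -
  define bs where "bs = bits_of n"
  have pos: "n div 2 ^ k > 0 \<longleftrightarrow> k < length bs" for k
  proof -
    have "n div 2 ^ k > 0 \<longleftrightarrow> bits_of (n div 2 ^ k) \<noteq> []"
      using bits_of_pos[of "n div 2 ^ k"] by (cases "n div 2 ^ k = 0") simp_all
    then show ?thesis by (simp only: bits_of_div_power bs_def drop_eq_Nil not_le)
  qed
  have nth: "odd (n div 2 ^ k) = bs ! k" if "k < length bs" for k
    using bits_of_div_power[of n k] bits_of_pos[of "n div 2 ^ k"] pos[of k] that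
    by (simp add: bs_def Cons_nth_drop_Suc[symmetric])
  define I where "I k s \<longleftrightarrow> s ''v'' 0 = int (n div 2 ^ k) \<and> outs s (S @ digits (take k bs))" for k and s :: store
  have "I (length bs) (fst ((den Q (If (V ''v'') emit_digit Nop) ^^ N) u))"
  proof (rule rep_for[where K = 0])
    show "I 0 (fst u)" using assms by (simp add: I_def)
    show "length bs - 0 \<le> N" using length_bits_of_le[OF assms(4)] by (simp add: bs_def)
    fix k assume k: "k < length bs"
    fix u :: "config" assume I: "I k (fst u)"
    have "n div 2 ^ k div 2 = n div 2 ^ Suc k" by (metis div_mult2_eq power_Suc2)
    then show "I (Suc k) (fst (den Q emit_digit u))"
      using emit_digit_spec[of u "S @ digits (take k bs)" "n div 2 ^ k" Q] I nth[OF k] k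
      by (simp add: I_def take_Suc_conv_app_nth digits_append)
  next
    fix k s assume "I k s"
    then have "s ''v'' 0 = int (n div 2 ^ k)" by (simp add: I_def)
    then show "(aval (V ''v'') s \<noteq> 0) = (k < length bs)" using pos[of k] by (simp del: div_greater_zero_iff)
  qed simp
  moreover have "den Q emit_nat u = den Q (emit_bit (Num 0)) ((den Q (If (V ''v'') emit_digit Nop) ^^ N) u)"
    using assms(3) by (simp add: emit_nat_def den_simps den.simps(7))
  ultimately show ?thesis
    using emit_bit_spec[of "(den Q (If (V ''v'') emit_digit Nop) ^^ N) u" "S @ digits bs" "Num 0" False Q]
    by (simp add: I_def enc_nat_digits bs_def)
qed

lemma emit_term_spec:
  assumes "outs (fst u) S" "fst u ''k'' 0 = int K" "fst u ''p'' 0 = int P" "fst u ''N'' 0 = int N"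
    and c: "c = fst u ''C'' K mod int P" "\<bar>c\<bar> < 2 ^ N" and e: "fst u ''E'' K = int e" "e < 2 ^ N"
  shows "outs (fst (den Q emit_term u)) (S @ True # enc_int c @ enc_nat e)"
    "fst (den Q emit_term u) ''k'' 0 = int (Suc K)"
proof -
  define u1 where "u1 = den Q (emit_bit (Num 1)) u"
  define u2 where "u2 = den Q (Let1 ''c'' (Rem (Get ''C'' (V ''k'')) (V ''p''))) u1"
  define u3 where "u3 = den Q (emit_bit (Less (V ''c'') (Num 0))) u2"
  define u4 where "u4 = den Q (If (Less (V ''c'') (Num 0)) (Let1 ''v'' (Sub (Num 0) (V ''c''))) Nop)
    (den Q (Let1 ''v'' (V ''c'')) u3)"
  define u5 where "u5 = den Q emit_nat u4"
  define u6 where "u6 = den Q (Let1 ''v'' (Get ''E'' (V ''k''))) u5"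
  define u7 where "u7 = den Q emit_nat u6"
  have eq: "den Q emit_term u = den Q (Inc ''k'' 1) u7"
    by (simp only: emit_term_def block.simps den.simps(1,5) u1_def u2_def u3_def u4_def u5_def u6_def u7_def)
  note fr = frame mods_prog
  have 1: "outs (fst u1) (S @ [True])" "fst u1 ''k'' 0 = int K" "fst u1 ''p'' 0 = int P" "fst u1 ''N'' 0 = int N"
    "fst u1 ''C'' = fst u ''C''" "fst u1 ''E'' = fst u ''E''"
    unfolding u1_def using emit_bit_spec[OF assms(1), of "Num 1" True Q] assms by (simp_all add: fr)
  have 2: "outs (fst u2) (S @ [True])" "fst u2 ''k'' 0 = int K" "fst u2 ''N'' 0 = int N" "fst u2 ''c'' 0 = c"
    "fst u2 ''E'' = fst u ''E''"
    using 1 unfolding c(1) by (simp_all add: u2_def den_simps upd_apply minus_div_mult_eq_mod outs_def)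
  have 3: "outs (fst u3) (S @ [True] @ [c < 0])" "fst u3 ''k'' 0 = int K" "fst u3 ''N'' 0 = int N" "fst u3 ''c'' 0 = c"
    "fst u3 ''E'' = fst u ''E''"
    unfolding u3_def using emit_bit_spec[OF 2(1), of "Less (V ''c'') (Num 0)" "c < 0" Q] 2 by (simp_all add: fr)
  have 4: "outs (fst u4) (S @ [True] @ [c < 0])" "fst u4 ''k'' 0 = int K" "fst u4 ''N'' 0 = int N" "fst u4 ''v'' 0 = int (nat \<bar>c\<bar>)"
    "fst u4 ''E'' = fst u ''E''"
    using 3 by (auto simp: u4_def den_simps upd_apply outs_def)
  have c2: "nat \<bar>c\<bar> < 2 ^ N" using c(2) by (simp add: nat_less_iff)
  have 5: "outs (fst u5) ((S @ [True] @ [c < 0]) @ enc_nat (nat \<bar>c\<bar>))" "fst u5 ''k'' 0 = int K" "fst u5 ''N'' 0 = int N"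
    "fst u5 ''E'' = fst u ''E''"
    unfolding u5_def using emit_nat_spec[OF 4(1,4,3) c2, of Q] 4 by (simp_all add: fr)
  have 6: "outs (fst u6) ((S @ [True] @ [c < 0]) @ enc_nat (nat \<bar>c\<bar>))" "fst u6 ''k'' 0 = int K" "fst u6 ''N'' 0 = int N"
    "fst u6 ''v'' 0 = int e"
    using 5 e(1) by (simp_all add: u6_def den_simps upd_apply outs_def)
  have 7: "outs (fst u7) (((S @ [True] @ [c < 0]) @ enc_nat (nat \<bar>c\<bar>)) @ enc_nat e)" "fst u7 ''k'' 0 = int K"
    unfolding u7_def using emit_nat_spec[OF 6(1,4,3) e(2), of Q] 6 by (simp_all add: fr)
  show "fst (den Q emit_term u) ''k'' 0 = int (Suc K)" using 7 by (simp add: eq den_simps upd_apply)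
  have "outs (fst (den Q emit_term u)) (((S @ [True] @ [c < 0]) @ enc_nat (nat \<bar>c\<bar>)) @ enc_nat e)"
    using 7(1) unfolding eq by (subst outs_cong[of _ "fst u7"]) (simp_all add: den_simps upd_apply)
  then show "outs (fst (den Q emit_term u)) (S @ True # enc_int c @ enc_nat e)"
    by (simp add: enc_int_def)
qed

lemma small_mod:
  assumes "\<bar>c\<bar> < 2 ^ N" "P < 2 ^ N"
  shows "\<bar>c mod int P\<bar> < 2 ^ N"
proof (cases "P = 0")
  case False
  then have "0 \<le> c mod int P" "c mod int P < int P" by simp_all
  moreover have "int P < 2 ^ N" using assms(2) of_nat_less_iff[of P "2 ^ N", where ?'a = int] by simp
  ultimately show ?thesis by linarith
qed (use assms in simp)

lemma emit_poly_spec: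
  assumes "outs (fst u) S" "fst u ''k'' 0 = int K" "fst u ''h'' 0 = int H" "fst u ''p'' 0 = int P" "fst u ''N'' 0 = int N"
    and KH: "K \<le> H" "H - K \<le> N" and small: "small N (fst u)" and P: "P < 2 ^ N"
  shows "outs (fst (den Q emit_poly u)) (S @ enc_poly (reduce P (terms (fst u) K H)))"
    "fst (den Q emit_poly u) ''k'' 0 = int H"
proof -
  define enc where "enc k = concat (map (\<lambda>(c, n). True # enc_int c @ enc_nat n) (reduce P (terms (fst u) K k)))" for k
  have enc_Suc: "enc (Suc k) = enc k @ True # enc_int (fst u ''C'' k mod int P) @ enc_nat (nat (fst u ''E'' k))"
    if "K \<le> k" for k
    using that by (simp add: enc_def terms_Suc reduce_def)
  define I where "I k s \<longleftrightarrow> outs s (S @ enc k) \<and> s ''k'' 0 = int k \<and> s ''h'' 0 = int H \<and> s ''p'' 0 = int P \<and>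
     s ''N'' 0 = int N \<and> s ''C'' = fst u ''C'' \<and> s ''E'' = fst u ''E''" for k and s :: store
  have "I H (fst ((den Q (If (Less (V ''k'') (V ''h'')) emit_term Nop) ^^ N) u))"
  proof (rule rep_for[where K = K])
    show "I K (fst u)" using assms by (simp add: I_def enc_def terms_def reduce_def)
    fix k assume k: "K \<le> k" "k < H"
    fix u' :: "config" assume I: "I k (fst u')"
    have C: "\<bar>fst u ''C'' k mod int P\<bar> < 2 ^ N" by (rule small_mod[OF _ P]) (use small in \<open>simp add: small_def\<close>)
    have E: "0 \<le> fst u ''E'' k" "fst u ''E'' k < 2 ^ N" using small by (simp_all add: small_def)
    then have E': "nat (fst u ''E'' k) < 2 ^ N" by (simp add: nat_less_iff)
    have "outs (fst (den Q emit_term u')) ((S @ enc k) @ True # enc_int (fst u ''C'' k mod int P) @ enc_nat (nat (fst u ''E'' k)))"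
      "fst (den Q emit_term u') ''k'' 0 = int (Suc k)"
      using emit_term_spec[of u' "S @ enc k" k P N "fst u ''C'' k mod int P" "nat (fst u ''E'' k)" Q] I C E E'
      by (simp_all add: I_def)
    then show "I (Suc k) (fst (den Q emit_term u'))"
      using I k by (simp add: I_def frame mods_prog enc_Suc)
  next
    fix k s assume "k \<le> H" "I k s"
    then show "(aval (Less (V ''k'') (V ''h'')) s \<noteq> 0) = (k < H)" by (auto simp: I_def)
  qed (use KH in simp_all)
  moreover have "den Q emit_poly u = den Q (emit_bit (Num 0)) ((den Q (If (Less (V ''k'') (V ''h'')) emit_term Nop) ^^ N) u)"
    using assms(5) by (simp add: emit_poly_def den_simps den.simps(7))
  moreover have "enc_poly (reduce P (terms (fst u) K H)) = enc H @ [False]"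
    by (simp add: enc_def enc_sparse_def enc_list_def case_prod_unfold)
  ultimately show "outs (fst (den Q emit_poly u)) (S @ enc_poly (reduce P (terms (fst u) K H)))"
    "fst (den Q emit_poly u) ''k'' 0 = int H"
    using emit_bit_spec[of "(den Q (If (Less (V ''k'') (V ''h'')) emit_term Nop) ^^ N) u" "S @ enc H" "Num 0" False Q]
    by (simp_all add: I_def frame mods_prog)
qed

text \<open>Used twice: with \<open>P = 0\<close> to reproduce the parsed input, and with a random
  \<open>P\<close> to form a query.\<close>

lemma emit_spec:
  assumes "fst u ''p'' 0 = int P" "fst u ''N'' 0 = int N" "fst u ''n'' 0 = int n" "fst u ''m'' 0 = int m"
    and nm: "n \<le> N" "n \<le> m" "m \<le> n + N" and small: "small N (fst u)" and P: "P < 2 ^ N"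
  shows "outs (fst (den Q emit u)) (question P (terms (fst u) 0 n) (terms (fst u) n m))"
proof -
  note fr = frame mods_prog
  define u1 where "u1 = den Q (Let1 ''v'' (V ''p'')) (den Q (emit_bit (Num 0)) (den Q (Let1 ''l'' (Num 0)) u))"
  define u2 where "u2 = den Q emit_nat u1"
  define u3 where "u3 = den Q (Let1 ''h'' (V ''n'')) (den Q (Let1 ''k'' (Num 0)) u2)"
  define u4 where "u4 = den Q emit_poly u3"
  define u5 where "u5 = den Q (Let1 ''h'' (V ''m'')) u4"
  have eq: "den Q emit u = den Q emit_poly u5"
    by (simp only: emit_def block.simps den.simps(1,5) u1_def u2_def u3_def u4_def u5_def)
  have 1: "outs (fst u1) [False]" "fst u1 ''v'' 0 = int P" "fst u1 ''N'' 0 = int N"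
    using assms by (simp_all add: u1_def den_simps upd_apply outs_def emit_bit_def)
  have 2: "outs (fst u2) ([False] @ enc_nat P)"
    unfolding u2_def by (rule emit_nat_spec[OF 1 P])
  have f2: "fst u2 x = fst u x" if "x \<in> {''p'', ''N'', ''n'', ''m'', ''C'', ''E''}" for x
    using that by (auto simp: u2_def u1_def fr)
  have 3: "outs (fst u3) ([False] @ enc_nat P)" "fst u3 ''k'' 0 = int 0" "fst u3 ''h'' 0 = int n"
    "fst u3 ''p'' 0 = int P" "fst u3 ''N'' 0 = int N"
    using 2 assms by (simp_all add: u3_def den_simps upd_apply outs_def f2)
  have f3: "fst u3 x = fst u x" if "x \<in> {''p'', ''N'', ''n'', ''m'', ''C'', ''E''}" for x
    using that by (auto simp: u3_def den_simps upd_apply f2)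
  have s3: "small N (fst u3)" using small by (simp add: small_def f3)
  have t3: "terms (fst u3) a b = terms (fst u) a b" for a b by (simp add: terms_def f3)
  have 4: "outs (fst u4) (([False] @ enc_nat P) @ enc_poly (reduce P (terms (fst u) 0 n)))"
     "fst u4 ''k'' 0 = int n"
    using emit_poly_spec[OF 3, of Q] nm s3 P unfolding u4_def t3 by simp_all
  have f5: "fst u5 x = fst u x" if "x \<in> {''p'', ''N'', ''n'', ''m'', ''C'', ''E''}" for x
    using that by (auto simp: u5_def u4_def den_simps upd_apply f3 fr)
  have 5: "outs (fst u5) (([False] @ enc_nat P) @ enc_poly (reduce P (terms (fst u) 0 n)))"
    "fst u5 ''k'' 0 = int n" "fst u5 ''h'' 0 = int m"
    using 4 assms(4) f3[of "''m''"] by (simp_all add: u5_def den_simps upd_apply outs_def) (simp_all add: u4_def fr)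
  have s5: "small N (fst u5)" using small by (simp add: small_def f5)
  have t5: "terms (fst u5) a b = terms (fst u) a b" for a b by (simp add: terms_def f5)
  have "outs (fst (den Q emit u)) ((([False] @ enc_nat P) @ enc_poly (reduce P (terms (fst u) 0 n))) @
     enc_poly (reduce P (terms (fst u) n m)))"
    using emit_poly_spec(1)[OF 5, of P N Q] nm s5 P assms f5 unfolding eq t5 by simp
  then show ?thesis by (simp add: question_def)
qed

text \<open>\<open>x\<close> starts as the difference of the lengths and is afterwards only ever set
  to 1, so a discrepancy once found persists.\<close>

lemma compare_spec:
  assumes "outs (fst u) (False # False # T)" "fst u ''in'' = inp w" "fst u ''len'' 0 = int (length w)"
    "fst u ''N'' 0 = int N" "length w \<le> N"
  shows "fst (den Q compare u) ''x'' 0 = 0 \<longleftrightarrow> w = T"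
proof -
  define u1 where "u1 = den Q (Let1 ''j'' (Num 0)) (den Q (Let1 ''x'' (Sub (V ''l'') (Add (V ''len'') (Num 2)))) u)"
  let ?b = "block [If (Sub (Get ''in'' (V ''j'')) (Get ''y'' (Add (V ''j'') (Num 2)))) (Let1 ''x'' (Num 1)) Nop,
           Inc ''j'' 1]"
  define I where "I k s \<longleftrightarrow> s ''j'' 0 = int k \<and> s ''in'' = inp w \<and> s ''len'' 0 = int (length w) \<and> s ''y'' = fst u ''y'' \<and>
     (s ''x'' 0 = 0 \<longleftrightarrow> length w = length T \<and> (\<forall>i<k. inp w i = fst u ''y'' (Suc (Suc i))))" for k and s :: store
  have "I (length w) (fst ((den Q (If (Less (V ''j'') (V ''len'')) ?b Nop) ^^ N) u1))"
  proof (rule rep_for[where K = 0])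
    show "I 0 (fst u1)" using assms by (auto simp: I_def u1_def den_simps upd_apply outs_def)
    fix k and u' :: "config" assume "I k (fst u')"
    then show "I (Suc k) (fst (den Q ?b u'))"
      by (auto simp: I_def den_simps upd_apply less_Suc_eq)
  next
    fix k s assume "I k s"
    then show "(aval (Less (V ''j'') (V ''len'')) s \<noteq> 0) = (k < length w)" by (simp add: I_def)
  qed (use assms in simp_all)
  moreover have "den Q compare u = (den Q (If (Less (V ''j'') (V ''len'')) ?b Nop) ^^ N) u1"
    using assms(4) by (simp add: compare_def den.simps(1-5,7) u1_def upd_apply)
  ultimately have "fst (den Q compare u) ''x'' 0 = 0 \<longleftrightarrow>
     length w = length T \<and> (\<forall>i<length w. inp w i = fst u ''y'' (Suc (Suc i)))"
    by (simp add: I_def)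
  also have "\<dots> \<longleftrightarrow> w = T"
    using assms(1) by (auto simp: outs_def list_eq_iff_nth_eq inp_def  dest: spec[of _ "Suc (Suc _)"])
  finally show ?thesis .
qed

subsection \<open>Validity and contents\<close>

lemma check_exponent_inner:
  assumes "fst u ''j'' 0 = 0" "fst u ''k'' 0 = int k" "fst u ''n'' 0 = int n" "k \<le> N"
  shows "fst ((den Q (If (Less (V ''j'') (V ''k'')) check_exponent Nop) ^^ N) u) ''x'' 0 = 0 \<longleftrightarrow>
    fst u ''x'' 0 = 0 \<and> (\<forall>j<k. (j < n \<longleftrightarrow> k < n) \<longrightarrow> fst u ''E'' j \<noteq> fst u ''E'' k)"
proof -
  define I where "I j s \<longleftrightarrow> s ''j'' 0 = int j \<and> s ''k'' 0 = int k \<and> s ''n'' 0 = int n \<and> s ''E'' = fst u ''E'' \<and>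
     (s ''x'' 0 = 0 \<longleftrightarrow> fst u ''x'' 0 = 0 \<and> (\<forall>i<j. (i < n \<longleftrightarrow> k < n) \<longrightarrow> fst u ''E'' i \<noteq> fst u ''E'' k))"
    for j and s :: store
  have "I k (fst ((den Q (If (Less (V ''j'') (V ''k'')) check_exponent Nop) ^^ N) u))"
  proof (rule rep_for[where K = 0])
    show "I 0 (fst u)" using assms by (simp add: I_def)
    fix j and u' :: "config" assume "I j (fst u')"
    then show "I (Suc j) (fst (den Q check_exponent u'))"
      by (cases "j < n"; cases "k < n"; cases "fst u ''E'' j = fst u ''E'' k")
        (auto simp: I_def check_exponent_def den_simps upd_apply less_Suc_eq)
  next
    fix j s assume "I j s"
    then show "(aval (Less (V ''j'') (V ''k'')) s \<noteq> 0) = (j < k)" by (simp add: I_def)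
  qed (use assms in simp_all)
  then show ?thesis by (simp add: I_def)
qed

lemma check_spec:
  assumes "fst u ''n'' 0 = int n" "fst u ''m'' 0 = int m" "fst u ''N'' 0 = int N" "m \<le> N"
  shows "fst (den Q check u) ''x'' 0 = 0 \<longleftrightarrow> fst u ''x'' 0 = 0 \<and>
    (\<forall>k<m. fst u ''C'' k \<noteq> 0 \<and> (\<forall>j<k. (j < n \<longleftrightarrow> k < n) \<longrightarrow> fst u ''E'' j \<noteq> fst u ''E'' k))"
proof -
  define I where "I k s \<longleftrightarrow> s ''k'' 0 = int k \<and> s ''n'' 0 = int n \<and> s ''m'' 0 = int m \<and> s ''N'' 0 = int N \<and>
     s ''C'' = fst u ''C'' \<and> s ''E'' = fst u ''E'' \<and>
     (s ''x'' 0 = 0 \<longleftrightarrow> fst u ''x'' 0 = 0 \<and>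
        (\<forall>k'<k. fst u ''C'' k' \<noteq> 0 \<and> (\<forall>j<k'. (j < n \<longleftrightarrow> k' < n) \<longrightarrow> fst u ''E'' j \<noteq> fst u ''E'' k')))"
    for k and s :: store
  have "I m (fst ((den Q (If (Less (V ''k'') (V ''m'')) check_term Nop) ^^ N) (den Q (Let1 ''k'' (Num 0)) u)))"
  proof (rule rep_for[where K = 0])
    show "I 0 (fst (den Q (Let1 ''k'' (Num 0)) u))" using assms by (simp add: I_def den_simps upd_apply)
    fix k and u' :: "config" assume I: "I k (fst u')" and k: "k < m"
    define u1 where "u1 = den Q (Let1 ''j'' (Num 0)) (den Q (If (Get ''C'' (V ''k'')) Nop (Let1 ''x'' (Num 1))) u')"
    define u2 where "u2 = (den Q (If (Less (V ''j'') (V ''k'')) check_exponent Nop) ^^ N) u1"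
    have 1: "fst u1 ''j'' 0 = 0" "fst u1 ''k'' 0 = int k" "fst u1 ''n'' 0 = int n" "fst u1 ''E'' = fst u ''E''"
      "fst u1 ''x'' 0 = 0 \<longleftrightarrow> fst u' ''x'' 0 = 0 \<and> fst u ''C'' k \<noteq> 0" "fst u1 ''N'' 0 = int N"
      using I by (auto simp: I_def u1_def den_simps upd_apply)
    have f: "fst u2 x = fst u' x" if "x \<notin> {''j'', ''x''}" for x
      using that by (simp add: u2_def u1_def frame frame_power mods_prog)
    have eq: "den Q check_term u' = den Q (Inc ''k'' 1) u2"
      using 1(6) by (simp add: check_term_def block.simps den.simps(1,5,7) u2_def u1_def[symmetric])
    have x: "fst u2 ''x'' 0 = 0 \<longleftrightarrow> fst u1 ''x'' 0 = 0 \<and> (\<forall>j<k. (j < n \<longleftrightarrow> k < n) \<longrightarrow> fst u ''E'' j \<noteq> fst u ''E'' k)"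
      unfolding u2_def 1(4)[symmetric] by (rule check_exponent_inner) (use 1 k assms(4) in simp_all)
    show "I (Suc k) (fst (den Q check_term u'))"
    proof -
      have "fst u2 ''k'' 0 = int k" "fst u2 ''n'' 0 = int n" "fst u2 ''m'' 0 = int m" "fst u2 ''N'' 0 = int N"
        "fst u2 ''C'' = fst u ''C''" "fst u2 ''E'' = fst u ''E''"
        using I by (simp_all add: f I_def)
      moreover have "fst u2 ''x'' 0 = 0 \<longleftrightarrow> fst u ''x'' 0 = 0 \<and>
        (\<forall>k'<Suc k. fst u ''C'' k' \<noteq> 0 \<and> (\<forall>j<k'. (j < n \<longleftrightarrow> k' < n) \<longrightarrow> fst u ''E'' j \<noteq> fst u ''E'' k'))"
        using I unfolding x 1(5) I_def All_less_Suc by (simp only: conj_ac)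
      ultimately show ?thesis unfolding eq by (simp add: I_def den_simps upd_apply)
    qed
  next
    fix k s assume "I k s"
    then show "(aval (Less (V ''k'') (V ''m'')) s \<noteq> 0) = (k < m)" by (simp add: I_def)
  qed (use assms in simp_all)
  moreover have "den Q check u = (den Q (If (Less (V ''k'') (V ''m'')) check_term Nop) ^^ N) (den Q (Let1 ''k'' (Num 0)) u)"
    using assms(3) by (simp add: check_def block.simps den.simps(1,2,5,7) upd_apply)
  ultimately show ?thesis by (simp add: I_def)
qed

section \<open>Euclid's algorithm and the content test\<close>

fun euclid :: "int \<times> int \<Rightarrow> int \<times> int" where
  "euclid (a, b) = (if b = 0 then (a, b) else (b, a mod b))"

lemma euclid_fixed: "(euclid ^^ k) (a, 0) = (a, 0)"
  by (induction k) auto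

text \<open>Two rounds of Euclid's algorithm halve the second entry, also for negative entries, as \<open>a mod b\<close> has the sign of \<open>b\<close>.\<close>

lemma mod_halves: "0 < b1 \<Longrightarrow> b1 < b \<Longrightarrow> 2 * (b mod b1) < (b :: int)"
proof -
  assume a: "0 < b1" "b1 < b"
  have "b mod b1 < b1" using a by simp
  moreover have "b div b1 \<ge> 1" using a by (simp add: pos_imp_zdiv_pos_iff int_one_le_iff_zero_less)
  then have "1 * b1 \<le> b div b1 * b1" using a(1) by (intro mult_right_mono) auto
  moreover have "b = b div b1 * b1 + b mod b1" by simp
  ultimately show ?thesis by linarith
qed

lemma mod_mod_halves:
  assumes "b \<noteq> 0" "a mod b \<noteq> (0 :: int)"
  shows "2 * \<bar>b mod (a mod b)\<bar> < \<bar>b\<bar>"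
proof (cases "b > 0")
  case True
  then have "0 \<le> a mod b" "a mod b < b" by simp_all
  then have "0 < a mod b" "a mod b < b" using assms by linarith+
  then show ?thesis using mod_halves[of "a mod b" b] by simp
next
  case False
  then have "b < 0" using assms by simp
  then have "a mod b \<le> 0" "b < a mod b" by simp_all
  then have 1: "0 < - (a mod b)" "- (a mod b) < - b" using assms by linarith+
  have "(- b) mod (- (a mod b)) = - (b mod (a mod b))" by (rule mod_minus_minus)
  moreover have "b mod (a mod b) \<le> 0" using 1 by simp
  ultimately show ?thesis using mod_halves[OF 1] \<open>b < 0\<close> by simp
qed

text \<open>Two rounds more than halve \<open>\<bar>b\<bar>\<close>, so \<open>2 * e\<close> rounds
  bring it to 0, and further rounds change nothing. Only the size of \<open>b\<close> enters, and
  the result is a gcd up to sign because \<open>mod\<close> takes the sign of the divisor.\<close>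

lemma euclid_power:
  "\<bar>b\<bar> < 2 ^ e \<Longrightarrow> 2 * e \<le> k \<Longrightarrow> \<exists>d. (euclid ^^ k) (a, b) = (d, 0) \<and> \<bar>d\<bar> = gcd a b"
proof (induction e arbitrary: a b k)
  case 0
  then show ?case by (simp add: euclid_fixed)
next
  case (Suc e)
  define k' where "k' = k - 2"
  have k: "k = Suc (Suc k')" "2 * e \<le> k'" using Suc.prems(2) by (simp_all add: k'_def)
  have two: "(euclid ^^ k) (a, b) = (euclid ^^ k') (euclid (euclid (a, b)))"
    by (simp only: k(1) funpow_Suc_right o_apply)
  show ?case
  proof (cases "b = 0")
    case True
    then show ?thesis by (simp add: euclid_fixed)
  next
    case b: False
    show ?thesis
    proof (cases "a mod b = 0")
      case True
      then have "(euclid ^^ k) (a, b) = (b, 0)"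
        using b unfolding two by (simp add: euclid_fixed)
      moreover have "gcd a b = \<bar>b\<bar>" using True by (metis gcd.commute gcd_red_int gcd_0_int)
      ultimately show ?thesis by simp
    next
      case False
      have "2 * \<bar>b mod (a mod b)\<bar> < \<bar>b\<bar>" by (rule mod_mod_halves[OF b False])
      then have "\<bar>b mod (a mod b)\<bar> < 2 ^ e" using Suc.prems(1) by simp
      from Suc.IH[OF this k(2), of "a mod b"] obtain d where
        "(euclid ^^ k') (a mod b, b mod (a mod b)) = (d, 0)" "\<bar>d\<bar> = gcd (a mod b) (b mod (a mod b))" by blast
      moreover have "(euclid ^^ k) (a, b) = (euclid ^^ k') (a mod b, b mod (a mod b))"
        using b False unfolding two by simp
      moreover have "gcd (a mod b) (b mod (a mod b)) = gcd a b" by (metis gcd.commute gcd_red_int)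
      ultimately show ?thesis by auto
    qed
  qed
qed

lemma gcd_step_spec:
  assumes "fst u ''N'' 0 = int N" "fst u ''k'' 0 = int k" "\<bar>fst u ''C'' k\<bar> < 2 ^ e" "2 * e \<le> N"
  shows "\<bar>fst (den Q gcd_step u) ''a'' 0\<bar> = gcd (fst u ''a'' 0) (fst u ''C'' k)"
    "fst (den Q gcd_step u) ''k'' 0 = int (Suc k)"
proof -
  define u1 where "u1 = den Q (Let1 ''b'' (Get ''C'' (V ''k''))) u"
  define u2 where "u2 = (den Q (If (V ''b'') euclid_step Nop) ^^ N) u1"
  have 1: "fst u1 ''a'' 0 = fst u ''a'' 0" "fst u1 ''b'' 0 = fst u ''C'' k" "fst u1 ''N'' 0 = int N" "fst u1 ''k'' 0 = int k"
    using assms by (simp_all add: u1_def den_simps upd_apply)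
  define I where "I j u' \<longleftrightarrow> (fst u' ''a'' 0, fst u' ''b'' 0) = (euclid ^^ j) (fst u ''a'' 0, fst u ''C'' k)"
    for j and u' :: "config"
  have "I N u2" unfolding u2_def
  proof (rule rep_inv)
    show "I 0 u1" using 1 by (simp add: I_def)
    fix j u' assume I: "I j u'"
    have "(euclid ^^ Suc j) (fst u ''a'' 0, fst u ''C'' k) = euclid (fst u' ''a'' 0, fst u' ''b'' 0)"
      using I by (simp add: I_def)
    then show "I (Suc j) (den Q (If (V ''b'') euclid_step Nop) u')"
      unfolding I_def by (auto simp: den_simps euclid_step_def upd_apply minus_div_mult_eq_mod)
  qed
  moreover obtain d where "(euclid ^^ N) (fst u ''a'' 0, fst u ''C'' k) = (d, 0)" "\<bar>d\<bar> = gcd (fst u ''a'' 0) (fst u ''C'' k)"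
    using euclid_power[OF assms(3,4)] by blast
  ultimately have 2: "\<bar>fst u2 ''a'' 0\<bar> = gcd (fst u ''a'' 0) (fst u ''C'' k)" by (simp add: I_def)
  have k2: "fst u2 ''k'' 0 = int k" using 1(4) by (simp add: u2_def frame_power mods_prog)
  have eq: "den Q gcd_step u = den Q (Inc ''k'' 1) u2"
    using 1(3) by (simp add: gcd_step_def block.simps den.simps(1,5,7) u2_def u1_def[symmetric])
  show "\<bar>fst (den Q gcd_step u) ''a'' 0\<bar> = gcd (fst u ''a'' 0) (fst u ''C'' k)"
    "fst (den Q gcd_step u) ''k'' 0 = int (Suc k)"
    using 2 k2 by (simp_all add: eq den_simps upd_apply)
qed

lemma contents_spec:
  assumes "fst u ''N'' 0 = int N" "fst u ''n'' 0 = int n" "fst u ''m'' 0 = int m" "fst u ''a'' 0 = 0" "fst u ''r'' 0 = 0"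
    and nm: "n \<le> m" "m \<le> N" and C: "\<And>k. k < n \<Longrightarrow> \<bar>fst u ''C'' k\<bar> < 2 ^ e" "2 * e \<le> N"
  shows "fst (den Q contents u) ''r'' 0 = 0 \<longleftrightarrow> content_ok (terms (fst u) 0 n) (terms (fst u) n m)"
proof -
  define u1 where "u1 = den Q (Let1 ''k'' (Num 0)) u"
  define u2 where "u2 = (den Q (If (Less (V ''k'') (V ''n'')) gcd_step Nop) ^^ N) u1"
  define u3 where "u3 = (den Q (If (Less (V ''k'') (V ''m'')) content_step Nop) ^^ N) u2"
  define I where "I k s \<longleftrightarrow> s ''k'' 0 = int k \<and> s ''n'' 0 = int n \<and> s ''N'' 0 = int N \<and> s ''C'' = fst u ''C'' \<and>
     \<bar>s ''a'' 0\<bar> = Gcd (fst u ''C'' ` {..<k})" for k and s :: store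
  have I2: "I n (fst u2)" unfolding u2_def
  proof (rule rep_for[where K = 0])
    show "I 0 (fst u1)" using assms by (simp add: I_def u1_def den_simps upd_apply)
    fix k and u' :: "config" assume I: "I k (fst u')" and k: "k < n"
    have "gcd (fst u' ''a'' 0) (fst u ''C'' k) = Gcd (fst u ''C'' ` {..<Suc k})"
    proof -
      have "Gcd (fst u ''C'' ` {..<Suc k}) = gcd (fst u ''C'' k) (Gcd (fst u ''C'' ` {..<k}))"
        by (simp add: lessThan_Suc)
      also have "Gcd (fst u ''C'' ` {..<k}) = \<bar>fst u' ''a'' 0\<bar>" using I by (simp add: I_def)
      finally show ?thesis by (simp add: gcd.commute)
    qed
    then show "I (Suc k) (fst (den Q gcd_step u'))"
      using I gcd_step_spec[of u' N k e Q] C(1)[OF k] C(2) by (simp add: I_def frame mods_prog)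
  next
    fix k s assume "I k s"
    then show "(aval (Less (V ''k'') (V ''n'')) s \<noteq> 0) = (k < n)" by (simp add: I_def)
  qed (use nm in simp_all)
  define a where "a = fst u2 ''a'' 0"
  have f2: "fst u2 x = fst u x" if "x \<notin> {''t'', ''a'', ''b'', ''k''}" for x
    using that by (simp add: u2_def u1_def frame_power frame mods_prog)
  define J where "J k s \<longleftrightarrow> s ''k'' 0 = int k \<and> s ''m'' 0 = int m \<and> s ''C'' = fst u ''C'' \<and> s ''a'' 0 = a \<and>
    (s ''r'' 0 = 0 \<longleftrightarrow> (\<forall>j. n \<le> j \<longrightarrow> j < k \<longrightarrow> a dvd fst u ''C'' j))" for k and s :: store
  \<comment> \<open>The loop starts at \<open>n\<close>, the index at which the gcd loop has
    stopped.\<close>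
  have J3: "J m (fst u3)" unfolding u3_def
  proof (rule rep_for[where K = n])
    show "J n (fst u2)" using I2 assms by (auto simp: J_def I_def f2 a_def)
    fix k and u' :: "config" assume J: "J k (fst u')" and k: "n \<le> k" "k < m"
    have "fst u ''C'' k - fst u ''C'' k div a * a = 0 \<longleftrightarrow> a dvd fst u ''C'' k"
      by (simp add: minus_div_mult_eq_mod dvd_eq_mod_eq_0)
    then show "J (Suc k) (fst (den Q content_step u'))"
      using J k by (auto simp: J_def content_step_def den_simps upd_apply less_Suc_eq)
  next
    fix k s assume "J k s"
    then show "(aval (Less (V ''k'') (V ''m'')) s \<noteq> 0) = (k < m)" by (simp add: J_def)
  qed (use nm in simp_all)
  have N: "fst u1 ''N'' 0 = int N" "fst u2 ''N'' 0 = int N"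
    using assms(1) by (simp_all add: u1_def u2_def frame frame_power mods_prog)
  then have eq: "den Q contents u = u3"
    by (simp add: contents_def block.simps den.simps(1,5,7) u3_def u2_def[symmetric] u1_def[symmetric])
  have s1: "\<bar>a\<bar> = Gcd (fst ` set (terms (fst u) 0 n))"
  proof -
    have "fst ` set (terms (fst u) 0 n) = fst u ''C'' ` {..<n}"
      unfolding terms_def by (simp add: image_image atLeast0LessThan)
    then show ?thesis using I2 by (simp add: I_def a_def)
  qed
  have s2: "fst ` set (terms (fst u) n m) = fst u ''C'' ` {n..<m}"
    unfolding terms_def by (simp add: image_image)
  have "content_ok (terms (fst u) 0 n) (terms (fst u) n m) \<longleftrightarrow> (\<forall>c\<in>fst u ''C'' ` {n..<m}. \<bar>a\<bar> dvd c)"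
    unfolding content_ok_def s1[symmetric] s2 ..
  also have "\<dots> \<longleftrightarrow> (\<forall>j. n \<le> j \<longrightarrow> j < m \<longrightarrow> a dvd fst u ''C'' j)" by auto
  finally have "content_ok (terms (fst u) 0 n) (terms (fst u) n m) \<longleftrightarrow> (\<forall>j. n \<le> j \<longrightarrow> j < m \<longrightarrow> a dvd fst u ''C'' j)" .
  then show ?thesis using J3 by (simp add: eq J_def)
qed

subsection \<open>The trials\<close>

lemma bval_less: "bval bs < 2 ^ length bs"
  by (induction bs) auto

text \<open>Doubling and adding makes the earliest coin the most significant bit, whereas
  \<open>bval\<close> is little-endian; hence \<open>rev\<close>.\<close>

lemma toss_spec:
  assumes "fst u ''p'' 0 = 0" "N \<le> length (snd u)"
  shows "fst ((den Q toss_digit ^^ N) u) ''p'' 0 = int (bval (rev (take N (snd u))))"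
    "snd ((den Q toss_digit ^^ N) u) = drop N (snd u)"
proof -
  define I where "I k u' \<longleftrightarrow> fst u' ''p'' 0 = int (bval (rev (take k (snd u)))) \<and> snd u' = drop k (snd u)"
    for k and u' :: "config"
  have "I N ((den Q toss_digit ^^ N) u)"
  proof (rule rep_inv)
    show "I 0 u" using assms by (simp add: I_def)
    fix k u' assume k: "k < N" and I: "I k u'"
    have "hd (drop k (snd u)) = snd u ! k" by (rule hd_drop_conv_nth) (use k assms in simp)
    moreover have "take (Suc k) (snd u) = take k (snd u) @ [snd u ! k]"
      using k assms by (simp add: take_Suc_conv_app_nth)
    ultimately show "I (Suc k) (den Q toss_digit u')"
      using I by (simp add: I_def toss_digit_def den_simps upd_apply drop_Suc tl_drop)
  qed
  then show "fst ((den Q toss_digit ^^ N) u) ''p'' 0 = int (bval (rev (take N (snd u))))"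
    "snd ((den Q toss_digit ^^ N) u) = drop N (snd u)" by (simp_all add: I_def)
qed

definition ready :: "nat \<Rightarrow> nat \<Rightarrow> (int \<times> nat) list \<Rightarrow> (int \<times> nat) list \<Rightarrow> store \<Rightarrow> bool" where
  "ready N M g f s \<longleftrightarrow> s ''N'' 0 = int N \<and> s ''M'' 0 = int M \<and> small N s \<and>
     (\<exists>n m. s ''n'' 0 = int n \<and> s ''m'' 0 = int m \<and> n \<le> N \<and> n \<le> m \<and> m \<le> n + N \<and>
        terms s 0 n = g \<and> terms s n m = f)"

definition success :: "bool list set \<Rightarrow> nat \<Rightarrow> (int \<times> nat) list \<Rightarrow> (int \<times> nat) list \<Rightarrow> nat \<Rightarrow> bool" where
  "success Q M g f p \<longleftrightarrow> length (question p g f) < M \<and> question p g f \<in> Q"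

lemma ready_cong:
  assumes "\<And>x. x \<in> {''N'', ''M'', ''C'', ''E'', ''n'', ''m''} \<Longrightarrow> s x = s' x"
  shows "ready N M g f s = ready N M g f s'"
proof -
  have "s ''N'' = s' ''N''" "s ''M'' = s' ''M''" "s ''C'' = s' ''C''" "s ''E'' = s' ''E''"
    "s ''n'' = s' ''n''" "s ''m'' = s' ''m''" using assms by auto
  then show ?thesis by (simp add: ready_def small_def terms_def)
qed

lemma trial_spec:
  assumes "ready N M g f (fst u)" "N \<le> length (snd u)"
  shows "snd (den Q trial u) = drop N (snd u)"
    "fst (den Q trial u) ''r'' 0 \<noteq> 0 \<longleftrightarrow>
       fst u ''r'' 0 \<noteq> 0 \<or> success Q M g f (bval (rev (take N (snd u))))"
    "ready N M g f (fst (den Q trial u))"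
proof -
  note fr = frame frame_power mods_prog
  show "ready N M g f (fst (den Q trial u))"
    using assms(1) by (subst ready_cong[of _ "fst u"]) (auto simp: fr)
  define P where "P = bval (rev (take N (snd u)))"
  have P: "P < 2 ^ N" using bval_less[of "rev (take N (snd u))"] assms(2) by (simp add: P_def)
  define u1 where "u1 = den Q (Let1 ''p'' (Num 0)) u"
  define u2 where "u2 = (den Q toss_digit ^^ N) u1"
  define u3 where "u3 = den Q (Let1 ''q'' (Num 0)) (den Q emit u2)"
  define u4 where "u4 = den Q (Ask ''q'' ''y'' (V ''l'')) u3"
  have N1: "fst u1 ''N'' 0 = int N" using assms(1) by (simp add: ready_def u1_def fr)
  have eq: "den Q trial u = den Q (If (V ''q'') (Let1 ''r'' (Num 1)) Nop) u4"
    using N1 by (simp add: trial_def block.simps den.simps(1,5,7) u4_def u3_def u2_def u1_def[symmetric])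
  have 1: "fst u1 ''p'' 0 = 0" "snd u1 = snd u" by (simp_all add: u1_def den_simps upd_apply)
  have 2: "fst u2 ''p'' 0 = int P" "snd u2 = drop N (snd u)"
    using toss_spec[OF 1(1), of N Q] assms(2) by (simp_all add: u2_def P_def 1(2))
  have r2: "ready N M g f (fst u2)"
    using assms(1) by (subst ready_cong[of _ "fst u"]) (auto simp: fr u2_def u1_def)
  then obtain n m where nm: "fst u2 ''n'' 0 = int n" "fst u2 ''m'' 0 = int m" "n \<le> N" "n \<le> m" "m \<le> n + N"
    "terms (fst u2) 0 n = g" "terms (fst u2) n m = f" "fst u2 ''N'' 0 = int N" "small N (fst u2)"
    by (auto simp: ready_def)
  have "outs (fst (den Q emit u2)) (question P g f)"
    using emit_spec[OF 2(1) nm(8,1-5,9) P, of Q] nm(6,7) by simp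
  then have o3: "outs (fst u3) (question P g f)"
    unfolding u3_def by (subst outs_cong[of _ "fst (den Q emit u2)"]) (simp_all add: fr)
  have q3: "fst u3 ''q'' 0 = 0" by (simp add: u3_def den_simps upd_apply)
  have s3: "snd u3 = drop N (snd u)"
    using 2(2) den_toss_free[OF toss_free_prog(2), of Q u2] by (simp add: u3_def den_simps)
  have M3: "fst u3 ''M'' 0 = int M" using assms(1) by (simp add: ready_def fr u3_def u2_def u1_def)
  have r3: "fst u3 ''r'' = fst u ''r''" by (simp add: fr u3_def u2_def u1_def)
  have l3: "fst u3 ''l'' 0 = int (length (question P g f))" using o3 by (simp add: outs_def)
  have y3: "map (\<lambda>i. fst u3 ''y'' i \<noteq> 0) [0..<length (question P g f)] = question P g f"
    using o3 by (intro nth_equalityI) (simp_all add: outs_def)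
  have 4: "fst u4 ''q'' 0 \<noteq> 0 \<longleftrightarrow> success Q M g f P"
    using q3 by (simp add: u4_def den_simps upd_apply l3 M3 y3 success_def)
  have r4: "fst u4 ''r'' = fst u ''r''" "snd u4 = drop N (snd u)"
    using r3 s3 by (simp_all add: u4_def den_simps upd_apply)
  show "snd (den Q trial u) = drop N (snd u)"
    unfolding eq using r4 by (simp add: den_simps)
  show "fst (den Q trial u) ''r'' 0 \<noteq> 0 \<longleftrightarrow> fst u ''r'' 0 \<noteq> 0 \<or> success Q M g f (bval (rev (take N (snd u))))"
    unfolding eq P_def[symmetric] using r4 4 by (simp add: den_simps upd_apply)
qed

lemma trials_spec:
  assumes "ready N M g f (fst u)" "T * N \<le> length (snd u)"
  shows "fst ((den Q trial ^^ T) u) ''r'' 0 \<noteq> 0 \<longleftrightarrow> fst u ''r'' 0 \<noteq> 0 \<or>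
    (\<exists>j<T. success Q M g f (bval (rev (take N (drop (j * N) (snd u))))))"
proof -
  define I where "I k u' \<longleftrightarrow> ready N M g f (fst u') \<and> snd u' = drop (k * N) (snd u) \<and>
    (fst u' ''r'' 0 \<noteq> 0 \<longleftrightarrow> fst u ''r'' 0 \<noteq> 0 \<or>
      (\<exists>j<k. success Q M g f (bval (rev (take N (drop (j * N) (snd u)))))))" for k and u' :: "config"
  have "I T ((den Q trial ^^ T) u)"
  proof (rule rep_inv)
    show "I 0 u" using assms by (simp add: I_def)
    fix k u' assume k: "k < T" and I: "I k u'"
    have "Suc k * N \<le> T * N" using k by (intro mult_le_mono1) simp
    then have "N \<le> length (snd u')" using I assms(2) by (simp add: I_def)
    then show "I (Suc k) (den Q trial u')"
      using I trial_spec[of N M g f u' Q] by (simp add: I_def Ex_less_Suc disj_ac)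
  qed
  then show ?thesis by (simp add: I_def)
qed

text \<open>Complements \<open>check_spec\<close>, whose assumption \<open>m \<le> N\<close> is
  available only after a successful comparison: a failed comparison cannot be undone by the later
  check.\<close>

lemma check_keeps:
  assumes "fst u ''x'' 0 \<noteq> 0"
  shows "fst (den Q check u) ''x'' 0 \<noteq> 0"
proof -
  define I where "I k u' \<longleftrightarrow> fst u' ''x'' 0 \<noteq> 0" for k :: nat and u' :: "config"
  have inner: "I k ((den Q (If (Less (V ''j'') (V ''k'')) check_exponent Nop) ^^ N) u')" if "I k u'" for k N u'
  proof -
    have "I N ((den Q (If (Less (V ''j'') (V ''k'')) check_exponent Nop) ^^ N) u')"
      by (rule rep_inv) (use that in \<open>auto simp: I_def check_exponent_def den_simps upd_apply\<close>)
    then show ?thesis by (simp add: I_def)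
  qed
  have step: "I k (den Q check_term u')" if "I k u'" for k u'
  proof -
    define u1 where "u1 = den Q (Let1 ''j'' (Num 0)) (den Q (If (Get ''C'' (V ''k'')) Nop (Let1 ''x'' (Num 1))) u')"
    have "I k u1" using that by (auto simp: I_def u1_def den_simps upd_apply)
    from inner[OF this, of "nat (fst u1 ''N'' 0)"] show ?thesis
      by (simp add: check_term_def block.simps den.simps(1,5,7) u1_def[symmetric]) (simp add: I_def den_simps upd_apply)
  qed
  define u1 where "u1 = den Q (Let1 ''k'' (Num 0)) u"
  have "I (nat (fst u1 ''N'' 0)) ((den Q (If (Less (V ''k'') (V ''m'')) check_term Nop) ^^ nat (fst u1 ''N'' 0)) u1)"
  proof (rule rep_inv)
    show "I 0 u1" using assms by (simp add: I_def u1_def den_simps upd_apply)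
    show "I (Suc k) (den Q (If (Less (V ''k'') (V ''m'')) check_term Nop) u')" if "I k u'" for k u'
      using step[OF that] that by (simp add: den.simps(1,6) I_def)
  qed
  then show ?thesis
    by (simp add: check_def block.simps den.simps(1,5,7) u1_def[symmetric] I_def)
qed

lemma sparse_terms_iff:
  assumes "small N s"
  shows "nonzero_terms (terms s a b) \<longleftrightarrow>
    (\<forall>k. a \<le> k \<longrightarrow> k < b \<longrightarrow> s ''C'' k \<noteq> 0 \<and> (\<forall>j. a \<le> j \<longrightarrow> j < k \<longrightarrow> s ''E'' j \<noteq> s ''E'' k))"
proof -
  have E: "nat (s ''E'' j) = nat (s ''E'' k) \<longleftrightarrow> s ''E'' j = s ''E'' k" for j k
    using assms by (simp add: small_def eq_nat_nat_iff)
  have "distinct (map snd (terms s a b)) \<longleftrightarrow> inj_on (\<lambda>j. nat (s ''E'' j)) {a..<b}"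
    by (simp add: terms_def distinct_map o_def)
  also have "\<dots> \<longleftrightarrow> (\<forall>k. a \<le> k \<longrightarrow> k < b \<longrightarrow> (\<forall>j. a \<le> j \<longrightarrow> j < k \<longrightarrow> s ''E'' j \<noteq> s ''E'' k))"
  proof
    assume i: "inj_on (\<lambda>j. nat (s ''E'' j)) {a..<b}"
    show "\<forall>k. a \<le> k \<longrightarrow> k < b \<longrightarrow> (\<forall>j. a \<le> j \<longrightarrow> j < k \<longrightarrow> s ''E'' j \<noteq> s ''E'' k)"
    proof (intro allI impI notI)
      fix k j assume jk: "a \<le> k" "k < b" "a \<le> j" "j < k" "s ''E'' j = s ''E'' k"
      then have "j = k" using inj_onD[OF i, of j k] by simp
      with jk show False by simp
    qed
  next
    assume d: "\<forall>k. a \<le> k \<longrightarrow> k < b \<longrightarrow> (\<forall>j. a \<le> j \<longrightarrow> j < k \<longrightarrow> s ''E'' j \<noteq> s ''E'' k)"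
    show "inj_on (\<lambda>j. nat (s ''E'' j)) {a..<b}"
    proof (rule inj_onI)
      fix j k assume jk: "j \<in> {a..<b}" "k \<in> {a..<b}" "nat (s ''E'' j) = nat (s ''E'' k)"
      then have e: "s ''E'' j = s ''E'' k" by (simp only: E)
      show "j = k"
      proof (rule linorder_cases[of j k])
        assume "j < k" then show ?thesis using d[rule_format, of k j] jk e by simp
      next
        assume "k < j" then show ?thesis using d[rule_format, of j k] jk e by simp
      qed
    qed
  qed
  finally have dist: "distinct (map snd (terms s a b)) \<longleftrightarrow>
    (\<forall>k. a \<le> k \<longrightarrow> k < b \<longrightarrow> (\<forall>j. a \<le> j \<longrightarrow> j < k \<longrightarrow> s ''E'' j \<noteq> s ''E'' k))" .
  have nz: "(\<forall>(c, n)\<in>set (terms s a b). c \<noteq> 0) \<longleftrightarrow> (\<forall>k. a \<le> k \<longrightarrow> k < b \<longrightarrow> s ''C'' k \<noteq> 0)"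
    by (auto simp: terms_def)
  show ?thesis unfolding sparse_list_def dist nz imp_conjR all_conj_distrib by (rule conj_commute)
qed

lemma sparse_terms_split:
  assumes "small N s" "n \<le> m"
  shows "(\<forall>k<m. s ''C'' k \<noteq> 0 \<and> (\<forall>j<k. (j < n \<longleftrightarrow> k < n) \<longrightarrow> s ''E'' j \<noteq> s ''E'' k)) \<longleftrightarrow>
    nonzero_terms (terms s 0 n) \<and> nonzero_terms (terms s n m)" (is "?L \<longleftrightarrow> ?R")
proof
  assume L: ?L
  have "s ''E'' j \<noteq> s ''E'' k" if "j < k" "k < m" "j < n \<longleftrightarrow> k < n" for j k using L that by blast
  then show ?R unfolding sparse_terms_iff[OF assms(1)] using L assms(2) by (auto simp: not_less)
next
  assume R: ?R
  show ?L
  proof (intro allI impI conjI)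
    fix k assume k: "k < m"
    then show "s ''C'' k \<noteq> 0" using R unfolding sparse_terms_iff[OF assms(1)] by (cases "k < n") auto
    fix j assume "j < k" "j < n \<longleftrightarrow> k < n"
    then show "s ''E'' j \<noteq> s ''E'' k"
      using R k unfolding sparse_terms_iff[OF assms(1)] by (cases "k < n") auto
  qed
qed

section \<open>Correctness of the whole program\<close>

lemma reduce_0 [simp]: "reduce 0 ts = ts"
  by (simp add: reduce_def case_prod_unfold)

lemma question_0: "question 0 g f = False # False # enc_poly g @ enc_poly f"
  by (simp add: question_def enc_nat_def)

lemma start_simps:
  "start w ''in'' = inp w" "start w ''len'' 0 = int (length w)" "start w ''N'' 0 = int (rounds (length w))"
  "start w ''M'' 0 = int (rounds (length w) * rounds (length w))"
  "x \<notin> {''in'', ''len'', ''N'', ''M''} \<Longrightarrow> start w x i = 0"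
  by (auto simp: start_def upd_apply init_store_def inp_def fun_eq_iff)

text \<open>Holds for every input: whatever terms the parser has stored, they fit into
  \<open>N\<close> bits and are written back faithfully, so passing the tests exhibits the input as
  an encoding of exactly these terms.\<close>

lemma main_prefix:
  fixes Q :: "bool list set" and w r :: "bool list"
  defines "N \<equiv> rounds (length w)"
  defines "u1 \<equiv> den Q parse (start w, r)"
  defines "u4 \<equiv> den Q check (den Q compare (den Q emit u1))"
  obtains n m where
    "fst u1 ''n'' 0 = int n" "fst u1 ''m'' 0 = int m" "n \<le> m" "n \<le> N" "m \<le> n + N" "small N (fst u1)"
    "fst u4 ''x'' 0 = 0 \<longleftrightarrow> w = enc_poly (terms (fst u1) 0 n) @ enc_poly (terms (fst u1) n m) \<and>
      nonzero_terms (terms (fst u1) 0 n) \<and> nonzero_terms (terms (fst u1) n m)"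
proof -
  note fr = frame mods_prog
  have st: "fst (start w, r) ''N'' 0 = int N" "fst (start w, r) ''k'' 0 = 0" "small N (fst (start w, r))"
    by (simp_all add: start_simps N_def small_def)
  obtain n m where nm: "fst u1 ''n'' 0 = int n" "fst u1 ''m'' 0 = int m" "n \<le> N" "n \<le> m" "m \<le> n + N"
    and sm: "small N (fst u1)"
    using parse_small[OF st, of Q] unfolding u1_def by blast
  define g where "g = terms (fst u1) 0 n"
  define f where "f = terms (fst u1) n m"
  define u2 where "u2 = den Q emit u1"
  define u3 where "u3 = den Q compare u2"
  have u4: "u4 = den Q check u3" by (simp add: u4_def u3_def u2_def)
  have b: "fst u1 ''p'' 0 = int 0" "fst u1 ''N'' 0 = int N" "fst u1 ''in'' = inp w" "fst u1 ''len'' 0 = int (length w)"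
    by (simp_all add: u1_def fr start_simps N_def)
  have o2: "outs (fst u2) (False # False # enc_poly g @ enc_poly f)"
    using emit_spec[OF b(1,2) nm sm, of Q] by (simp add: u2_def g_def f_def question_0)
  have wN: "length w \<le> N" by (simp add: N_def rounds_def)
  have x3: "fst u3 ''x'' 0 = 0 \<longleftrightarrow> w = enc_poly g @ enc_poly f"
    unfolding u3_def by (rule compare_spec[OF o2 _ _ _ wN]) (use b in \<open>simp_all add: u2_def fr\<close>)
  have f3: "fst u3 x = fst u1 x" if "x \<in> {''n'', ''m'', ''N'', ''C'', ''E''}" for x
    using that by (auto simp: u3_def u2_def fr)
  have "fst u4 ''x'' 0 = 0 \<longleftrightarrow> w = enc_poly g @ enc_poly f \<and>
     nonzero_terms g \<and> nonzero_terms f"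
  proof (cases "fst u3 ''x'' 0 = 0")
    case False
    then show ?thesis using x3 check_keeps[OF False, of Q] unfolding u4 by simp
  next
    case True
    then have w: "w = enc_poly g @ enc_poly f" using x3 by simp
    \<comment> \<open>Each parsed term occupies part of the input, since the comparison succeeded;
      in general \<open>m\<close> is only known to be at most \<open>2 * N\<close>.\<close>
    have "m = length g + length f" using nm by (simp add: g_def f_def)
    also have "\<dots> \<le> length w" using w length_enc_sparse_int(2)[of g] length_enc_sparse_int(2)[of f] by simp
    finally have "m \<le> N" using wN by simp
    then have "fst u4 ''x'' 0 = 0 \<longleftrightarrow>
      (\<forall>k<m. fst u1 ''C'' k \<noteq> 0 \<and> (\<forall>j<k. (j < n \<longleftrightarrow> k < n) \<longrightarrow> fst u1 ''E'' j \<noteq> fst u1 ''E'' k))"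
      using check_spec[of u3 n m N Q] True nm b by (simp add: u4 f3)
    also have "\<dots> \<longleftrightarrow> nonzero_terms g \<and> nonzero_terms f"
      unfolding sparse_terms_split[OF sm nm(4)] g_def f_def ..
    finally show ?thesis using w by simp
  qed
  then show ?thesis using that[OF nm(1,2,4,3,5) sm] by (simp add: g_def f_def)
qed

text \<open>No trial changes \<open>N\<close>, so the nested loops amount to \<open>N * N\<close>
  iterations of \<open>trial\<close>, and no step after the validity test changes
  \<open>x\<close>.\<close>

lemma main_effect:
  fixes Q :: "bool list set" and w r :: "bool list"
  defines "N \<equiv> rounds (length w)"
  defines "u1 \<equiv> den Q parse (start w, r)"
  defines "u4 \<equiv> den Q check (den Q compare (den Q emit u1))"
  shows "accepting (fst (den Q main (start w, r))) \<longleftrightarrow> fst u4 ''x'' 0 = 0 \<and>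
    fst ((den Q trial ^^ (N * N)) (den Q contents u4)) ''r'' 0 \<noteq> 0"
proof -
  note fr = frame frame_power mods_prog
  define u5 where "u5 = den Q contents u4"
  define u6 where "u6 = (den Q trial ^^ (N * N)) u5"
  have N: "nat (fst u5 ''N'' 0) = N" by (simp add: u5_def u4_def u1_def fr start_simps N_def)
  have N': "nat (fst u' ''N'' 0) = N" if "fst u' ''N'' = fst u5 ''N''" for u' :: "config" using N that by simp
  have "(den Q (Rep trial) ^^ k) u5 = ((den Q trial ^^ N) ^^ k) u5" for k
  proof (induction k)
    case (Suc k)
    have "fst ((den Q (Rep trial) ^^ k) u5) ''N'' = fst u5 ''N''" by (simp add: fr)
    from N'[OF this] show ?case using Suc by (simp add: den.simps(7))
  qed simp
  then have "den Q (Rep (Rep trial)) u5 = u6"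
    by (simp add: den.simps(7)[of Q "Rep trial"] N u6_def funpow_mult)
  then have "den Q main (start w, r) = den Q (If (V ''x'') Nop (Let1 ''out'' (V ''r''))) u6"
    by (simp only: main_def block.simps den.simps(1,5) u5_def u4_def u1_def)
  moreover have "fst u6 ''x'' = fst u4 ''x''" "fst u6 ''out'' 0 = 0"
    by (simp_all add: u6_def u5_def fr) (simp add: u4_def u1_def fr start_simps)
  ultimately show ?thesis by (auto simp: accepting_def den_simps upd_apply u6_def u5_def)
qed

lemma main_invalid:
  assumes "\<nexists>g f. w = enc_poly g @ enc_poly f \<and>
    nonzero_terms g \<and> nonzero_terms f"
  shows "\<not> accepting (fst (den Q main (start w, r)))"
proof -
  define u1 where "u1 = den Q parse (start w, r)"
  define u4 where "u4 = den Q check (den Q compare (den Q emit u1))"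
  obtain n m where
    "fst u4 ''x'' 0 = 0 \<longleftrightarrow> w = enc_poly (terms (fst u1) 0 n) @ enc_poly (terms (fst u1) n m) \<and>
      nonzero_terms (terms (fst u1) 0 n) \<and> nonzero_terms (terms (fst u1) n m)"
    unfolding u1_def u4_def by (rule main_prefix[of Q w r])
  then have "fst u4 ''x'' 0 \<noteq> 0" using assms by blast
  then show ?thesis unfolding main_effect u4_def u1_def by simp
qed

lemma main_valid:
  assumes w: "w = enc_poly g @ enc_poly f"
    and sp: "nonzero_terms g" "nonzero_terms f"
    and N: "N = rounds (length w)" and r: "N * N * N \<le> length r"
  shows "accepting (fst (den Q main (start w, r))) \<longleftrightarrow> \<not> content_ok g f \<or>
    (\<exists>j<N * N. success Q (N * N) g f (bval (rev (take N (drop (j * N) r)))))"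
proof -
  note fr = frame frame_power mods_prog
  define u1 where "u1 = den Q parse (start w, r)"
  define u4 where "u4 = den Q check (den Q compare (den Q emit u1))"
  define u5 where "u5 = den Q contents u4"
  have wN: "2 * length w \<le> N" "length w \<le> N" by (simp_all add: N rounds_def)
  have p: "terms (fst u1) 0 (length g) = g" "terms (fst u1) (length g) (length g + length f) = f"
    "fst u1 ''n'' 0 = int (length g)" "fst u1 ''m'' 0 = int (length g + length f)"
    using parse_spec[of "(start w, r)" w N g f Q] w wN by (simp_all add: u1_def start_simps N)
  obtain n m where nm: "fst u1 ''n'' 0 = int n" "fst u1 ''m'' 0 = int m" "n \<le> m" "n \<le> N" "m \<le> n + N"
    and sm: "small N (fst u1)"
    and x: "fst u4 ''x'' 0 = 0 \<longleftrightarrow> w = enc_poly (terms (fst u1) 0 n) @ enc_poly (terms (fst u1) n m) \<and>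
      nonzero_terms (terms (fst u1) 0 n) \<and> nonzero_terms (terms (fst u1) n m)"
    unfolding u1_def u4_def N by (rule main_prefix[of Q w r])
  have nm': "n = length g" "m = length g + length f" using nm p by simp_all
  have x4: "fst u4 ''x'' 0 = 0" using x w sp p unfolding nm' by simp
  have f4: "fst u4 x = fst u1 x" if "x \<in> {''n'', ''m'', ''N'', ''M'', ''C'', ''E'', ''a'', ''r''}" for x
    using that by (auto simp: u4_def fr)
  have t4: "terms (fst u4) a b = terms (fst u1) a b" for a b by (simp add: terms_def f4)
  have s4: "snd u4 = r" using toss_free_prog by (simp add: u4_def u1_def den_toss_free)
  have mN: "m \<le> N"
    using w wN length_enc_sparse_int(2)[of g] length_enc_sparse_int(2)[of f] by (simp add: nm')
  have C: "\<bar>fst u4 ''C'' k\<bar> < 2 ^ length w" if "k < n" for k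
  proof -
    have "g ! k = (fst u1 ''C'' k, nat (fst u1 ''E'' k))" using p(1) that nm'(1)
      by (metis (no_types, lifting) terms_def nth_map_upt diff_zero add_0)
    then have "(fst u1 ''C'' k, nat (fst u1 ''E'' k)) \<in> set g" using that nm'(1) by (metis nth_mem)
    then have "length (bits_of (nat \<bar>fst u1 ''C'' k\<bar>)) \<le> length w"
      using length_enc_sparse_int(1)[of "fst u1 ''C'' k" _ g] w by fastforce
    then have "(2::nat) ^ length (bits_of (nat \<bar>fst u1 ''C'' k\<bar>)) \<le> 2 ^ length w" by (intro power_increasing) simp_all
    then have "nat \<bar>fst u1 ''C'' k\<bar> < 2 ^ length w"
      using less_power_length_bits_of[of "nat \<bar>fst u1 ''C'' k\<bar>"] by linarith
    then show ?thesis by (simp add: f4 nat_less_iff)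
  qed
  have N4: "fst u4 ''N'' 0 = int N" "fst u4 ''M'' 0 = int (N * N)" "fst u4 ''a'' 0 = 0" "fst u4 ''r'' 0 = 0"
    by (simp_all add: f4) (simp_all add: u1_def fr start_simps N)
  have c5: "fst u5 ''r'' 0 = 0 \<longleftrightarrow> content_ok g f"
    using contents_spec[of u4 N n m "length w" Q] N4 nm(1-3) mN C wN p unfolding nm' u5_def
    by (simp add: f4 t4)
  have "ready N (N * N) g f (fst u5)"
  proof -
    have f5: "fst u5 x = fst u1 x" if "x \<in> {''n'', ''m'', ''N'', ''M'', ''C'', ''E''}" for x
      using that f4[of x] by (auto simp: u5_def fr)
    have "small N (fst u5)" using sm by (simp add: small_def f5)
    moreover have "terms (fst u5) a b = terms (fst u1) a b" for a b by (simp add: terms_def f5)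
    moreover have "fst u1 ''N'' 0 = int N" "fst u1 ''M'' 0 = int (N * N)" using N4(1,2) by (simp_all add: f4)
    ultimately show ?thesis unfolding ready_def using nm p
      by (intro conjI exI[of _ n] exI[of _ m]) (simp_all add: f5 nm')
  qed
  moreover have "snd u5 = r" using toss_free_prog s4 by (simp add: u5_def den_toss_free)
  ultimately have "fst ((den Q trial ^^ (N * N)) u5) ''r'' 0 \<noteq> 0 \<longleftrightarrow> \<not> content_ok g f \<or>
    (\<exists>j<N * N. success Q (N * N) g f (bval (rev (take N (drop (j * N) r)))))"
    using trials_spec[of N "N * N" g f u5 "N * N" Q] r c5 by simp
  then show ?thesis
    using x4 unfolding main_effect u5_def u4_def u1_def N by simp
qed

subsection \<open>Probability of success\<close>

lemma card_lists_length: "card {r :: bool list. length r = m} = 2 ^ m"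
  using card_lists_length_eq[of "UNIV :: bool set" m] by (simp add: card_UNIV_bool)

lemma finite_lists_length: "finite {r :: bool list. length r = m \<and> P r}"
  by (rule finite_subset[OF _ finite_lists_length_eq[of "UNIV :: bool set" m]]) auto

text \<open>Independence of the trials as a count: cutting off the first block is a bijection onto
  pairs, and the \<open>e\<close> surplus coins are free.\<close>

lemma card_blocks:
  fixes P :: "bool list \<Rightarrow> bool"
  shows "card {r. length r = T * N + e \<and> (\<forall>j<T. P (take N (drop (j * N) r)))} =
    card {b. length b = N \<and> P b} ^ T * 2 ^ e"
proof (induction T)
  case 0
  then show ?case by (simp add: card_lists_length)
next
  case (Suc T)
  let ?A = "{b. length b = N \<and> P b}"
  let ?F = "{r. length r = T * N + e \<and> (\<forall>j<T. P (take N (drop (j * N) r)))}"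
  let ?G = "{r. length r = Suc T * N + e \<and> (\<forall>j<Suc T. P (take N (drop (j * N) r)))}"
  have "bij_betw (\<lambda>(b, r). b @ r) (?A \<times> ?F) ?G"
  proof (rule bij_betwI[where g = "\<lambda>r. (take N r, drop N r)"])
    show "(\<lambda>(b, r). b @ r) \<in> ?A \<times> ?F \<rightarrow> ?G"
      by (auto simp: All_less_Suc2)
    show "(\<lambda>r. (take N r, drop N r)) \<in> ?G \<rightarrow> ?A \<times> ?F"
      by (auto simp: All_less_Suc2 add.commute)
  qed auto
  then have "card (?A \<times> ?F) = card ?G" by (rule bij_betw_same_card)
  then have "card ?G = card ?A * card ?F" by (simp only: card_cartesian_product)
  also have "\<dots> = card ?A ^ Suc T * 2 ^ e" unfolding Suc by simp
  finally show ?case .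
qed

text \<open>Reading coins as binary digits is injective on lists of length \<open>N\<close>, and
  there are as many lists as numbers below \<open>2 ^ N\<close>; so the candidates are uniformly
  distributed.\<close>

lemma card_bval:
  assumes "S \<subseteq> {..<2 ^ N}"
  shows "card {b. length b = N \<and> bval (rev b) \<in> S} = card S"
proof -
  let ?L = "{b :: bool list. length b = N}"
  let ?h = "\<lambda>b. bval (rev b)"
  have bval_inj: "bval b = bval b' \<Longrightarrow> length b = length b' \<Longrightarrow> b = b'" for b b'
  proof (induction b arbitrary: b')
    case (Cons x b)
    then obtain y c where b': "b' = y # c" by (cases b') auto
    have "of_bool x + 2 * bval b = of_bool y + 2 * bval c" using Cons.prems b' by simp
    then have "x = y \<and> bval b = bval c" by (cases x; cases y) (simp_all; presburger)+
    then show ?case using Cons b' by simp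
  qed simp
  have inj: "inj_on ?h ?L" by (rule inj_onI) (use bval_inj in fastforce)
  have "?h ` ?L \<subseteq> {..<2 ^ N}" using bval_less[of "rev _"] by auto
  moreover have "card (?h ` ?L) = card {..<(2::nat) ^ N}"
    using card_image[OF inj] card_lists_length[of N] by simp
  ultimately have img: "?h ` ?L = {..<2 ^ N}" by (intro card_subset_eq) simp_all
  have "?h ` {b. length b = N \<and> ?h b \<in> S} = ?h ` ?L \<inter> S" by auto
  also have "\<dots> = S" unfolding img using assms by (rule Int_absorb1)
  finally have "?h ` {b. length b = N \<and> ?h b \<in> S} = S" .
  moreover have "inj_on ?h {b. length b = N \<and> ?h b \<in> S}" by (rule inj_on_subset[OF inj]) auto
  ultimately show ?thesis by (metis card_image)
qed

lemma prob_lists: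
  "measure_pmf.prob (pmf_of_set {r :: bool list. length r = m}) A = card {r. length r = m \<and> r \<in> A} / 2 ^ m"
proof -
  have "finite {r :: bool list. length r = m}" "{r :: bool list. length r = m} \<noteq> {}"
    using finite_lists_length[of m "\<lambda>_. True"] Ex_list_of_length[of m] by auto
  note measure_pmf_of_set[OF this(2,1), of A]
  also have "{r. length r = m} \<inter> A = {r. length r = m \<and> r \<in> A}" by auto
  finally show ?thesis by (simp add: card_lists_length)
qed

text \<open>All trials miss \<open>S\<close> with probability at most
  \<open>(1 - 1 / (2 * N)) ^ (N * N)\<close>, which is at most \<open>exp (- N / 2)\<close> and, by
  \<open>N \<ge> 16\<close>, at most \<open>exp (- 2)\<close>.\<close>

lemma prob_some_block:
  assumes S: "S \<subseteq> {..<2 ^ N}" "2 ^ N \<le> 2 * N * card S" and N: "N \<ge> 16" and m: "m \<ge> N ^ 3"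
  shows "measure_pmf.prob (pmf_of_set {r :: bool list. length r = m})
    {r. \<exists>j<N * N. bval (rev (take N (drop (j * N) r))) \<in> S} \<ge> 2 / 3"
proof -
  define T where "T = N * N"
  define e where "e = m - T * N"
  have me: "m = T * N + e" using m by (simp add: e_def T_def power3_eq_cube)
  define F where "F = {r :: bool list. length r = m \<and> (\<forall>j<T. bval (rev (take N (drop (j * N) r))) \<notin> S)}"
  define X where "X = {r :: bool list. \<exists>j<T. bval (rev (take N (drop (j * N) r))) \<in> S}"
  have cS: "card S \<le> 2 ^ N" using card_mono[OF _ S(1)] by simp
  have "card {b. length b = N \<and> bval (rev b) \<notin> S} = 2 ^ N - card S"
  proof -
    have "{b. length b = N \<and> bval (rev b) \<notin> S} = {b. length b = N} - {b. length b = N \<and> bval (rev b) \<in> S}" by auto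
    then show ?thesis
      using card_Diff_subset[OF finite_lists_length[of N "\<lambda>b. bval (rev b) \<in> S"], of "{b. length b = N}"]
      by (simp add: card_bval[OF S(1)] card_lists_length Collect_mono)
  qed
  then have F: "card F = (2 ^ N - card S) ^ T * 2 ^ e"
    unfolding F_def me using card_blocks[of T N e "\<lambda>b. bval (rev b) \<notin> S"] by simp
  have fF: "finite F" unfolding F_def by (rule finite_lists_length)
  have "{r. length r = m \<and> r \<in> X} = {r. length r = m} - F" by (auto simp: F_def X_def)
  moreover have "card ({r. length r = m} - F) = 2 ^ m - card F"
    using card_Diff_subset[OF fF, of "{r. length r = m}"] by (auto simp: F_def card_lists_length)
  moreover have "card F \<le> 2 ^ m"
    unfolding F me power_add power_mult[of 2 T N] mult.commute[of T N] power_mult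
    by (intro mult_le_mono power_mono) simp_all
  ultimately have c: "real (card {r. length r = m \<and> r \<in> X}) = 2 ^ m - real (card F)"
    by (simp add: of_nat_diff)
  define y where "y = 1 / (2 * real N)"
  have y: "0 \<le> y" "y \<le> 1" using N by (simp_all add: y_def)
  have "real (card F) / 2 ^ m = (1 - real (card S) / 2 ^ N) ^ T"
  proof -
    have "real (card F) = (2 ^ N - real (card S)) ^ T * 2 ^ e" using cS by (simp add: F of_nat_diff)
    moreover have "(2::real) ^ m = (2 ^ N) ^ T * 2 ^ e" unfolding me power_add mult.commute[of T N] power_mult ..
    ultimately have "real (card F) / 2 ^ m = ((2 ^ N - real (card S)) / 2 ^ N) ^ T" by (simp add: power_divide)
    then show ?thesis by (simp add: diff_divide_distrib)
  qed
  also have "\<dots> \<le> (1 - y) ^ T"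
  proof (rule power_mono)
    have "real (2 ^ N) \<le> real (2 * N * card S)" using S(2) by (simp only: of_nat_le_iff)
    then have "y \<le> real (card S) / 2 ^ N" using N by (simp add: y_def field_simps)
    then show "1 - real (card S) / 2 ^ N \<le> 1 - y" by simp
    have "real (card S) \<le> real (2 ^ N)" using cS by (simp only: of_nat_le_iff)
    then show "0 \<le> 1 - real (card S) / 2 ^ N" by (simp add: field_simps)
  qed
  also have "\<dots> \<le> exp (- y) ^ T" using y exp_ge_add_one_self[of "- y"] by (intro power_mono) auto
  also have "\<dots> = exp (- (real N / 2))"
    using N by (simp add: exp_of_nat_mult[symmetric] T_def y_def field_simps)
  also have "\<dots> \<le> exp (- 2)" using N by simp
  also have "\<dots> \<le> 1 / 3"
  proof -
    have "1 + 2 \<le> exp (2::real)" by (rule exp_ge_add_one_self)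
    then show ?thesis by (simp add: exp_minus field_simps)
  qed
  finally have "real (card F) / 2 ^ m \<le> 1 / 3" .
  then have "2 / 3 \<le> real (card {r. length r = m \<and> r \<in> X}) / 2 ^ m"
    unfolding c by (simp add: diff_divide_distrib)
  then show ?thesis unfolding prob_lists X_def[symmetric] T_def[symmetric] by simp
qed

text \<open>Reduction may lengthen a coefficient, as -1 becomes \<open>p - 1\<close>, but to at most
  \<open>N\<close> bits. Every term already has three bits of overhead, so the factor
  \<open>2 * N + 1\<close> pays for the growth.\<close>

lemma length_question:
  assumes "0 < p" "p < 2 ^ N"
  shows "length (question p g f) \<le> 2 * N + 2 + (2 * N + 1) * length (enc_poly g @ enc_poly f)"
proof -
  have bits: "length (bits_of (nat \<bar>c mod int p\<bar>)) \<le> N" for c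
  proof (rule length_bits_of_le)
    have "0 \<le> c mod int p" "c mod int p < int p" using assms(1) by simp_all
    then have "nat \<bar>c mod int p\<bar> < p" by linarith
    then show "nat \<bar>c mod int p\<bar> < 2 ^ N" using assms(2) by linarith
  qed
  have "length (enc_poly (reduce p ts)) \<le> (2 * N + 1) * length (enc_poly ts)" for ts
  proof (induction ts)
    case (Cons t ts)
    obtain c n where t: "t = (c, n)" by (cases t)
    have "length (enc_poly (reduce p (t # ts))) =
      length (bits_of (nat \<bar>c mod int p\<bar>)) * 2 + 3 + length (enc_nat n) + length (enc_poly (reduce p ts))"
      by (simp add: t reduce_def length_enc_int)
    also have "\<dots> \<le> N * 2 + 3 + length (enc_nat n) + (2 * N + 1) * length (enc_poly ts)"
      using bits[of c] Cons by simp
    also have "\<dots> \<le> (2 * N + 1) * (3 + length (enc_nat n)) + (2 * N + 1) * length (enc_poly ts)"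
      by (simp add: algebra_simps)
    also have "\<dots> = (2 * N + 1) * (3 + length (enc_nat n) + length (enc_poly ts))"
      by (simp only: distrib_left)
    also have "\<dots> \<le> (2 * N + 1) * length (enc_poly (t # ts))"
      by (intro mult_le_mono2) (simp add: t length_enc_int)
    finally show ?case .
  qed (simp add: reduce_def)
  from this[of g] this[of f] length_bits_of_le[OF assms(2)] show ?thesis
    by (simp add: question_def length_enc_nat distrib_left)
qed

theorem mainTheorem3:
  shows "rand_poly_turing_reducible nondiv_Z nondiv_Fq"
proof (rule reducible_by_prog[OF good_main])
  fix w :: "bool list" and m
  assume m: "rounds (length w) ^ 3 \<le> m"
  define N where "N = rounds (length w)"
  define acc where "acc r \<longleftrightarrow> accepting (fst (den nondiv_Fq main (start w, r)))" for r
  define D where "D = {r :: bool list. length r = m}"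
  \<comment> \<open>For the cases in which the coins do not influence the answer.\<close>
  have sure: "measure_pmf.prob (pmf_of_set D) {r. acc r \<longleftrightarrow> w \<in> nondiv_Z} \<ge> 2 / 3"
    if "\<And>r. length r = m \<Longrightarrow> acc r \<longleftrightarrow> w \<in> nondiv_Z"
  proof -
    have "{r. length r = m \<and> r \<in> {r. acc r \<longleftrightarrow> w \<in> nondiv_Z}} = D" using that by (auto simp: D_def)
    then show ?thesis unfolding D_def prob_lists by (simp add: D_def[symmetric]) (simp add: D_def card_lists_length)
  qed
  have "measure_pmf.prob (pmf_of_set D) {r. acc r \<longleftrightarrow> w \<in> nondiv_Z} \<ge> 2 / 3"
  proof (cases "\<exists>g f. w = enc_poly g @ enc_poly f \<and>
      nonzero_terms g \<and> nonzero_terms f")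
    case False
    then have "w \<notin> nondiv_Z" unfolding nondiv_Z_def by blast
    then show ?thesis using main_invalid[OF False] by (intro sure) (simp add: acc_def)
  next
    case True
    then obtain g f where w: "w = enc_poly g @ enc_poly f"
      and sp: "nonzero_terms g" "nonzero_terms f" by blast
    have dist: "distinct (map snd g)" "distinct (map snd f)" using sp by (auto simp: sparse_list_def)
    have acc: "acc r \<longleftrightarrow> \<not> content_ok g f \<or>
      (\<exists>j<N * N. success nondiv_Fq (N * N) g f (bval (rev (take N (drop (j * N) r)))))" if "length r = m" for r
      unfolding acc_def
      by (rule main_valid[OF w sp N_def]) (use m that in \<open>simp add: N_def power3_eq_cube\<close>)
    have mem: "w \<in> nondiv_Z \<longleftrightarrow> \<not> spoly g dvd spoly f" unfolding w nondiv_Z_iff using sp by simp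
    \<comment> \<open>In the first case no query can succeed, in the second the contents already
      give the answer; only the third depends on the coins.\<close>
    consider "spoly g dvd spoly f" | "\<not> spoly g dvd spoly f" "\<not> content_ok g f"
      | "\<not> spoly g dvd spoly f" "content_ok g f" by blast
    then show ?thesis
    proof cases
      case 1
      then show ?thesis using dvd_imp_no_success[OF dist 1] acc mem by (intro sure) (simp add: success_def)
    next
      case 2
      then show ?thesis using acc mem by (intro sure) simp
    next
      case 3
      define S where "S = {p. p < 2 ^ N \<and> question p g f \<in> nondiv_Fq}"
      have "length (question p g f) < N * N" if "p \<in> S" for p
      proof -
        have "p < 2 ^ N" "0 < p" using that prime_gt_0_nat unfolding S_def question_in_iff by auto
        then have "length (question p g f) \<le> 2 * N + 2 + (2 * N + 1) * length w"
          using length_question[of p N g f] by (simp add: w)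
        \<comment> \<open>Since \<open>N\<close> is 16 times the successor of the input length, the
          queries for good primes pass the length guard \<open>M = N * N\<close>.\<close>
        also have "\<dots> < N * N"
          by (simp add: N_def rounds_def algebra_simps)
        finally show ?thesis .
      qed
      then have succ: "success nondiv_Fq (N * N) g f p" if "p \<in> S" for p
        using that by (simp add: success_def S_def)
      have "2 / 3 \<le> measure_pmf.prob (pmf_of_set D) {r. \<exists>j<N * N. bval (rev (take N (drop (j * N) r))) \<in> S}"
        unfolding D_def
      proof (rule prob_some_block)
        show "2 ^ N \<le> 2 * N * card S"
          using many_successes[OF sp 3 refl] unfolding S_def N_def w .
        show "N ^ 3 \<le> m" using m by (simp add: N_def)
      qed (auto simp: S_def N_def rounds_def)
      also have "\<dots> \<le> measure_pmf.prob (pmf_of_set D) {r. acc r \<longleftrightarrow> w \<in> nondiv_Z}"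
        unfolding D_def prob_lists
      proof (intro divide_right_mono of_nat_mono card_mono finite_lists_length)
        show "{r. length r = m \<and> r \<in> {r. \<exists>j<N * N. bval (rev (take N (drop (j * N) r))) \<in> S}}
          \<subseteq> {r. length r = m \<and> r \<in> {r. acc r \<longleftrightarrow> w \<in> nondiv_Z}}"
          using acc succ mem 3 by blast
      qed simp
      finally show ?thesis .
    qed
  qed
  then show "2 / 3 \<le> measure_pmf.prob (pmf_of_set {r. length r = m})
      {r. accepting (fst (den nondiv_Fq main (start w, r))) \<longleftrightarrow> w \<in> nondiv_Z}"
    by (simp only: D_def acc_def)
qed

end
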